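(* Let $d\ge 0$ and $r\ge d+1$ be integers. Let $X$ be a $d$-Leray simplicial complex with vertex set $V$. Let $M$ be a matroid of rank $r$ that is a subcomplex of $X$ with the same vertex set $V$. Then $M$ has a basis $B$ such that $$\sum_{v\in B}\delta_X\bigl(V\setminus\operatorname{span}_M(B\setminus\{v\})\bigr)\ \ge\ 0 .$$
   Context: A simplicial complex $K$ is a finite nonempty family of finite sets (faces) closed under taking subsets (so $\varnothing\in K$); its vertex set $V(K)$ is the union of its faces. For $W\subseteq V(K)$, $K[W]=\{\sigma\in K:\sigma\subseteq W\}$. For $\tau\in K$, the link is $\operatorname{lk}(K,\tau)=\{\sigma\in K:\sigma\cap\tau=\varnothing,\ \sigma\cup\tau\in K\}$. $\widetilde H_i(K)$, $i\ge -1$, is reduced simplicial homology over $\mathbb Z$, with $\widetilde H_{-1}(\{\varnothing\})\cong\mathbb Z$ and $\widetilde H_{-1}(K)=0$ if $K$ has a vertex. The Leray number is $$L(K)=\min\{j\ge 0:\widetilde H_i(K[W])=0\text{ for all }W\subseteq V(K)\text{ and all }i\ge j\},$$ and $K$ is $d$-Leray if $L(K)\le d$. The *link-Leray dimension* of a set $W\subseteq V(K)$ is $\delta_K(W)=L(\operatorname{lk}(K,W))$ if $W\in K$, and $\delta_K(W)=-1$ otherwise. A matroid $M$ is a simplicial complex (of independent sets) satisfying the exchange axiom: if $A,B\in M$, $|A|<|B|$, then $A\cup\{x\}\in M$ for some $x\in B\setminus A$. Bases are the inclusion-maximal independent sets, the rank is their common size, $\rho_M(W)$ is the rank of $M[W]$,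 and $\operatorname{span}_M(A)=\{v\in V:\rho_M(A\cup\{v\})=\rho_M(A)\}$. *)

theory Defs
  imports "HOL-Algebra.Elementary_Groups" "HOL-Combinatorics.Permutations"
begin

section \<open>Simplicial complexes\<close>

definition simplicial_complex :: "'a set set \<Rightarrow> bool" where
  "simplicial_complex K \<longleftrightarrow>
     finite K \<and> K \<noteq> {} \<and> (\<forall>\<sigma>\<in>K. finite \<sigma>) \<and> (\<forall>\<sigma>\<in>K. \<forall>\<tau>. \<tau> \<subseteq> \<sigma> \<longrightarrow> \<tau> \<in> K)"

definition vertex_set :: "'a set set \<Rightarrow> 'a set" where
  "vertex_set K = \<Union>K"

definition induced :: "'a set set \<Rightarrow> 'a set \<Rightarrow> 'a set set" where
  "induced K W = {\<sigma> \<in> K. \<sigma> \<subseteq> W}"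

definition link :: "'a set set \<Rightarrow> 'a set \<Rightarrow> 'a set set" where
  "link K \<tau> = {\<sigma> \<in> K. \<sigma> \<inter> \<tau> = {} \<and> \<sigma> \<union> \<tau> \<in> K}"

section \<open>Reduced simplicial homology over the integers\<close>

text \<open>
  An ordered \<open>i\<close>-simplex is a list of \<open>i + 1\<close> distinct vertices spanning a face. An oriented
  \<open>i\<close>-chain is an integer-valued function on the ordered \<open>i\<close>-simplices, extended by \<open>0\<close> to all
  other lists, that is multiplied by the sign of \<open>p\<close> when the vertices are permuted by \<open>p\<close>.
  The oriented simplex \<open>[v\<^sub>0, \<dots>, v\<^sub>i]\<close> is the function whose value is the sign of \<open>p\<close> on the
  list obtained by rearranging \<open>v\<^sub>0, \<dots>, v\<^sub>i\<close> by \<open>p\<close>. For \<open>i = - 1\<close> the only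
  ordered simplex is the empty list, so the complex is the augmented one.
  No finite-support condition is needed, because complexes are finite.
\<close>

definition ordered_simplices :: "int \<Rightarrow> 'a set set \<Rightarrow> 'a list set" where
  "ordered_simplices i K = {xs. distinct xs \<and> set xs \<in> K \<and> int (length xs) = i + 1}"

definition oriented_chains :: "int \<Rightarrow> 'a set set \<Rightarrow> ('a list \<Rightarrow> int) set" where
  "oriented_chains i K =
     {c. (\<forall>xs. xs \<notin> ordered_simplices i K \<longrightarrow> c xs = 0) \<and>
         (\<forall>xs p. p permutes {..<length xs} \<longrightarrow> c (permute_list p xs) = sign p * c xs)}"

definition chain_group :: "int \<Rightarrow> 'a set set \<Rightarrow> ('a list \<Rightarrow> int) monoid" where
  "chain_group i K =
     \<lparr>carrier = oriented_chains i K, monoid.mult = (\<lambda>a b xs. a xs + b xs), one = (\<lambda>xs. 0)\<rparr>"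

text \<open>
  On oriented simplices this is the usual formula
  \<open>\<partial>[v\<^sub>0, \<dots>, v\<^sub>i] = (\<Sum>j\<le>i. (- 1) ^ j * [v\<^sub>0, \<dots>, v\<^sub>j\<^sub>-\<^sub>1, v\<^sub>j\<^sub>+\<^sub>1, \<dots>, v\<^sub>i])\<close>: moving \<open>v\<^sub>j\<close> to
  the front is a permutation of sign \<open>(- 1) ^ j\<close>. On \<open>0\<close>-chains it is the augmentation.
\<close>

definition boundary_map :: "'a set set \<Rightarrow> ('a list \<Rightarrow> int) \<Rightarrow> ('a list \<Rightarrow> int)" where
  "boundary_map K c = (\<lambda>ys. \<Sum>v\<in>vertex_set K. c (v # ys))"

definition cycles :: "int \<Rightarrow> 'a set set \<Rightarrow> ('a list \<Rightarrow> int) set" where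
  "cycles i K = kernel (chain_group i K) (chain_group (i - 1) K) (boundary_map K)"

definition boundaries :: "int \<Rightarrow> 'a set set \<Rightarrow> ('a list \<Rightarrow> int) set" where
  "boundaries i K = boundary_map K ` carrier (chain_group (i + 1) K)"

definition reduced_homology :: "int \<Rightarrow> 'a set set \<Rightarrow> ('a list \<Rightarrow> int) set monoid" where
  "reduced_homology i K = (chain_group i K)\<lparr>carrier := cycles i K\<rparr> Mod boundaries i K"

section \<open>Leray numbers and link-Leray dimension\<close>

definition leray_number :: "'a set set \<Rightarrow> nat" where
  "leray_number K =
     (LEAST j. \<forall>W\<subseteq>vertex_set K. \<forall>i\<ge>int j. trivial_group (reduced_homology i (induced K W)))"

definition leray :: "nat \<Rightarrow> 'a set set \<Rightarrow> bool" where
  "leray d K \<longleftrightarrow> leray_number K \<le> d"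

definition link_leray_dim :: "'a set set \<Rightarrow> 'a set \<Rightarrow> int" where
  "link_leray_dim K W = (if W \<in> K then int (leray_number (link K W)) else - 1)"

section \<open>Matroids\<close>

definition matroid :: "'a set set \<Rightarrow> bool" where
  "matroid M \<longleftrightarrow> simplicial_complex M \<and>
     (\<forall>A\<in>M. \<forall>B\<in>M. card A < card B \<longrightarrow> (\<exists>x\<in>B - A. A \<union> {x} \<in> M))"

definition bases :: "'a set set \<Rightarrow> 'a set set" where
  "bases M = {B \<in> M. \<forall>A\<in>M. B \<subseteq> A \<longrightarrow> A = B}"

definition matroid_rank :: "'a set set \<Rightarrow> nat" where
  "matroid_rank M = (THE n. \<forall>B\<in>bases M. card B = n)"

definition rank_of :: "'a set set \<Rightarrow> 'a set \<Rightarrow> nat" where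
  "rank_of M W = matroid_rank (induced M W)"

definition matroid_span :: "'a set set \<Rightarrow> 'a set \<Rightarrow> 'a set" where
  "matroid_span M A = {v \<in> vertex_set M. rank_of M (A \<union> {v}) = rank_of M A}"

end

(*
  The key fact is that some flat F of M has V - F in X and rank F <= L(lk(X, A)) for all
  A contained in V - F. Extending a basis I of F to a basis B of M, every v in B - I has
  V - span(B - v) contained in V - F, hence contributes at least rank F to the sum, while the
  rank F many elements of I contribute at least -1 each.

  The key fact is a Lefschetz-type argument. Suppose it fails. One constructs for every tau
  contained in V a chain h(tau) of X, of dimension |tau|, all of whose faces contain the set
  D(tau) = V - span(V - tau), such that the boundary of h(tau) agrees, on faces containing
  D(tau), with the sum of the h(tau - x) up to signs and up to chains that avoid some element
  of tau; moreover h of the empty set is a point. Comparing the coefficients of tau itself and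
  summing over all tau gives 0 = 1.

  For the construction one needs chains for all cubes [sigma, tau] of subsets of V. The cycle to
  be filled lives in the link of D(tau), where it bounds if its dimension is at least rank F - 1,
  F = span(V - tau). In lower dimensions one compares with the chains which can be found inside
  the matroid restricted to F, as a matroid is acyclic below its top dimension. These comparisons
  have to be coherent for chains of flats, so that flags of flats are carried along as an
  additional index.
*)
theory Submission
  imports Defs
begin

section \<open>Signed chains on subsets of a finite ground set\<close>

text \<open>Enlarging a face does not raise the Leray number of its link, so failure of the key fact
  gives \<open>L(lk(X, V - G)) < rk G\<close> for every flat \<open>G\<close> with
  \<open>V - G\<close> in \<open>X\<close>. For a cell \<open>(\<sigma>, E, F)\<close> with
  \<open>D = core (\<sigma> \<union> E)\<close>, \<open>\<Phi> = V - D\<close> and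
  \<open>\<sigma>\<close> disjoint from \<open>D\<close>, the faces to be filled have
  \<open>card (E \<inter> \<Phi>) + card F\<close> vertices outside \<open>D\<close>. If this number
  is at least \<open>rk \<Phi>\<close>, the link of \<open>D\<close> fills them (when
  \<open>D\<close> is not in \<open>X\<close> there is nothing to fill). Otherwise the same
  inequality says that \<open>\<Phi>\<close> may be added to the flag, and the cells with the longer
  flag contain the wanted filling: dropping \<open>\<Phi>\<close> in their boundary gives back the
  original flag. The two constructions leave no gap. Chains of a cell avoid \<open>\<sigma>\<close>.
  The upper facet of a cube in direction \<open>x\<close> has \<open>x\<close> in its base point, so
  its chain has coefficient 0 at every face containing \<open>x\<close>. This removes the unwanted
  terms both in the trace and in the filling of low cells.\<close>

definition esign :: "('b \<Rightarrow> 'b \<Rightarrow> bool) \<Rightarrow> 'b \<Rightarrow> 'b set \<Rightarrow> int" where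
  "esign r x A = (-1) ^ card {y \<in> A. r y x}"

lemma esign_square [simp]: "esign r x A * esign r x A = 1"
  by (simp add: esign_def flip: power_mult_distrib)

lemma esign_square_left [simp]: "esign r x A * (esign r x A * z) = z"
  by (simp flip: mult.assoc)

lemma esign_insert:
  assumes "finite A" "y \<notin> A"
  shows "esign r x (insert y A) = (if r y x then - 1 else 1) * esign r x A"
proof (cases "r y x")
  case True
  then have "{z \<in> insert y A. r z x} = insert y {z \<in> A. r z x}" by auto
  then show ?thesis using True assms by (simp add: esign_def)
next
  case False
  then have "{z \<in> insert y A. r z x} = {z \<in> A. r z x}" by auto
  then show ?thesis using False assms by (simp add: esign_def)
qed

lemma esign_insert_self: "\<not> r x x \<Longrightarrow> esign r x (insert x A) = esign r x A"
  unfolding esign_def by (rule arg_cong[where f="\<lambda>B. (-1) ^ card B"]) auto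

lemma esign_eq_1: "(\<And>y. y \<in> A \<Longrightarrow> \<not> r y x) \<Longrightarrow> esign r x A = 1"
  by (simp add: esign_def) (metis (mono_tags, lifting) card_0_eq card.infinite empty_Collect_eq power_0)

lemma esign_Un:
  assumes "finite A" "finite B" "A \<inter> B = {}"
  shows "esign r x (A \<union> B) = esign r x A * esign r x B"
proof -
  have "{y \<in> A \<union> B. r y x} = {y \<in> A. r y x} \<union> {y \<in> B. r y x}" by auto
  moreover have "card \<dots> = card {y \<in> A. r y x} + card {y \<in> B. r y x}"
    using assms by (intro card_Un_disjoint) auto
  ultimately show ?thesis by (simp add: esign_def power_add)
qed

text \<open>Exactly one of \<open>x\<close> and \<open>y\<close> precedes the other, so deleting
  that one flips the sign of the other. Every vanishing of an iterated boundary below comes from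
  this; \<open>r\<close> will be the order of positions on vertices and strict inclusion on the
  members of a flag.\<close>

lemma esign_swap:
  assumes "finite A" "x \<in> A" "y \<in> A" "x \<noteq> y" "r x y \<longleftrightarrow> \<not> r y x" "\<not> r x x" "\<not> r y y"
  shows "esign r x A * esign r y (A - {x}) = - (esign r y A * esign r x (A - {y}))"
proof -
  define B where "B = A - {x, y}"
  have B: "finite B" "x \<notin> B" "y \<notin> B" "A = insert x (insert y B)" "A - {x} = insert y B" "A - {y} = insert x B"
    using assms by (auto simp: B_def)
  have "esign r x A = esign r x (insert y B)"
    unfolding B(4) by (rule esign_insert_self) (rule assms)
  moreover have "esign r y A = esign r y (insert x B)"
    unfolding B(4) by (subst insert_commute) (rule esign_insert_self, rule assms)
  ultimately show ?thesis using B assms by (auto simp: esign_insert esign_insert_self)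
qed

lemma sum_antisymmetric:
  fixes g :: "'b \<Rightarrow> 'b \<Rightarrow> int"
  assumes "finite A" "\<And>x y. x \<in> A \<Longrightarrow> y \<in> A \<Longrightarrow> x \<noteq> y \<Longrightarrow> g x y = - g y x"
  shows "(\<Sum>x\<in>A. \<Sum>y\<in>A-{x}. g x y) = 0"
proof -
  let ?S = "\<Sum>x\<in>A. \<Sum>y\<in>A-{x}. g x y"
  have "?S = (\<Sum>x\<in>A. \<Sum>y | y \<in> A \<and> x \<noteq> y. g x y)"
    by (intro sum.cong) auto
  also have "\<dots> = (\<Sum>y\<in>A. \<Sum>x | x \<in> A \<and> x \<noteq> y. g x y)"
    using assms(1) by (rule sum.swap_restrict)  (rule assms(1))
  also have "\<dots> = (\<Sum>y\<in>A. \<Sum>x\<in>A-{y}. - g y x)"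
  proof (intro sum.cong refl)
    fix y x assume "y \<in> A" "x \<in> A - {y}"
    then show "g x y = - g y x" using assms(2)[of x y] by blast
  qed auto
  also have "\<dots> = - ?S" by (simp add: sum_negf)
  finally show ?thesis by simp
qed

text \<open>The degree \<open>k\<close> counts vertices, one more than the dimension;
  \<open>k = 0\<close> is the augmented degree, carried by the empty face.\<close>

definition chain_on :: "'a set set \<Rightarrow> nat \<Rightarrow> ('a set \<Rightarrow> int) \<Rightarrow> bool" where
  "chain_on S k c \<longleftrightarrow> (\<forall>\<rho>. c \<rho> \<noteq> 0 \<longrightarrow> \<rho> \<in> S \<and> card \<rho> = k)"

lemma chain_onI: "(\<And>\<rho>. c \<rho> \<noteq> 0 \<Longrightarrow> \<rho> \<in> S \<and> card \<rho> = k) \<Longrightarrow> chain_on S k c"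
  by (simp add: chain_on_def)

lemma chain_onD: "chain_on S k c \<Longrightarrow> c \<rho> \<noteq> 0 \<Longrightarrow> \<rho> \<in> S \<and> card \<rho> = k"
  by (simp add: chain_on_def)

lemma induced_subset: "induced K W \<subseteq> K"
  by (auto simp: induced_def)

locale ordered_ground =
  fixes V :: "'a set" and pos :: "'a \<Rightarrow> nat"
  assumes finite_V: "finite V" and inj_pos: "inj_on pos V"
begin

abbreviation es :: "'a \<Rightarrow> 'a set \<Rightarrow> int" where
  "es \<equiv> esign (\<lambda>y x. pos y < pos x)"

lemma finite_sub: "A \<subseteq> V \<Longrightarrow> finite A"
  using finite_V by (rule finite_subset[rotated])

text \<open>The boundary is given by its coefficient at \<open>\<rho>\<close>, a signed sum over
  cofaces, so it makes sense for any function on sets and for any complex on \<open>V\<close> at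
  once. Sets \<open>\<rho>\<close> not inside \<open>V\<close> are disposed of by
  \<open>bd_outside\<close>.\<close>

definition bd :: "('a set \<Rightarrow> int) \<Rightarrow> 'a set \<Rightarrow> int" where
  "bd c \<rho> = (\<Sum>x\<in>V-\<rho>. es x \<rho> * c (insert x \<rho>))"

lemma es_swap:
  assumes "A \<subseteq> V" "x \<in> A" "y \<in> A" "x \<noteq> y"
  shows "es x A * es y (A - {x}) = - (es y A * es x (A - {y}))"
proof -
  have "pos x \<noteq> pos y" using assms inj_pos by (auto dest: inj_onD)
  then show ?thesis using assms finite_V by (intro esign_swap) (auto intro: finite_subset)
qed

lemma es_insert_swap:
  assumes "A \<subseteq> V" "x \<in> V - A" "y \<in> V - A" "x \<noteq> y"
  shows "es x A * es y (insert x A) = - (es y A * es x (insert y A))"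
proof -
  have *: "insert x (insert y A) - {x} = insert y A" "insert x (insert y A) - {y} = insert x A"
    using assms by auto
  have "es x (insert x (insert y A)) = es x (insert y A)"
    by (rule esign_insert_self) simp
  moreover have "es y (insert x (insert y A)) = es y (insert x A)"
    by (subst insert_commute) (rule esign_insert_self, simp)
  moreover have "es x (insert y A) * es y (insert y A) = - (es y (insert x A) * es x (insert x A))"
    using es_swap[of "insert x (insert y A)" x y] assms * calculation by auto
  moreover have "es y (insert y A) = es y A" "es x (insert x A) = es x A"
    by (simp_all add: esign_insert_self)
  ultimately show ?thesis by (simp add: mult.commute)
qed

lemma bd_add: "bd (\<lambda>\<rho>. c \<rho> + d \<rho>) \<rho> = bd c \<rho> + bd d \<rho>"
  by (simp add: bd_def algebra_simps sum.distrib)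

lemma bd_diff: "bd (\<lambda>\<rho>. c \<rho> - d \<rho>) \<rho> = bd c \<rho> - bd d \<rho>"
  by (simp add: bd_def algebra_simps sum_subtractf)

lemma bd_uminus: "bd (\<lambda>\<rho>. - c \<rho>) \<rho> = - bd c \<rho>"
  by (simp add: bd_def sum_negf)

lemma bd_scale: "bd (\<lambda>\<rho>. a * c \<rho>) \<rho> = a * bd c \<rho>"
  by (simp add: bd_def sum_distrib_left mult.left_commute)

lemma bd_sum: "bd (\<lambda>\<rho>. \<Sum>i\<in>I. c i \<rho>) \<rho> = (\<Sum>i\<in>I. bd (c i) \<rho>)"
  unfolding bd_def sum_distrib_left by (rule sum.swap)

lemma bd_cong:
  assumes "\<And>x. x \<in> V - \<rho> \<Longrightarrow> c (insert x \<rho>) = d (insert x \<rho>)"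
  shows "bd c \<rho> = bd d \<rho>"
  unfolding bd_def using assms by (intro sum.cong) auto

lemma bd_eq_0: "(\<And>x. x \<in> V - \<rho> \<Longrightarrow> c (insert x \<rho>) = 0) \<Longrightarrow> bd c \<rho> = 0"
  by (simp add: bd_def)

lemma bd_bd:
  assumes "\<rho> \<subseteq> V"
  shows "bd (bd c) \<rho> = 0"
proof -
  have "bd (bd c) \<rho> = (\<Sum>x\<in>V-\<rho>. \<Sum>y\<in>V-\<rho>-{x}. es x \<rho> * es y (insert x \<rho>) * c (insert y (insert x \<rho>)))"
    unfolding bd_def
  proof (intro sum.cong refl)
    fix x
    have "V - insert x \<rho> = V - \<rho> - {x}" by blast
    then show "es x \<rho> * (\<Sum>y\<in>V - insert x \<rho>. es y (insert x \<rho>) * c (insert y (insert x \<rho>))) =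
        (\<Sum>y\<in>V - \<rho> - {x}. es x \<rho> * es y (insert x \<rho>) * c (insert y (insert x \<rho>)))"
      by (simp only: sum_distrib_left mult.assoc)
  qed
  also have "\<dots> = 0"
  proof (rule sum_antisymmetric)
    fix x y assume "x \<in> V - \<rho>" "y \<in> V - \<rho>" "x \<noteq> y"
    then show "es x \<rho> * es y (insert x \<rho>) * c (insert y (insert x \<rho>)) =
        - (es y \<rho> * es x (insert y \<rho>) * c (insert x (insert y \<rho>)))"
      using es_insert_swap[OF assms, of x y] by (simp only: insert_commute[of x y]) simp
  qed (simp add: finite_V)
  finally show ?thesis .
qed

lemma bd_outside:
  assumes "chain_on S k c" "S \<subseteq> Pow V" "\<not> \<rho> \<subseteq> V"
  shows "bd c \<rho> = 0"
  using assms by (intro bd_eq_0) (auto dest!: chain_onD)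

end

section \<open>From oriented chains to set chains\<close>

lemma permute_list_transpose:
  "permute_list (Transposition.transpose (length us) (length us + Suc (length ms))) (us @ x # ms @ y # vs) = us @ y # ms @ x # vs"
proof (rule nth_equalityI)
  fix k assume "k < length (permute_list (Transposition.transpose (length us) (length us + Suc (length ms))) (us @ x # ms @ y # vs))"
  then have k: "k < length us + length ms + length vs + 2" by simp
  let ?i = "length us" and ?j = "length us + Suc (length ms)"
  have perm: "Transposition.transpose ?i ?j permutes {..<length (us @ x # ms @ y # vs)}"
    by (intro permutes_swap_id) auto
  have eq: "permute_list (Transposition.transpose ?i ?j) (us @ x # ms @ y # vs) ! k = (us @ x # ms @ y # vs) ! (Transposition.transpose ?i ?j k)"
    using k by (intro permute_list_nth perm) auto
  consider "k = ?i" | "k = ?j" | "k \<noteq> ?i" "k \<noteq> ?j" by blast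
  then show "permute_list (Transposition.transpose ?i ?j) (us @ x # ms @ y # vs) ! k = (us @ y # ms @ x # vs) ! k"
  proof cases
    case 3
    then show ?thesis unfolding eq by (auto simp: nth_append nth_Cons' transpose_apply_other)
  qed (unfold eq, auto simp: nth_append nth_Cons')
qed simp

text \<open>Induction on the block between the two entries: \<open>x\<close> passes its first entry,
  the shorter exchange is made, then \<open>y\<close> passes that entry. Three sign changes amount
  to one.\<close>

lemma alternating_transpose:
  fixes \<Phi> :: "'a list \<Rightarrow> int"
  assumes adj: "\<And>us x y vs. \<Phi> (us @ x # y # vs) = - \<Phi> (us @ y # x # vs)"
  shows "\<Phi> (us @ x # ms @ y # vs) = - \<Phi> (us @ y # ms @ x # vs)"
proof (induction ms arbitrary: us)
  case Nil
  then show ?case using adj[of us x y vs] by simp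
next
  case (Cons m ms)
  have "\<Phi> (us @ x # (m # ms) @ y # vs) = - \<Phi> (us @ m # x # ms @ y # vs)"
    using adj[of us x m "ms @ y # vs"] by simp
  also have "\<dots> = \<Phi> (us @ m # y # ms @ x # vs)"
    using Cons[of "us @ [m]"] by simp
  also have "\<dots> = - \<Phi> (us @ y # m # ms @ x # vs)"
    by (rule adj)
  finally show ?case by simp
qed

text \<open>Permutations are products of transpositions, so adjacent exchanges suffice. This is how
  a function on lists built from a set chain is recognised as an oriented chain.\<close>

lemma alternating_permute:
  fixes \<Phi> :: "'a list \<Rightarrow> int"
  assumes adj: "\<And>us x y vs. \<Phi> (us @ x # y # vs) = - \<Phi> (us @ y # x # vs)"
    and "p permutes {..<length xs}"
  shows "\<Phi> (permute_list p xs) = sign p * \<Phi> xs"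
proof -
  have "\<forall>xs. length xs = n \<longrightarrow> \<Phi> (permute_list p xs) = sign p * \<Phi> xs" if "p permutes {..<n}" for n
    using that finite_lessThan
  proof (induction rule: permutes_induct)
    case id
    then show ?case by (simp add: permute_list_id)
  next
    case (swap a b p)
    show ?case
    proof (intro allI impI)
      fix xs :: "'a list" assume len: "length xs = n"
      have swap_lt: "\<Phi> (permute_list (Transposition.transpose i j) xs) = - \<Phi> xs" if "i < j" "j < n" for i j
      proof -
        define us x ms y vs where "us = take i xs" and "x = xs ! i"
          and "ms = take (j - i - 1) (drop (Suc i) xs)" and "y = xs ! j" and "vs = drop (Suc j) xs"
        have "xs = us @ x # drop (Suc i) xs"
          using that len by (simp add: us_def x_def id_take_nth_drop)
        moreover have "drop (Suc i) xs = ms @ y # vs"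
          using id_take_nth_drop[of "j - i - 1" "drop (Suc i) xs"] that len
          by (simp add: ms_def y_def vs_def)
        ultimately have xs: "xs = us @ x # ms @ y # vs" by simp
        have "length us = i" "length us + Suc (length ms) = j"
          using that len by (auto simp: us_def ms_def)
        then show ?thesis
          using permute_list_transpose[of us ms x y vs] alternating_transpose[of \<Phi>, OF adj, of us x ms y vs] xs
          by simp
      qed
      have t: "\<Phi> (permute_list (Transposition.transpose a b) xs) = - \<Phi> xs"
      proof (cases "a < b")
        case True
        then show ?thesis using swap_lt swap by simp
      next
        case False
        then have "b < a" using swap by simp
        then show ?thesis using swap_lt[of b a] swap by (simp add: transpose_commute)
      qed
      have "permute_list (Transposition.transpose a b \<circ> p) xs = permute_list p (permute_list (Transposition.transpose a b) xs)"
        using swap len by (intro permute_list_compose) (simp add: permutes_swap_id)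
      moreover have "sign (Transposition.transpose a b \<circ> p) = - sign p"
        using swap by (subst sign_compose) (auto simp: sign_swap_id intro: permutation_swap_id permutes_imp_permutation)
      ultimately show "\<Phi> (permute_list (Transposition.transpose a b \<circ> p) xs) = sign (Transposition.transpose a b \<circ> p) * \<Phi> xs"
        using swap t len by simp
    qed
  qed
  then show ?thesis using assms(2) by blast
qed

lemma oriented_chains_adjacent:
  assumes "c \<in> oriented_chains i K"
  shows "c (us @ x # y # vs) = - c (us @ y # x # vs)"
proof -
  let ?t = "Transposition.transpose (length us) (length us + Suc (length ([] :: 'a list)))"
  have "?t permutes {..<length (us @ x # [] @ y # vs)}"
    by (intro permutes_swap_id) auto
  then have "c (permute_list ?t (us @ x # [] @ y # vs)) = sign ?t * c (us @ x # [] @ y # vs)"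
    using assms unfolding oriented_chains_def by blast
  then have "c (us @ y # [] @ x # vs) = sign ?t * c (us @ x # [] @ y # vs)"
    by (simp only: permute_list_transpose)
  moreover have "sign ?t = - 1"
    by (simp add: sign_swap_id)
  ultimately show ?thesis by simp
qed

section \<open>Sorting signs, and vanishing homology as existence of fillings\<close>

context ordered_ground
begin

text \<open>The sign of the permutation that sorts the list: each factor counts the later vertices
  of smaller position, so the exponents add up to the number of inversions.\<close>

primrec list_sign :: "'a list \<Rightarrow> int" where
  "list_sign [] = 1"
| "list_sign (x # xs) = es x (set xs) * list_sign xs"

lemma list_sign_adjacent:
  assumes "distinct (us @ x # y # vs)" "set (us @ x # y # vs) \<subseteq> V"
  shows "list_sign (us @ x # y # vs) = - list_sign (us @ y # x # vs)"
  using assms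
proof (induction us)
  case Nil
  then have "es x (insert y (set vs)) * es y (set vs) = - (es y (insert x (set vs)) * es x (set vs))"
    using es_insert_swap[of "set vs" x y] by (simp add: mult.commute)
  then show ?case by (simp flip: mult.assoc)
next
  case (Cons u us)
  then show ?case by (simp add: insert_commute)
qed

definition sorted_enum :: "'a set \<Rightarrow> 'a list" where
  "sorted_enum A = sort_key pos (SOME xs. set xs = A \<and> distinct xs)"

lemma sorted_enum:
  assumes "A \<subseteq> V"
  shows "set (sorted_enum A) = A" "distinct (sorted_enum A)" "sorted (map pos (sorted_enum A))"
    "length (sorted_enum A) = card A"
proof -
  have "\<exists>xs. set xs = A \<and> distinct xs"
    by (rule finite_distinct_list[OF finite_subset[OF assms finite_V]])
  then have *: "set (SOME xs. set xs = A \<and> distinct xs) = A \<and> distinct (SOME xs. set xs = A \<and> distinct xs)"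
    by (rule someI_ex)
  then show "set (sorted_enum A) = A" "distinct (sorted_enum A)" "sorted (map pos (sorted_enum A))"
    by (simp_all add: sorted_enum_def)
  then show "length (sorted_enum A) = card A"
    by (metis distinct_card)
qed

lemma sorted_enum_unique:
  assumes "set xs \<subseteq> V" "distinct xs" "sorted (map pos xs)"
  shows "sorted_enum (set xs) = xs"
proof -
  note e = sorted_enum[OF assms(1)]
  have "inj_on pos (set xs)" using assms(1) inj_pos by (rule inj_on_subset[rotated])
  then have "map pos (sorted_enum (set xs)) = map pos xs"
    using e assms by (intro sorted_distinct_set_unique) (auto simp: distinct_map)
  then show ?thesis
    using \<open>inj_on pos (set xs)\<close> e(1) by (auto dest: map_inj_on)
qed

lemma list_sign_sorted:
  "distinct xs \<Longrightarrow> set xs \<subseteq> V \<Longrightarrow> sorted (map pos xs) \<Longrightarrow> list_sign xs = 1"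
proof (induction xs)
  case (Cons x xs)
  then have "es x (set xs) = 1" by (intro esign_eq_1) (auto simp: not_less)
  then show ?case using Cons by simp
qed simp

text \<open>Sorted insertion moves \<open>x\<close> past exactly the vertices of smaller position,
  one sign change for each. The prefix \<open>us\<close> is arbitrary because the induction shifts
  the passed vertices into it.\<close>

lemma alternating_insort:
  assumes adj: "\<And>us x y vs. b (us @ x # y # vs) = - b (us @ y # x # vs)"
    and "x \<notin> set xs" "set xs \<subseteq> V" "x \<in> V" "distinct xs" "sorted (map pos xs)"
  shows "b (us @ x # xs) = es x (set xs) * b (us @ insort_key pos x xs)"
  using assms(2-)
proof (induction xs arbitrary: us)
  case Nil
  then show ?case by (simp add: esign_def)
next
  case (Cons y ys)
  show ?case
  proof (cases "pos x \<le> pos y")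
    case True
    then have "es x (set (y # ys)) = 1" using Cons.prems by (intro esign_eq_1) (auto simp: not_less)
    then show ?thesis using True by simp
  next
    case False
    have "b (us @ x # y # ys) = - b ((us @ [y]) @ x # ys)" using adj[of us x y ys] by simp
    also have "\<dots> = - (es x (set ys) * b ((us @ [y]) @ insort_key pos x ys))"
      using Cons.prems by (subst Cons.IH) auto
    also have "\<dots> = es x (set (y # ys)) * b (us @ insort_key pos x (y # ys))"
      using False Cons.prems by (simp add: esign_insert)
    finally show ?thesis .
  qed
qed

lemma alternating_sorted_enum:
  assumes adj: "\<And>us x y vs. b (us @ x # y # vs) = - b (us @ y # x # vs)"
    and "\<rho> \<subseteq> V" "x \<in> V - \<rho>"
  shows "b (x # sorted_enum \<rho>) = es x \<rho> * b (sorted_enum (insert x \<rho>))"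
proof -
  note e = sorted_enum[OF assms(2)]
  have "sorted_enum (set (insort_key pos x (sorted_enum \<rho>))) = insort_key pos x (sorted_enum \<rho>)"
    using e assms by (intro sorted_enum_unique) (auto simp: set_insort_key sorted_insort_key distinct_insort_key distinct_insort)
  then have "sorted_enum (insert x \<rho>) = insort_key pos x (sorted_enum \<rho>)"
    using e by (simp add: set_insort_key)
  then show ?thesis
    using alternating_insort[of b x "sorted_enum \<rho>" "[]", OF adj] e assms by auto
qed

text \<open>Leray number at most \<open>j\<close>, stated through fillings. Since \<open>k\<close>
  counts vertices, \<open>k > j\<close> means dimension \<open>k - 1 \<ge> j\<close>.\<close>

definition bounding_from :: "nat \<Rightarrow> 'a set set \<Rightarrow> bool" where
  "bounding_from j K \<longleftrightarrow> (\<forall>W\<subseteq>V. \<forall>k>j. \<forall>z. chain_on (induced K W) k z \<longrightarrow> (\<forall>\<rho>. bd z \<rho> = 0) \<longrightarrow>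
     (\<exists>y. chain_on (induced K W) (Suc k) y \<and> (\<forall>\<rho>. bd y \<rho> = z \<rho>)))"

lemma bounding_fromD:
  assumes "bounding_from j K" "W \<subseteq> V" "j < k" "chain_on (induced K W) k z" "\<And>\<rho>. bd z \<rho> = 0"
  obtains y where "chain_on (induced K W) (Suc k) y" "\<And>\<rho>. bd y \<rho> = z \<rho>"
proof -
  have "\<exists>y. chain_on (induced K W) (Suc k) y \<and> (\<forall>\<rho>. bd y \<rho> = z \<rho>)"
    using assms(1)[unfolded bounding_from_def, rule_format, OF assms(2-4)] assms(5) by simp
  then show ?thesis using that by blast
qed

lemma boundary_map_eq:
  assumes "c \<in> oriented_chains i K" "\<Union>K \<subseteq> V"
  shows "boundary_map K c ys = (\<Sum>v\<in>V - set ys. c (v # ys))"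
proof -
  have z: "c (v # ys) = 0" if "v \<notin> \<Union>K \<or> v \<in> set ys" for v
  proof -
    have "v # ys \<notin> ordered_simplices i K" using that by (auto simp: ordered_simplices_def)
    then show ?thesis using assms(1) by (auto simp: oriented_chains_def)
  qed
  have "(\<Sum>v\<in>\<Union>K. c (v # ys)) = (\<Sum>v\<in>V. c (v # ys))"
    using assms(2) finite_V z by (intro sum.mono_neutral_left) auto
  also have "\<dots> = (\<Sum>v\<in>V - set ys. c (v # ys))"
    using finite_V z by (intro sum.mono_neutral_right) auto
  finally show ?thesis by (simp add: boundary_map_def vertex_set_def)
qed

text \<open>The set cycle becomes an oriented cycle \<open>c\<close> by means of
  \<open>list_sign\<close>. A trivial quotient has a single coset, and \<open>c\<close> lies in its
  own coset because 0 is a boundary; hence \<open>c\<close> is a boundary. Reading its preimage on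
  increasing lists gives the set chain.\<close>

lemma trivial_homology_bounding:
  assumes triv: "trivial_group (reduced_homology i K)" and KV: "K \<subseteq> Pow V"
    and k: "int k = i + 1" and z: "chain_on K k z" and cyc: "\<And>\<rho>. bd z \<rho> = 0"
  shows "\<exists>y. chain_on K (Suc k) y \<and> (\<forall>\<rho>. bd y \<rho> = z \<rho>)"
proof -
  define c where "c xs = (if distinct xs then list_sign xs * z (set xs) else 0)" for xs
  have c0: "c xs = 0" if "xs \<notin> ordered_simplices i K" for xs
    using that z k by (auto simp: c_def ordered_simplices_def distinct_card dest!: chain_onD)
  have adj: "c (us @ x # y # vs) = - c (us @ y # x # vs)" for us x y vs
  proof (cases "distinct (us @ x # y # vs) \<and> z (set (us @ x # y # vs)) \<noteq> 0")
    case True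
    then have "set (us @ x # y # vs) \<subseteq> V" using z KV by (blast dest: chain_onD)
    then have "list_sign (us @ x # y # vs) = - list_sign (us @ y # x # vs)"
      using True by (intro list_sign_adjacent) auto
    moreover have "set (us @ x # y # vs) = set (us @ y # x # vs)"
      "distinct (us @ y # x # vs) = distinct (us @ x # y # vs)" by auto
    ultimately show ?thesis unfolding c_def by simp
  next
    case False
    moreover have "set (us @ x # y # vs) = set (us @ y # x # vs)"
      "distinct (us @ y # x # vs) = distinct (us @ x # y # vs)" by auto
    ultimately show ?thesis unfolding c_def by auto
  qed
  have cch: "c \<in> oriented_chains i K"
    using c0 alternating_permute[of c, OF adj] by (auto simp: oriented_chains_def)
  have UK: "\<Union>K \<subseteq> V" using KV by auto
  have "boundary_map K c ys = 0" for ys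
  proof (cases "distinct ys")
    case True
    then have "boundary_map K c ys = (\<Sum>v\<in>V - set ys. list_sign ys * (es v (set ys) * z (insert v (set ys))))"
      unfolding boundary_map_eq[OF cch UK] by (intro sum.cong) (auto simp: c_def)
    also have "\<dots> = list_sign ys * bd z (set ys)" by (simp add: bd_def sum_distrib_left)
    finally show ?thesis by (simp add: cyc)
  qed (simp add: boundary_map_def c_def)
  then have ccyc: "c \<in> cycles i K"
    using cch by (auto simp: cycles_def kernel_def chain_group_def)
  let ?G = "(chain_group i K)\<lparr>carrier := cycles i K\<rparr>"
  have "carrier (reduced_homology i K) = {\<one>\<^bsub>reduced_homology i K\<^esub>}"
    using triv by (simp add: trivial_group_def)
  then have "rcosets\<^bsub>?G\<^esub> boundaries i K = {boundaries i K}"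
    by (simp add: reduced_homology_def FactGroup_def)
  moreover have "boundaries i K #>\<^bsub>?G\<^esub> c \<in> rcosets\<^bsub>?G\<^esub> boundaries i K"
    using ccyc by (auto simp: RCOSETS_def)
  ultimately have coset: "boundaries i K #>\<^bsub>?G\<^esub> c = boundaries i K" by simp
  have zero: "(\<lambda>xs. 0) \<in> boundaries i K"
    unfolding boundaries_def by (rule image_eqI[of _ _ "\<lambda>xs. 0"])
      (auto simp: boundary_map_def chain_group_def oriented_chains_def)
  then have "(\<lambda>xs. 0 + c xs) \<in> boundaries i K #>\<^bsub>?G\<^esub> c"
    unfolding r_coset_def chain_group_def by (intro UN_I[of "\<lambda>xs. 0"]) auto
  then have "c \<in> boundaries i K" using coset by simp
  then obtain b where b: "b \<in> oriented_chains (i + 1) K" and cb: "c = boundary_map K b"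
    by (auto simp: boundaries_def chain_group_def)
  define y where "y \<rho> = (if \<rho> \<subseteq> V then b (sorted_enum \<rho>) else 0)" for \<rho>
  have "chain_on K (Suc k) y"
  proof (rule chain_onI)
    fix \<rho> assume y: "y \<rho> \<noteq> 0"
    then have \<rho>: "\<rho> \<subseteq> V" "b (sorted_enum \<rho>) \<noteq> 0" by (auto simp: y_def split: if_splits)
    then have "sorted_enum \<rho> \<in> ordered_simplices (i + 1) K"
      using b by (auto simp: oriented_chains_def)
    then show "\<rho> \<in> K \<and> card \<rho> = Suc k"
      using sorted_enum[OF \<rho>(1)] k by (auto simp: ordered_simplices_def)
  qed
  moreover have "bd y \<rho> = z \<rho>" for \<rho>
  proof (cases "\<rho> \<subseteq> V")
    case True
    note e = sorted_enum[OF True]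
    have "bd y \<rho> = (\<Sum>x\<in>V - set (sorted_enum \<rho>). b (x # sorted_enum \<rho>))"
      unfolding bd_def e(1)
    proof (intro sum.cong refl)
      fix x assume x: "x \<in> V - \<rho>"
      then have "y (insert x \<rho>) = b (sorted_enum (insert x \<rho>))" using True by (simp add: y_def)
      moreover have "b (x # sorted_enum \<rho>) = es x \<rho> * b (sorted_enum (insert x \<rho>))"
        by (rule alternating_sorted_enum[of b, OF oriented_chains_adjacent[OF b] True x])
      ultimately show "es x \<rho> * y (insert x \<rho>) = b (x # sorted_enum \<rho>)" by simp
    qed
    also have "\<dots> = c (sorted_enum \<rho>)" unfolding cb boundary_map_eq[OF b UK] ..
    also have "\<dots> = z \<rho>" using e True by (simp add: c_def list_sign_sorted)
    finally show ?thesis .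
  next
    case False
    then have "z \<rho> = 0" using z KV by (blast dest: chain_onD)
    moreover have "y (insert x \<rho>) = 0" for x using False by (simp add: y_def)
    ultimately show ?thesis by (simp add: bd_eq_0)
  qed
  ultimately show ?thesis by blast
qed

end

section \<open>Links and relative cycles\<close>

text \<open>In contrast to \<open>simplicial_complex\<close> this admits the empty family, which is
  the link of a non-face.\<close>

definition down_closed :: "'a set set \<Rightarrow> bool" where
  "down_closed K \<longleftrightarrow> (\<forall>\<sigma>\<in>K. \<forall>\<tau>\<subseteq>\<sigma>. \<tau> \<in> K)"

lemma down_closedD: "down_closed K \<Longrightarrow> \<sigma> \<in> K \<Longrightarrow> \<tau> \<subseteq> \<sigma> \<Longrightarrow> \<tau> \<in> K"
  by (auto simp: down_closed_def)

lemma simplicial_complex_down_closed: "simplicial_complex K \<Longrightarrow> down_closed K"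
  by (auto simp: down_closed_def simplicial_complex_def)

lemma down_closed_link: "down_closed K \<Longrightarrow> down_closed (link K \<tau>)"
  unfolding down_closed_def link_def by (auto, meson Un_mono subset_refl)

lemma link_link:
  assumes x: "x \<notin> A" and K: "down_closed K"
  shows "link (link K A) {x} = link K (insert x A)"
proof (rule Set.set_eqI)
  fix \<sigma>
  have "\<sigma> \<union> A \<in> K \<and> {x} \<union> \<sigma> \<in> K \<and> \<sigma> \<in> K" if "\<sigma> \<union> insert x A \<in> K"
    using K that by (auto intro: down_closedD[of K "\<sigma> \<union> insert x A"])
  moreover have "\<sigma> \<union> {x} \<union> A = \<sigma> \<union> insert x A" by auto
  ultimately show "\<sigma> \<in> link (link K A) {x} \<longleftrightarrow> \<sigma> \<in> link K (insert x A)"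
    using x unfolding link_def by (auto simp: Un_commute)
qed

lemma link_empty: "link K {} = K"
  by (auto simp: link_def)

lemma link_subset: "link K A \<subseteq> K"
  by (auto simp: link_def)

text \<open>Despite the name, the exchange axiom is included. These two closure conditions are what
  passes directly to restrictions, deletions and contractions.\<close>

definition independence_system :: "'a set set \<Rightarrow> bool" where
  "independence_system N \<longleftrightarrow> down_closed N \<and>
     (\<forall>A\<in>N. \<forall>B\<in>N. card A < card B \<longrightarrow> (\<exists>x\<in>B - A. insert x A \<in> N))"

lemma trivial_homology_of_no_simplices:
  assumes "ordered_simplices i K = {}" "ordered_simplices (i + 1) K = {}"
  shows "trivial_group (reduced_homology i K)"
proof -
  have och: "oriented_chains i K = {\<lambda>xs. 0}" "oriented_chains (i + 1) K = {\<lambda>xs. 0}"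
    using assms by (auto simp: oriented_chains_def)
  have b0: "boundary_map K (\<lambda>xs. 0) = (\<lambda>xs. 0)"
    by (simp add: boundary_map_def)
  have cyc: "cycles i K = {\<lambda>xs. 0}"
    unfolding cycles_def kernel_def chain_group_def by (simp add: och) (use b0 in blast)
  have bou: "boundaries i K = {\<lambda>xs. 0}"
    by (simp add: boundaries_def chain_group_def och b0)
  define G where "G = (chain_group i K)\<lparr>carrier := cycles i K\<rparr>"
  have "group G"
    by (rule groupI) (auto simp: G_def cyc chain_group_def)
  moreover have "boundaries i K = {\<one>\<^bsub>G\<^esub>}"
    by (simp add: bou G_def chain_group_def)
  ultimately have "group (G Mod boundaries i K)"
    by (simp add: group.one_is_normal normal.factorgroup_is_group)
  moreover have "carrier (G Mod boundaries i K) = {\<one>\<^bsub>G Mod boundaries i K\<^esub>}"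
    by (simp add: FactGroup_def RCOSETS_def r_coset_def G_def cyc bou chain_group_def)
  ultimately show ?thesis
    by (simp add: trivial_group_def reduced_homology_def G_def)
qed

section \<open>Leray numbers under passage to links, and relative fillings\<close>

context ordered_ground
begin

lemma bounding_from_leray_number:
  assumes KV: "K \<subseteq> Pow V" and j: "leray_number K \<le> j"
  shows "bounding_from j K"
proof -
  let ?P = "\<lambda>j. \<forall>W\<subseteq>vertex_set K. \<forall>i\<ge>int j. trivial_group (reduced_homology i (induced K W))"
  \<comment> \<open>The \<open>LEAST\<close> in the Leray number carries information only once some
    value satisfies the predicate. \<open>card V\<close> does: an ordered simplex of dimension at
    least \<open>card V\<close> would need more than \<open>card V\<close> vertices.\<close>
  have "?P (card V)"
  proof (intro allI impI)
    fix W i assume i: "int (card V) \<le> i"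
    have "ordered_simplices i' (induced K W) = {}" if "int (card V) \<le> i'" for i'
    proof -
      have "length xs \<le> card V" if "distinct xs" "set xs \<in> induced K W" for xs
      proof -
        have "set xs \<subseteq> V" using that KV by (auto simp: induced_def)
        then show ?thesis using that card_mono[OF finite_V, of "set xs"] by (simp add: distinct_card)
      qed
      then show ?thesis using that by (fastforce simp: ordered_simplices_def)
    qed
    then show "trivial_group (reduced_homology i (induced K W))"
      using i by (intro trivial_homology_of_no_simplices) auto
  qed
  then have P: "?P (leray_number K)"
    unfolding leray_number_def by (rule LeastI)
  show ?thesis
    unfolding bounding_from_def
  proof (intro allI impI)
    fix W k z assume k: "j < k" and z: "chain_on (induced K W) k z" "\<forall>\<rho>. bd z \<rho> = 0"
    have "induced K (W \<inter> vertex_set K) = induced K W"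
      by (auto simp: induced_def vertex_set_def)
    moreover have "trivial_group (reduced_homology (int k - 1) (induced K (W \<inter> vertex_set K)))"
      using P j k by (auto simp del: One_nat_def)
    ultimately have "trivial_group (reduced_homology (int k - 1) (induced K W))" by simp
    then show "\<exists>y. chain_on (induced K W) (Suc k) y \<and> (\<forall>\<rho>. bd y \<rho> = z \<rho>)"
      using z KV induced_subset by (intro trivial_homology_bounding) (auto simp: induced_def)
  qed
qed

definition cone :: "'a \<Rightarrow> ('a set \<Rightarrow> int) \<Rightarrow> 'a set \<Rightarrow> int" where
  "cone v z \<rho> = (if v \<in> \<rho> then es v (\<rho> - {v}) * z (\<rho> - {v}) else 0)"

text \<open>The coefficient of \<open>v\<close> in \<open>u\<close>, a chain on the link of
  \<open>v\<close>. The sign is the one of \<open>cone\<close>, so that it recovers \<open>z\<close>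
  from \<open>cone v z\<close> when \<open>z\<close> vanishes on sets containing
  \<open>v\<close>.\<close>

definition link_part :: "'a \<Rightarrow> ('a set \<Rightarrow> int) \<Rightarrow> 'a set \<Rightarrow> int" where
  "link_part v u \<sigma> = (if v \<in> \<sigma> then 0 else es v \<sigma> * u (insert v \<sigma>))"

lemma bd_link_part:
  assumes "\<sigma> \<subseteq> V" "v \<notin> \<sigma>" "v \<in> V"
  shows "bd (link_part v u) \<sigma> = - (es v \<sigma> * bd u (insert v \<sigma>))"
proof -
  have "bd (link_part v u) \<sigma> = (\<Sum>x\<in>V - insert v \<sigma>. es x \<sigma> * link_part v u (insert x \<sigma>))"
    unfolding bd_def using finite_V by (intro sum.mono_neutral_right) (auto simp: link_part_def)
  also have "\<dots> = (\<Sum>x\<in>V - insert v \<sigma>. - (es v \<sigma> * (es x (insert v \<sigma>) * u (insert x (insert v \<sigma>)))))"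
  proof (rule sum.cong[OF refl])
    fix x assume x: "x \<in> V - insert v \<sigma>"
    have "es x \<sigma> * es v (insert x \<sigma>) = - (es v \<sigma> * es x (insert v \<sigma>))"
      using es_insert_swap[of \<sigma> x v] assms x by auto
    then have "es x \<sigma> * (es v (insert x \<sigma>) * a) = - (es v \<sigma> * (es x (insert v \<sigma>) * a))" for a
      by (simp flip: mult.assoc)
    then show "es x \<sigma> * link_part v u (insert x \<sigma>) = - (es v \<sigma> * (es x (insert v \<sigma>) * u (insert x (insert v \<sigma>))))"
      using x assms by (auto simp: link_part_def insert_commute)
  qed
  finally show ?thesis by (simp add: bd_def sum_negf sum_distrib_left)
qed

text \<open>At a face through \<open>v\<close> the formula follows because
  \<open>link_part v\<close> undoes the cone and anticommutes with the boundary; at any other face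
  only the coface obtained by adding \<open>v\<close> contributes.\<close>

lemma bd_cone:
  assumes "\<rho> \<subseteq> V" "v \<in> V" and z: "\<And>\<sigma>. v \<in> \<sigma> \<Longrightarrow> z \<sigma> = 0"
  shows "bd (cone v z) \<rho> = (if v \<in> \<rho> then - (es v (\<rho> - {v}) * bd z (\<rho> - {v})) else z \<rho>)"
proof (cases "v \<in> \<rho>")
  case True
  define \<sigma> where "\<sigma> = \<rho> - {v}"
  have \<sigma>: "\<sigma> \<subseteq> V" "v \<notin> \<sigma>" "\<rho> = insert v \<sigma>" using True assms by (auto simp: \<sigma>_def)
  have "link_part v (cone v z) \<tau> = z \<tau>" for \<tau>
    using z by (auto simp: link_part_def cone_def)
  then have "bd (link_part v (cone v z)) \<sigma> = bd z \<sigma>" by (simp cong: bd_cong)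
  then have "bd z \<sigma> = - (es v \<sigma> * bd (cone v z) \<rho>)"
    using bd_link_part[OF \<sigma>(1,2) assms(2), of "cone v z"] \<sigma>(3) by simp
  then have "- (es v \<sigma> * bd z \<sigma>) = bd (cone v z) \<rho>" by simp
  then show ?thesis using True by (simp add: \<sigma>_def)
next
  case False
  have "bd (cone v z) \<rho> = (\<Sum>x\<in>{v}. es x \<rho> * cone v z (insert x \<rho>))"
    unfolding bd_def using finite_V assms False
    by (intro sum.mono_neutral_right) (auto simp: cone_def)
  then show ?thesis using False by (simp add: cone_def)
qed

text \<open>A cycle \<open>z\<close> of the link is also a cycle of \<open>Y\<close>, hence bounds
  some \<open>y\<close> avoiding \<open>v\<close>. Then \<open>cone v z - y\<close> is a cycle with
  one more vertex and bounds some \<open>u\<close>. The part of \<open>u\<close> through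
  \<open>v\<close> lies in the link and, after a sign, fills \<open>z\<close>.\<close>

lemma bounding_from_link_vertex:
  assumes Y: "down_closed Y" "Y \<subseteq> Pow V" and j: "bounding_from j Y" and v: "v \<in> V"
  shows "bounding_from j (link Y {v})"
  unfolding bounding_from_def
proof (intro allI impI)
  fix W k z
  assume W: "W \<subseteq> V" and k: "j < k" and z: "chain_on (induced (link Y {v}) W) k z"
    and cyc: "\<forall>\<rho>. bd z \<rho> = 0"
  have zD: "\<rho> \<in> Y \<and> \<rho> \<subseteq> W \<and> v \<notin> \<rho> \<and> insert v \<rho> \<in> Y \<and> card \<rho> = k \<and> \<rho> \<subseteq> V" if "z \<rho> \<noteq> 0" for \<rho>
    using chain_onD[OF z that] Y(2) by (auto simp: induced_def link_def)
  have sub: "W - {v} \<subseteq> V" "insert v W \<subseteq> V" using W v by auto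
  have ch: "chain_on (induced Y (W - {v})) k z"
    by (rule chain_onI) (auto simp: induced_def dest: zD)
  obtain y where y: "chain_on (induced Y (W - {v})) (Suc k) y" "\<And>\<rho>. bd y \<rho> = z \<rho>"
    by (rule bounding_fromD[OF j sub(1) k ch cyc[rule_format]], rule that)
  have yD: "\<rho> \<in> Y \<and> \<rho> \<subseteq> W - {v} \<and> card \<rho> = Suc k" if "y \<rho> \<noteq> 0" for \<rho>
    using chain_onD[OF y(1) that] by (auto simp: induced_def)
  define z' where "z' \<rho> = cone v z \<rho> - y \<rho>" for \<rho>
  have z': "chain_on (induced Y (insert v W)) (Suc k) z'"
  proof (rule chain_onI)
    fix \<rho> assume "z' \<rho> \<noteq> 0"
    then consider "cone v z \<rho> \<noteq> 0" | "y \<rho> \<noteq> 0" by (cases "y \<rho> = 0") (auto simp: z'_def)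
    then show "\<rho> \<in> induced Y (insert v W) \<and> card \<rho> = Suc k"
    proof cases
      case 1
      then have v\<rho>: "v \<in> \<rho>" and nz: "z (\<rho> - {v}) \<noteq> 0" by (auto simp: cone_def split: if_splits)
      then have "finite (\<rho> - {v})" using zD[OF nz] by (intro finite_sub) blast
      moreover have "insert v (\<rho> - {v}) = \<rho>" using v\<rho> by auto
      ultimately show ?thesis
        using zD[OF nz] v\<rho> card_insert_disjoint[of "\<rho> - {v}" v] by (auto simp: induced_def)
    next
      case 2
      then show ?thesis using yD by (auto simp: induced_def)
    qed
  qed
  have cyc': "bd z' \<rho> = 0" for \<rho>
  proof (cases "\<rho> \<subseteq> V")
    case True
    have "z \<sigma> = 0" if "v \<in> \<sigma>" for \<sigma> using zD that by blast
    then show ?thesis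
      using bd_cone[OF True v, of z] cyc y(2)[of \<rho>] zD[of \<rho>] by (auto simp: z'_def[abs_def] bd_diff)
  next
    case False
    then show ?thesis by (rule bd_outside[OF z', rotated]) (use Y(2) in \<open>auto simp: induced_def\<close>)
  qed
  obtain u where u: "chain_on (induced Y (insert v W)) (Suc (Suc k)) u" "\<And>\<rho>. bd u \<rho> = z' \<rho>"
    by (rule bounding_fromD[OF j sub(2) less_SucI[OF k] z' cyc'], rule that)
  have uD: "\<rho> \<in> Y \<and> \<rho> \<subseteq> insert v W \<and> card \<rho> = Suc (Suc k)" if "u \<rho> \<noteq> 0" for \<rho>
    using chain_onD[OF u(1) that] by (auto simp: induced_def)
  have "chain_on (induced (link Y {v}) W) (Suc k) (\<lambda>\<sigma>. - link_part v u \<sigma>)"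
  proof (rule chain_onI)
    fix \<sigma> assume "- link_part v u \<sigma> \<noteq> 0"
    then have \<sigma>: "v \<notin> \<sigma>" "u (insert v \<sigma>) \<noteq> 0" by (auto simp: link_part_def split: if_splits)
    note * = uD[OF \<sigma>(2)]
    have "insert v \<sigma> \<subseteq> V" using * Y(2) by blast
    then have "finite \<sigma>" by (intro finite_sub) blast
    then have "card \<sigma> = Suc k" using * \<sigma> by simp
    moreover have "\<sigma> \<in> Y" using * Y(1) by (blast dest: down_closedD)
    ultimately show "\<sigma> \<in> induced (link Y {v}) W \<and> card \<sigma> = Suc k"
      using * \<sigma> by (auto simp: induced_def link_def)
  qed
  moreover have "bd (\<lambda>\<sigma>. - link_part v u \<sigma>) \<sigma> = z \<sigma>" for \<sigma>
  proof (cases "\<sigma> \<subseteq> V \<and> v \<notin> \<sigma>")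
    case True
    have "y (insert v \<sigma>) = 0" using yD by blast
    then show ?thesis
      using True bd_link_part[of \<sigma> v u] v by (simp add: bd_uminus u(2) z'_def cone_def)
  next
    case False
    have "u (insert v (insert x \<sigma>)) = 0 \<or> v \<in> insert x \<sigma>" for x
      using False uD[of "insert v (insert x \<sigma>)"] Y(2) by blast
    then have "bd (\<lambda>\<sigma>. - link_part v u \<sigma>) \<sigma> = 0"
      by (intro bd_eq_0) (auto simp: link_part_def)
    moreover have "z \<sigma> = 0" using False zD by blast
    ultimately show ?thesis by simp
  qed
  ultimately show "\<exists>y. chain_on (induced (link Y {v}) W) (Suc k) y \<and> (\<forall>\<rho>. bd y \<rho> = z \<rho>)"
    by blast
qed

lemma bounding_from_link:
  assumes Y: "down_closed Y" "Y \<subseteq> Pow V" and "A \<subseteq> B" "B \<subseteq> V" and j: "bounding_from j (link Y A)"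
  shows "bounding_from j (link Y B)"
proof -
  have "bounding_from j (link Y (A \<union> C))" if "finite C" "C \<subseteq> V - A" for C
    using that
  proof (induction rule: finite_induct)
    case empty
    then show ?case using j by simp
  next
    case (insert x C)
    then have "bounding_from j (link (link Y (A \<union> C)) {x})"
      using Y link_subset[of Y "A \<union> C"] by (intro bounding_from_link_vertex down_closed_link) auto
    then show ?case using insert Y(1) by (simp add: link_link)
  qed
  from this[of "B - A"] show ?thesis
    using assms finite_V by (simp add: Un_absorb1 Un_Diff_cancel Diff_mono finite_subset)
qed

text \<open>The sign that turns chains on faces containing \<open>D\<close> into chains on the link of \<open>D\<close>.\<close>

definition twist :: "'a set \<Rightarrow> 'a set \<Rightarrow> int" where
  "twist D \<sigma> = (\<Prod>y\<in>\<sigma>. es y D)"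

lemma twist_square [simp]: "twist D \<sigma> * twist D \<sigma> = 1" "twist D \<sigma> * (twist D \<sigma> * a) = a"
proof -
  show *: "twist D \<sigma> * twist D \<sigma> = 1"
    unfolding twist_def by (simp flip: prod.distrib)
  show "twist D \<sigma> * (twist D \<sigma> * a) = a"
    by (simp add: * flip: mult.assoc)
qed

text \<open>The sign of \<open>x\<close> relative to \<open>D \<union> \<sigma>\<close> is the
  product of its signs relative to \<open>D\<close> and to \<open>\<sigma>\<close>. The factor from
  \<open>D\<close> depends on \<open>x\<close> alone, and \<open>twist\<close> absorbs it.\<close>

lemma bd_twist:
  assumes "D \<subseteq> V" "\<sigma> \<subseteq> V" "\<sigma> \<inter> D = {}"
  shows "bd (\<lambda>\<sigma>. if \<sigma> \<inter> D = {} then twist D \<sigma> * c (D \<union> \<sigma>) else 0) \<sigma> = twist D \<sigma> * bd c (D \<union> \<sigma>)"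
proof -
  have fin: "finite \<sigma>" "finite D" using assms finite_V by (auto intro: finite_subset)
  let ?z = "\<lambda>\<sigma>. if \<sigma> \<inter> D = {} then twist D \<sigma> * c (D \<union> \<sigma>) else 0"
  have "bd ?z \<sigma> = (\<Sum>x\<in>V - (D \<union> \<sigma>). es x \<sigma> * ?z (insert x \<sigma>))"
    unfolding bd_def using finite_V by (intro sum.mono_neutral_right) auto
  also have "\<dots> = (\<Sum>x\<in>V - (D \<union> \<sigma>). twist D \<sigma> * (es x (D \<union> \<sigma>) * c (insert x (D \<union> \<sigma>))))"
  proof (rule sum.cong[OF refl])
    fix x assume x: "x \<in> V - (D \<union> \<sigma>)"
    have "es x (D \<union> \<sigma>) = es x D * es x \<sigma>" using fin assms by (intro esign_Un) auto
    moreover have "twist D (insert x \<sigma>) = es x D * twist D \<sigma>" using x fin by (simp add: twist_def)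
    ultimately show "es x \<sigma> * ?z (insert x \<sigma>) = twist D \<sigma> * (es x (D \<union> \<sigma>) * c (insert x (D \<union> \<sigma>)))"
      using x assms by simp
  qed
  finally show ?thesis by (simp add: bd_def sum_distrib_left)
qed

text \<open>Removing \<open>D\<close> from all faces turns a cycle modulo faces that do not contain
  \<open>D\<close> into an honest cycle of the link of \<open>D\<close>, with \<open>k\<close>
  vertices per face. The set \<open>W\<close> makes it possible to keep the filling away from
  prescribed vertices.\<close>

lemma bounding_from_relative:
  assumes X: "down_closed X" "X \<subseteq> Pow V" and D: "D \<subseteq> V" and W: "W \<subseteq> V - D"
    and j: "bounding_from j (link X D)" and k: "j < k"
    and R: "\<And>\<rho>. R \<rho> \<noteq> 0 \<Longrightarrow> \<rho> \<in> X \<and> D \<subseteq> \<rho> \<and> \<rho> \<subseteq> D \<union> W \<and> card \<rho> = card D + k"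
    and cyc: "\<And>\<rho>. \<rho> \<subseteq> V \<Longrightarrow> D \<subseteq> \<rho> \<Longrightarrow> bd R \<rho> = 0"
  shows "\<exists>r. (\<forall>\<rho>. r \<rho> \<noteq> 0 \<longrightarrow> \<rho> \<in> X \<and> D \<subseteq> \<rho> \<and> \<rho> \<subseteq> D \<union> W \<and> card \<rho> = Suc (card D + k))
     \<and> (\<forall>\<rho>\<subseteq>V. D \<subseteq> \<rho> \<longrightarrow> bd r \<rho> = R \<rho>)"
proof -
  have finD: "finite D" using D finite_V by (rule finite_subset)
  define z where "z \<sigma> = (if \<sigma> \<inter> D = {} then twist D \<sigma> * R (D \<union> \<sigma>) else 0)" for \<sigma>
  have z: "chain_on (induced (link X D) W) k z"
  proof (rule chain_onI)
    fix \<sigma> assume "z \<sigma> \<noteq> 0"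
    then have \<sigma>: "\<sigma> \<inter> D = {}" "R (D \<union> \<sigma>) \<noteq> 0" by (auto simp: z_def split: if_splits)
    note * = R[OF \<sigma>(2)]
    have "finite \<sigma>" using * X(2) by (intro finite_sub) blast
    then have "card \<sigma> = k" using * \<sigma>(1) finD by (simp add: card_Un_disjoint Int_commute)
    moreover have "\<sigma> \<in> X" using * X(1) by (blast dest: down_closedD)
    ultimately show "\<sigma> \<in> induced (link X D) W \<and> card \<sigma> = k"
      using * \<sigma> by (auto simp: induced_def link_def Un_commute)
  qed
  have zcyc: "bd z \<sigma> = 0" for \<sigma>
  proof (cases "\<sigma> \<subseteq> V \<and> \<sigma> \<inter> D = {}")
    case True
    then show ?thesis unfolding z_def[abs_def] using D by (simp add: bd_twist cyc)
  next
    case False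
    then show ?thesis
    proof (cases "\<sigma> \<subseteq> V")
      case True
      with False show ?thesis by (intro bd_eq_0) (auto simp: z_def)
    next
      case False
      then show ?thesis by (rule bd_outside[OF z, rotated])
        (use X(2) in \<open>auto simp: induced_def link_def\<close>)
    qed
  qed
  obtain y where y: "chain_on (induced (link X D) W) (Suc k) y" "\<And>\<rho>. bd y \<rho> = z \<rho>"
    by (rule bounding_fromD[OF j _ k z zcyc, rotated], rule that) (use W in auto)
  have yD: "\<sigma> \<inter> D = {} \<and> D \<union> \<sigma> \<in> X \<and> \<sigma> \<subseteq> W \<and> card \<sigma> = Suc k" if "y \<sigma> \<noteq> 0" for \<sigma>
    using chain_onD[OF y(1) that] by (auto simp: induced_def link_def Un_commute)
  define r where "r \<rho> = (if D \<subseteq> \<rho> then twist D (\<rho> - D) * y (\<rho> - D) else 0)" for \<rho>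
  have "\<rho> \<in> X \<and> D \<subseteq> \<rho> \<and> \<rho> \<subseteq> D \<union> W \<and> card \<rho> = Suc (card D + k)" if "r \<rho> \<noteq> 0" for \<rho>
  proof -
    have \<rho>: "D \<subseteq> \<rho>" "y (\<rho> - D) \<noteq> 0" using that by (auto simp: r_def split: if_splits)
    note * = yD[OF \<rho>(2)]
    have "D \<union> (\<rho> - D) = \<rho>" using \<rho> by auto
    moreover have "finite (\<rho> - D)" using * W by (intro finite_sub) blast
    ultimately show ?thesis using * \<rho>(1) finD card_Un_disjoint[of D "\<rho> - D"] by auto
  qed
  moreover have "bd r \<rho> = R \<rho>" if \<rho>: "\<rho> \<subseteq> V" "D \<subseteq> \<rho>" for \<rho>
  proof -
    have Dr: "D \<union> (\<rho> - D) = \<rho>" using \<rho> by auto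
    have "y \<sigma> = (if \<sigma> \<inter> D = {} then twist D \<sigma> * r (D \<union> \<sigma>) else 0)" for \<sigma>
    proof (cases "\<sigma> \<inter> D = {}")
      case True
      then have "D \<union> \<sigma> - D = \<sigma>" by auto
      then show ?thesis using True by (simp add: r_def)
    qed (use yD in auto)
    then have "bd y (\<rho> - D) = bd (\<lambda>\<sigma>. if \<sigma> \<inter> D = {} then twist D \<sigma> * r (D \<union> \<sigma>) else 0) (\<rho> - D)"
      by (rule arg_cong[where f="\<lambda>c. bd c (\<rho> - D)", OF ext])
    also have "\<dots> = twist D (\<rho> - D) * bd r (D \<union> (\<rho> - D))"
      using D \<rho> by (intro bd_twist) auto
    finally have "bd y (\<rho> - D) = twist D (\<rho> - D) * bd r \<rho>" by (simp only: Dr)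
    then have "twist D (\<rho> - D) * bd r \<rho> = twist D (\<rho> - D) * R \<rho>"
      using y(2)[of "\<rho> - D"] Dr Diff_disjoint[of D \<rho>] by (auto simp: z_def Int_commute)
    then have "twist D (\<rho> - D) * (twist D (\<rho> - D) * bd r \<rho>) = twist D (\<rho> - D) * (twist D (\<rho> - D) * R \<rho>)"
      by (rule arg_cong)
    then show ?thesis by (simp only: twist_square(2))
  qed
  ultimately show ?thesis by blast
qed

text \<open>
  Either coning with \<open>w\<close> works, or the deletion of \<open>w\<close> still has an independent set of size \<open>k + 1\<close>
  and the induction applies to the deletion and the contraction.
\<close>

lemma independence_system_bounding:
  assumes "independence_system N" "N \<subseteq> Pow V" "I \<in> N" "card I > k" "chain_on N k z" "\<And>\<rho>. bd z \<rho> = 0"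
  shows "\<exists>y. chain_on N (Suc k) y \<and> (\<forall>\<rho>. bd y \<rho> = z \<rho>)"
  using assms
proof (induction "card (\<Union>N)" arbitrary: N I k z rule: less_induct)
  case less
  note N = less.prems(1) and NV = less.prems(2) and z = less.prems(5) and cyc = less.prems(6)
  have dc: "down_closed N" and ex: "\<And>A B. A \<in> N \<Longrightarrow> B \<in> N \<Longrightarrow> card A < card B \<Longrightarrow> \<exists>x\<in>B - A. insert x A \<in> N"
    using N by (auto simp: independence_system_def)
  have fin: "finite A" if "A \<in> N" for A using that NV by (intro finite_sub) blast
  have finU: "finite (\<Union>N)" using NV by (intro finite_sub) blast
  obtain w where w: "w \<in> I" using less.prems(4) by (metis all_not_in_conv card.empty not_less_zero)
  have wN: "{w} \<in> N" by (rule down_closedD[OF dc less.prems(3)]) (use w in simp)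
  then have wV: "w \<in> V" using NV by auto
  have zD: "\<rho> \<in> N \<and> card \<rho> = k" if "z \<rho> \<noteq> 0" for \<rho> using z that by (rule chain_onD)
  show ?case
  proof (cases "\<forall>A\<in>N. w \<notin> A \<longrightarrow> card A = k \<longrightarrow> insert w A \<in> N")
    case True
    \<comment> \<open>Coning only the faces without \<open>w\<close> suffices: the cycle condition
      at \<open>\<rho> - {w}\<close> expresses the coefficient of \<open>z\<close> at a face
      \<open>\<rho>\<close> through \<open>w\<close> by the boundary of \<open>z0\<close>.\<close>
    define z0 where "z0 \<rho> = (if w \<in> \<rho> then 0 else z \<rho>)" for \<rho>
    have "chain_on N (Suc k) (cone w z0)"
    proof (rule chain_onI)
      fix \<rho> assume "cone w z0 \<rho> \<noteq> 0"
      then have \<rho>: "w \<in> \<rho>" "z (\<rho> - {w}) \<noteq> 0" by (auto simp: cone_def z0_def split: if_splits)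
      have "insert w (\<rho> - {w}) = \<rho>" using \<rho> by auto
      then show "\<rho> \<in> N \<and> card \<rho> = Suc k"
        using True zD[OF \<rho>(2)] fin[of "\<rho> - {w}"] card_insert_disjoint[of "\<rho> - {w}" w] by auto
    qed
    moreover have "bd (cone w z0) \<rho> = z \<rho>" for \<rho>
    proof (cases "\<rho> \<subseteq> V")
      case V: True
      have c: "bd (cone w z0) \<rho> = (if w \<in> \<rho> then - (es w (\<rho> - {w}) * bd z0 (\<rho> - {w})) else z0 \<rho>)"
        using V wV by (intro bd_cone) (auto simp: z0_def)
      show ?thesis
      proof (cases "w \<in> \<rho>")
        case True
        define \<sigma> where "\<sigma> = \<rho> - {w}"
        have \<sigma>: "\<sigma> \<subseteq> V" "w \<notin> \<sigma>" "\<rho> = insert w \<sigma>" using True V by (auto simp: \<sigma>_def)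
        have "0 = bd z \<sigma>" using cyc by simp
        also have "\<dots> = es w \<sigma> * z \<rho> + (\<Sum>x\<in>V - \<sigma> - {w}. es x \<sigma> * z (insert x \<sigma>))"
          unfolding bd_def \<sigma>(3) using \<sigma> wV finite_V by (intro sum.remove) auto
        also have "(\<Sum>x\<in>V - \<sigma> - {w}. es x \<sigma> * z (insert x \<sigma>)) = bd z0 \<sigma>"
          unfolding bd_def using \<sigma> finite_V
          by (intro sum.mono_neutral_cong_left) (auto simp: z0_def)
        finally have "bd z0 \<sigma> = - (es w \<sigma> * z \<rho>)" by simp
        then show ?thesis using c True by (simp add: \<sigma>_def)
      next
        case False
        then show ?thesis using c by (simp add: z0_def)
      qed
    next
      case False
      then have "z \<rho> = 0" using zD NV by blast
      moreover have "cone w z0 (insert x \<rho>) = 0" for x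
        using False zD[of "insert x \<rho> - {w}"] NV wV by (auto simp: cone_def z0_def)
      ultimately show ?thesis by (simp add: bd_eq_0)
    qed
    ultimately show ?thesis by blast
  next
    case False
    then obtain A where A: "A \<in> N" "w \<notin> A" "card A = k" "insert w A \<notin> N" by blast
    \<comment> \<open>Exchange with the larger set \<open>I\<close> enlarges \<open>A\<close> by an
      element that cannot be \<open>w\<close>. So the deletion \<open>N0\<close> keeps an
      independent set of size \<open>k + 1\<close>, as the induction requires.\<close>
    then obtain x where x: "x \<in> I - A" "insert x A \<in> N" using ex[of A I] less.prems(3,4) by auto
    have xw: "x \<noteq> w" using A x by auto
    have "A \<noteq> {}" using A wN by auto
    then have "k \<noteq> 0" using A fin[of A] by auto
    then obtain k' where k': "k = Suc k'" by (cases k) auto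
    define N0 where "N0 = {A \<in> N. w \<notin> A}"
    define N1 where "N1 = {A. w \<notin> A \<and> insert w A \<in> N}"
    have N10: "N1 \<subseteq> N"
    proof
      fix A assume "A \<in> N1"
      then show "A \<in> N" using down_closedD[OF dc, of "insert w A" A] by (auto simp: N1_def)
    qed
    have smaller: "card (\<Union>N0) < card (\<Union>N)" "card (\<Union>N1) < card (\<Union>N)"
    proof -
      have "\<Union>N0 \<subset> \<Union>N" "\<Union>N1 \<subset> \<Union>N"
        using wN N10 by (auto simp: N0_def N1_def)
      then show "card (\<Union>N0) < card (\<Union>N)" "card (\<Union>N1) < card (\<Union>N)"
        using finU by (auto intro: psubset_card_mono)
    qed
    have is0: "independence_system N0"
      unfolding independence_system_def
    proof (intro conjI ballI impI)
      show "down_closed N0" using dc by (auto simp: N0_def down_closed_def)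
      fix A B assume "A \<in> N0" "B \<in> N0" "card A < card B"
      then show "\<exists>x\<in>B - A. insert x A \<in> N0" using ex[of A B] by (auto simp: N0_def)
    qed
    have is1: "independence_system N1"
      unfolding independence_system_def
    proof (intro conjI ballI impI)
      show "down_closed N1"
        using dc unfolding N1_def down_closed_def by (auto dest: insert_mono)
      fix A B assume AB: "A \<in> N1" "B \<in> N1" "card A < card B"
      then have "card (insert w A) < card (insert w B)"
        using fin[OF subsetD[OF N10, of A]] fin[OF subsetD[OF N10, of B]] by (simp add: N1_def)
      then obtain x where "x \<in> insert w B - insert w A" "insert x (insert w A) \<in> N"
        using ex[of "insert w A" "insert w B"] AB by (auto simp: N1_def)
      then show "\<exists>x\<in>B - A. insert x A \<in> N1"
        using AB by (intro bexI[of _ x]) (auto simp: N1_def insert_commute)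
    qed
    \<comment> \<open>First the contraction: the part of \<open>z\<close> through \<open>w\<close>
      is a cycle there with one vertex fewer, and \<open>I - {w}\<close> is large enough for
      it.\<close>
    have "\<exists>y1. chain_on N1 (Suc k') y1 \<and> (\<forall>\<rho>. bd y1 \<rho> = link_part w z \<rho>)"
    proof (rule less.hyps[OF smaller(2) is1])
      show "N1 \<subseteq> Pow V" using N10 NV by auto
      show "I - {w} \<in> N1" using less.prems(3) w by (auto simp: N1_def insert_absorb)
      show "k' < card (I - {w})" using less.prems(3,4) w fin k' by (simp add: card_Diff_singleton)
      show "chain_on N1 k' (link_part w z)"
      proof (rule chain_onI)
        fix \<sigma> assume "link_part w z \<sigma> \<noteq> 0"
        then have \<sigma>: "w \<notin> \<sigma>" "z (insert w \<sigma>) \<noteq> 0" by (auto simp: link_part_def split: if_splits)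
        then show "\<sigma> \<in> N1 \<and> card \<sigma> = k'"
          using zD[OF \<sigma>(2)] fin[of "insert w \<sigma>"] k' by (auto simp: N1_def)
      qed
      show "bd (link_part w z) \<sigma> = 0" for \<sigma>
      proof (cases "\<sigma> \<subseteq> V \<and> w \<notin> \<sigma>")
        case True
        then show ?thesis using wV by (simp add: bd_link_part cyc)
      next
        case False
        then have "link_part w z (insert x \<sigma>) = 0" for x
          using zD[of "insert w (insert x \<sigma>)"] NV by (auto simp: link_part_def)
        then show ?thesis by (simp add: bd_eq_0)
      qed
    qed
    then obtain y1 where y1: "chain_on N1 k y1" "\<And>\<rho>. bd y1 \<rho> = link_part w z \<rho>"
      using k' by auto
    have y1D: "w \<notin> \<sigma> \<and> insert w \<sigma> \<in> N \<and> card \<sigma> = k" if "y1 \<sigma> \<noteq> 0" for \<sigma>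
      using chain_onD[OF y1(1) that] by (auto simp: N1_def)
    have cone_y1: "chain_on N (Suc k) (cone w y1)"
    proof (rule chain_onI)
      fix \<rho> assume "cone w y1 \<rho> \<noteq> 0"
      then have \<rho>: "w \<in> \<rho>" "y1 (\<rho> - {w}) \<noteq> 0" by (auto simp: cone_def split: if_splits)
      then have "insert w (\<rho> - {w}) = \<rho>" by auto
      then show "\<rho> \<in> N \<and> card \<rho> = Suc k"
        using y1D[OF \<rho>(2)] fin[of \<rho>] card_insert_disjoint[of "\<rho> - {w}" w] by auto
    qed
    \<comment> \<open>Adding this boundary cancels every face through \<open>w\<close>, so
      \<open>z'\<close> is a cycle of the deletion.\<close>
    define z' where "z' \<rho> = z \<rho> + bd (cone w y1) \<rho>" for \<rho>
    have z'_eq: "z' \<rho> = (if w \<in> \<rho> then 0 else z \<rho> + y1 \<rho>)" if "\<rho> \<subseteq> V" for \<rho>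
    proof -
      have "bd (cone w y1) \<rho> = (if w \<in> \<rho> then - (es w (\<rho> - {w}) * link_part w z (\<rho> - {w})) else y1 \<rho>)"
        using that wV y1D by (subst bd_cone) (auto simp: y1(2))
      then show ?thesis by (auto simp: z'_def link_part_def insert_absorb)
    qed
    have z'_out: "z' \<rho> = 0" if "\<not> \<rho> \<subseteq> V" for \<rho>
      using that zD[of \<rho>] NV bd_outside[OF cone_y1 NV that] by (auto simp: z'_def)
    have "\<exists>y0. chain_on N0 (Suc k) y0 \<and> (\<forall>\<rho>. bd y0 \<rho> = z' \<rho>)"
    proof (rule less.hyps[OF smaller(1) is0])
      show "N0 \<subseteq> Pow V" using NV by (auto simp: N0_def)
      show "insert x A \<in> N0" using x A xw by (auto simp: N0_def)
      show "k < card (insert x A)" using x A fin by simp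
      show "chain_on N0 k z'"
      proof (rule chain_onI)
        fix \<rho> assume nz: "z' \<rho> \<noteq> 0"
        then have \<rho>V: "\<rho> \<subseteq> V" using z'_out by blast
        then have "w \<notin> \<rho>" "z \<rho> \<noteq> 0 \<or> y1 \<rho> \<noteq> 0" using nz by (auto simp: z'_eq split: if_splits)
        then show "\<rho> \<in> N0 \<and> card \<rho> = k"
          using zD[of \<rho>] y1D[of \<rho>] down_closedD[OF dc, of "insert w \<rho>" \<rho>] by (auto simp: N0_def)
      qed
      show "bd z' \<rho> = 0" for \<rho>
      proof (cases "\<rho> \<subseteq> V")
        case True
        then show ?thesis unfolding z'_def[abs_def] by (simp add: bd_add bd_bd cyc)
      next
        case False
        then show ?thesis by (intro bd_eq_0) (auto intro: z'_out)
      qed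
    qed
    then obtain y0 where y0: "chain_on N0 (Suc k) y0" "\<And>\<rho>. bd y0 \<rho> = z' \<rho>" by blast
    have "chain_on N (Suc k) (\<lambda>\<rho>. y0 \<rho> - cone w y1 \<rho>)"
      using y0(1) cone_y1 by (auto simp: chain_on_def N0_def) (metis diff_0_right mem_Collect_eq)+
    moreover have "bd (\<lambda>\<rho>. y0 \<rho> - cone w y1 \<rho>) \<rho> = z \<rho>" for \<rho>
      by (simp add: bd_diff y0(2) z'_def)
    ultimately show ?thesis by blast
  qed
qed

end

section \<open>Matroid rank and span\<close>

lemma matroid_independence_system: "matroid M \<Longrightarrow> independence_system M"
  by (simp add: matroid_def independence_system_def simplicial_complex_down_closed)

lemma independence_system_induced: "independence_system M \<Longrightarrow> independence_system (induced M W)"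
  unfolding independence_system_def
proof (elim conjE, intro conjI ballI impI)
  assume dc: "down_closed M" and ex: "\<forall>A\<in>M. \<forall>B\<in>M. card A < card B \<longrightarrow> (\<exists>x\<in>B - A. insert x A \<in> M)"
  show "down_closed (induced M W)"
    using dc unfolding down_closed_def induced_def by blast
  fix A B assume AB: "A \<in> induced M W" "B \<in> induced M W" "card A < card B"
  then have "\<exists>x\<in>B - A. insert x A \<in> M" using ex by (simp add: induced_def)
  then obtain x where "x \<in> B - A" "insert x A \<in> M" by blast
  then show "\<exists>x\<in>B - A. insert x A \<in> induced M W"
    using AB by (intro bexI[of _ x]) (auto simp: induced_def)
qed

locale matroid_ground =
  fixes M :: "'a set set"
  assumes matroid: "matroid M"
begin

lemma finite_M: "finite M" and finite_indep: "I \<in> M \<Longrightarrow> finite I"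
  and empty_indep: "{} \<in> M" and subset_indep: "I \<in> M \<Longrightarrow> J \<subseteq> I \<Longrightarrow> J \<in> M"
  using matroid by (auto simp: matroid_def simplicial_complex_def)

lemma exchange: "A \<in> M \<Longrightarrow> B \<in> M \<Longrightarrow> card A < card B \<Longrightarrow> \<exists>x\<in>B - A. insert x A \<in> M"
  using matroid_independence_system[OF matroid] by (simp add: independence_system_def)

lemma ex_basis_above:
  assumes "I \<in> M" "I \<subseteq> W"
  shows "\<exists>B\<in>bases (induced M W). I \<subseteq> B"
proof -
  let ?S = "{A \<in> M. I \<subseteq> A \<and> A \<subseteq> W}"
  have S: "finite ?S" "?S \<noteq> {}" using finite_M assms by auto
  have "Max (card ` ?S) \<in> card ` ?S" using S by (intro Max_in) auto
  then obtain B where B: "B \<in> ?S" "card B = Max (card ` ?S)" by (metis (no_types, lifting) imageE)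
  have "A = B" if A: "A \<in> induced M W" "B \<subseteq> A" for A
  proof -
    have "A \<in> ?S" using A B by (auto simp: induced_def)
    then have "card A \<le> card B" unfolding B(2) using S by (intro Max_ge) auto
    moreover have "finite A" using A finite_indep by (auto simp: induced_def)
    ultimately show "A = B" using card_seteq[of A B] A by auto
  qed
  then show ?thesis using B by (intro bexI[of _ B]) (auto simp: bases_def induced_def)
qed

lemma bases_card_le:
  assumes B: "B \<in> bases (induced M W)" and I: "I \<in> M" "I \<subseteq> W"
  shows "card I \<le> card B"
proof (rule ccontr)
  assume "\<not> card I \<le> card B"
  then obtain x where x: "x \<in> I - B" "insert x B \<in> M"
    using exchange[of B I] B I by (auto simp: bases_def induced_def)
  then have "insert x B \<in> induced M W" using B I by (auto simp: bases_def induced_def)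
  then show False using B x unfolding bases_def by blast
qed

lemma card_basis:
  assumes B: "B \<in> bases (induced M W)"
  shows "card B = rank_of M W"
proof -
  have eq: "card B' = card B" if "B' \<in> bases (induced M W)" for B'
    using bases_card_le[OF B, of B'] bases_card_le[OF that, of B] that B
    by (auto simp: bases_def induced_def intro: antisym)
  have "(THE n. \<forall>B\<in>bases (induced M W). card B = n) = card B"
  proof (rule the_equality)
    show "\<forall>B'\<in>bases (induced M W). card B' = card B" using eq by blast
    fix n assume "\<forall>B\<in>bases (induced M W). card B = n"
    then have "card B = n" using B by (rule bspec)
    then show "n = card B" by (rule sym)
  qed
  then show ?thesis by (simp add: rank_of_def matroid_rank_def)
qed

lemma indep_extend:
  assumes "I \<in> M" "I \<subseteq> W"
  obtains B where "B \<in> M" "I \<subseteq> B" "B \<subseteq> W" "card B = rank_of M W" "B \<in> bases (induced M W)"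
  using ex_basis_above[OF assms] card_basis by (auto simp: bases_def induced_def)

lemma rank_ge: "I \<in> M \<Longrightarrow> I \<subseteq> W \<Longrightarrow> card I \<le> rank_of M W"
  using ex_basis_above[of "{}" W] bases_card_le card_basis empty_indep by force

lemma rank_mono: "A \<subseteq> B \<Longrightarrow> rank_of M A \<le> rank_of M B"
  by (metis empty_indep empty_subsetI indep_extend order_trans rank_ge)

lemma span_subset: "matroid_span M A \<subseteq> vertex_set M"
  by (auto simp: matroid_span_def)

lemma span_extensive: "A \<subseteq> vertex_set M \<Longrightarrow> A \<subseteq> matroid_span M A"
  by (auto simp: matroid_span_def insert_absorb)

lemma rank_span:
  assumes "A \<subseteq> vertex_set M"
  shows "rank_of M (matroid_span M A) = rank_of M A"
proof (rule antisym)
  show "rank_of M A \<le> rank_of M (matroid_span M A)"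
    using span_extensive[OF assms] by (rule rank_mono)
  obtain I where I: "I \<in> M" "I \<subseteq> A" "card I = rank_of M A"
    using indep_extend[OF empty_indep] by (metis empty_subsetI)
  obtain J where J: "J \<in> M" "J \<subseteq> matroid_span M A" "card J = rank_of M (matroid_span M A)"
    using indep_extend[OF empty_indep] by (metis empty_subsetI)
  show "rank_of M (matroid_span M A) \<le> rank_of M A"
  proof (rule ccontr)
    assume "\<not> rank_of M (matroid_span M A) \<le> rank_of M A"
    then obtain x where x: "x \<in> J - I" "insert x I \<in> M" using exchange[of I J] I J by auto
    then have "rank_of M (A \<union> {x}) = rank_of M A" using J by (auto simp: matroid_span_def)
    moreover have "card (insert x I) \<le> rank_of M (A \<union> {x})" using x I by (intro rank_ge) auto
    ultimately show False using x I finite_indep[of I] by simp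
  qed
qed

text \<open>A basis of \<open>A\<close> extends to one of \<open>B\<close>. If \<open>v\<close>
  raised the rank of \<open>B\<close>, exchange could enlarge the latter only by \<open>v\<close>
  itself, and then \<open>v\<close> would already be independent of the basis of
  \<open>A\<close>.\<close>

lemma span_mono:
  assumes "A \<subseteq> B"
  shows "matroid_span M A \<subseteq> matroid_span M B"
proof
  fix v assume v: "v \<in> matroid_span M A"
  then have vA: "v \<in> vertex_set M" "rank_of M (A \<union> {v}) = rank_of M A" by (auto simp: matroid_span_def)
  have "rank_of M (B \<union> {v}) \<le> rank_of M B"
  proof (rule ccontr)
    assume less: "\<not> rank_of M (B \<union> {v}) \<le> rank_of M B"
    obtain I where I: "I \<in> M" "I \<subseteq> A" "card I = rank_of M A"
      using indep_extend[OF empty_indep] by (metis empty_subsetI)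
    obtain I' where I': "I' \<in> M" "I \<subseteq> I'" "I' \<subseteq> B" "card I' = rank_of M B"
      using indep_extend[OF I(1), of B] I(2) assms by (metis order_trans)
    obtain J where J: "J \<in> M" "J \<subseteq> B \<union> {v}" "card J = rank_of M (B \<union> {v})"
      using indep_extend[OF empty_indep] by (metis empty_subsetI)
    obtain x where x: "x \<in> J - I'" "insert x I' \<in> M" using exchange[of I' J] I' J less by auto
    have "x = v"
    proof (rule ccontr)
      assume "x \<noteq> v"
      then have "card (insert x I') \<le> rank_of M B" using x J I' by (intro rank_ge) auto
      then show False using x I' finite_indep[of I'] by simp
    qed
    then have "insert v I \<in> M" using x(2) I'(2) by (auto intro: subset_indep)
    then have "card (insert v I) \<le> rank_of M (A \<union> {v})" using I by (intro rank_ge) auto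
    moreover have "v \<notin> I" using x \<open>x = v\<close> I' by auto
    ultimately show False using vA I finite_indep[of I] by simp
  qed
  then have "rank_of M (B \<union> {v}) = rank_of M B" by (rule antisym) (rule rank_mono, blast)
  then show "v \<in> matroid_span M B" using vA by (simp add: matroid_span_def)
qed

lemma span_span:
  assumes "A \<subseteq> vertex_set M"
  shows "matroid_span M (matroid_span M A) = matroid_span M A"
proof
  show "matroid_span M A \<subseteq> matroid_span M (matroid_span M A)"
    by (rule span_extensive[OF span_subset])
  show "matroid_span M (matroid_span M A) \<subseteq> matroid_span M A"
  proof
    fix v assume v: "v \<in> matroid_span M (matroid_span M A)"
    have "rank_of M (A \<union> {v}) \<le> rank_of M (matroid_span M A \<union> {v})"
      using span_extensive[OF assms] by (intro rank_mono) auto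
    also have "\<dots> = rank_of M A" using v rank_span[OF assms] by (simp add: matroid_span_def)
    finally have "rank_of M (A \<union> {v}) = rank_of M A" by (rule antisym) (rule rank_mono, blast)
    then show "v \<in> matroid_span M A" using v by (simp add: matroid_span_def)
  qed
qed

lemma subset_span_basis:
  assumes "I \<in> M" "I \<subseteq> A" "card I = rank_of M A" "A \<subseteq> vertex_set M"
  shows "A \<subseteq> matroid_span M I"
proof
  fix v assume v: "v \<in> A"
  have "rank_of M (I \<union> {v}) \<le> rank_of M A" using assms v by (intro rank_mono) auto
  also have "\<dots> = card I" using assms by simp
  also have "card I \<le> rank_of M I" using assms by (intro rank_ge) auto
  finally have "rank_of M (I \<union> {v}) = rank_of M I" by (rule antisym) (rule rank_mono, blast)
  then show "v \<in> matroid_span M I" using assms v by (auto simp: matroid_span_def)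
qed

end

section \<open>Systems of chains indexed by cubes and flags\<close>

context ordered_ground
begin

abbreviation fs :: "'a set \<Rightarrow> 'a set set \<Rightarrow> int" where
  "fs \<equiv> esign (\<subset>)"

type_synonym 'b system = "'b set \<Rightarrow> 'b set \<Rightarrow> 'b set set \<Rightarrow> 'b set \<Rightarrow> int"

text \<open>
  A system assigns a chain to each cell \<open>(\<sigma>, E, F)\<close>: the cube of all sets between \<open>\<sigma>\<close> and \<open>\<sigma> \<union> E\<close>,
  times the simplex spanned by the flag \<open>F\<close>.
\<close>

definition cube_bd :: "'a system \<Rightarrow> 'a system" where
  "cube_bd f \<sigma> E F \<rho> = (\<Sum>x\<in>E. es x E * (f \<sigma> (E - {x}) F \<rho> - f (insert x \<sigma>) (E - {x}) F \<rho>))"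

definition flag_bd :: "'a system \<Rightarrow> 'a system" where
  "flag_bd f \<sigma> E F \<rho> = (\<Sum>G\<in>F. fs G F * f \<sigma> E (F - {G}) \<rho>)"

definition cell_bd :: "'a system \<Rightarrow> 'a system" where
  "cell_bd f \<sigma> E F \<rho> = cube_bd f \<sigma> E F \<rho> + (-1) ^ card E * flag_bd f \<sigma> E F \<rho>"

text \<open>Opposite facets are compared only through their difference, and the two base points may
  differ; \<open>flag_extension_project\<close> exploits both.\<close>

lemma cell_bd_cong:
  assumes "\<And>x. x \<in> E \<Longrightarrow> f \<sigma> (E - {x}) F \<rho> - f (insert x \<sigma>) (E - {x}) F \<rho>
      = g \<sigma>' (E - {x}) F \<rho> - g (insert x \<sigma>') (E - {x}) F \<rho>"
    and "\<And>G. G \<in> F \<Longrightarrow> f \<sigma> E (F - {G}) \<rho> = g \<sigma>' E (F - {G}) \<rho>"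
  shows "cell_bd f \<sigma> E F \<rho> = cell_bd g \<sigma>' E F \<rho>"
  unfolding cell_bd_def cube_bd_def flag_bd_def using assms by (simp cong: sum.cong)

lemma cell_bd_nonzero:
  assumes "cell_bd f \<sigma> E F \<rho> \<noteq> 0"
  shows "(\<exists>x\<in>E. f \<sigma> (E - {x}) F \<rho> \<noteq> 0 \<or> f (insert x \<sigma>) (E - {x}) F \<rho> \<noteq> 0)
    \<or> (\<exists>G\<in>F. f \<sigma> E (F - {G}) \<rho> \<noteq> 0)"
proof (rule ccontr)
  assume "\<not> ?thesis"
  then have "cube_bd f \<sigma> E F \<rho> = 0" "flag_bd f \<sigma> E F \<rho> = 0"
    by (auto simp: cube_bd_def flag_bd_def intro!: sum.neutral)
  then show False using assms by (simp add: cell_bd_def)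
qed

lemma cell_bd_add: "cell_bd (\<lambda>\<sigma> E F \<rho>. f \<sigma> E F \<rho> + g \<sigma> E F \<rho>) \<sigma> E F \<rho> = cell_bd f \<sigma> E F \<rho> + cell_bd g \<sigma> E F \<rho>"
  by (simp add: cell_bd_def cube_bd_def flag_bd_def algebra_simps sum.distrib sum_subtractf)

lemma cell_bd_uminus: "cell_bd (\<lambda>\<sigma> E F \<rho>. - f \<sigma> E F \<rho>) \<sigma> E F \<rho> = - cell_bd f \<sigma> E F \<rho>"
  by (simp add: cell_bd_def cube_bd_def flag_bd_def algebra_simps sum_negf sum_subtractf)

lemma bd_cell_bd: "bd (cell_bd f \<sigma> E F) \<rho> = cell_bd (\<lambda>\<sigma> E F. bd (f \<sigma> E F)) \<sigma> E F \<rho>"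
proof -
  have "cell_bd f \<sigma> E F = (\<lambda>\<rho>. (\<Sum>x\<in>E. es x E * (f \<sigma> (E - {x}) F \<rho> - f (insert x \<sigma>) (E - {x}) F \<rho>))
      + (-1) ^ card E * (\<Sum>G\<in>F. fs G F * f \<sigma> E (F - {G}) \<rho>))"
    by (simp add: cell_bd_def cube_bd_def flag_bd_def fun_eq_iff)
  then show ?thesis
    by (simp add: bd_add bd_sum bd_scale bd_diff cell_bd_def cube_bd_def flag_bd_def)
qed

lemma cube_bd_cube_bd:
  assumes "E \<subseteq> V"
  shows "cube_bd (cube_bd f) \<sigma> E F \<rho> = 0"
proof -
  let ?h = "\<lambda>x y. (f \<sigma> (E - {x} - {y}) F \<rho> - f (insert y \<sigma>) (E - {x} - {y}) F \<rho>)
      - (f (insert x \<sigma>) (E - {x} - {y}) F \<rho> - f (insert y (insert x \<sigma>)) (E - {x} - {y}) F \<rho>)"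
  have "cube_bd (cube_bd f) \<sigma> E F \<rho> = (\<Sum>x\<in>E. \<Sum>y\<in>E-{x}. es x E * es y (E - {x}) * ?h x y)"
    unfolding cube_bd_def
    by (intro sum.cong refl) (simp only: right_diff_distrib sum_subtractf sum_distrib_left mult.assoc)
  also have "\<dots> = 0"
  proof (rule sum_antisymmetric)
    fix x y assume xy: "x \<in> E" "y \<in> E" "x \<noteq> y"
    have "E - {x} - {y} = E - {y} - {x}" "insert x (insert y \<sigma>) = insert y (insert x \<sigma>)" by auto
    then have "?h x y = ?h y x" by simp
    then show "es x E * es y (E - {x}) * ?h x y = - (es y E * es x (E - {y}) * ?h y x)"
      using es_swap[OF assms xy] by simp
  qed (use assms finite_sub in blast)
  finally show ?thesis .
qed

lemma flag_bd_flag_bd: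
  assumes "finite F" "\<And>G H. G \<in> F \<Longrightarrow> H \<in> F \<Longrightarrow> G \<subseteq> H \<or> H \<subseteq> G"
  shows "flag_bd (flag_bd f) \<sigma> E F \<rho> = 0"
proof -
  have "flag_bd (flag_bd f) \<sigma> E F \<rho> = (\<Sum>G\<in>F. \<Sum>H\<in>F-{G}. fs G F * fs H (F - {G}) * f \<sigma> E (F - {G} - {H}) \<rho>)"
    unfolding flag_bd_def
    by (intro sum.cong refl) (simp only: sum_distrib_left mult.assoc)
  also have "\<dots> = 0"
  proof (rule sum_antisymmetric)
    fix G H assume GH: "G \<in> F" "H \<in> F" "G \<noteq> H"
    have "F - {G} - {H} = F - {H} - {G}" by auto
    moreover have "fs G F * fs H (F - {G}) = - (fs H F * fs G (F - {H}))"
      using GH assms(2)[OF GH(1,2)] by (intro esign_swap assms(1)) auto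
    ultimately show "fs G F * fs H (F - {G}) * f \<sigma> E (F - {G} - {H}) \<rho>
        = - (fs H F * fs G (F - {H}) * f \<sigma> E (F - {H} - {G}) \<rho>)"
      by simp
  qed (rule assms(1))
  finally show ?thesis .
qed

lemma cube_bd_flag_bd: "cube_bd (flag_bd f) \<sigma> E F \<rho> = flag_bd (cube_bd f) \<sigma> E F \<rho>"
proof -
  have "cube_bd (flag_bd f) \<sigma> E F \<rho> = (\<Sum>x\<in>E. \<Sum>G\<in>F. fs G F *
      (es x E * (f \<sigma> (E - {x}) (F - {G}) \<rho> - f (insert x \<sigma>) (E - {x}) (F - {G}) \<rho>)))"
    unfolding cube_bd_def flag_bd_def
    by (simp add: sum_subtractf sum_distrib_left algebra_simps)
  also have "\<dots> = flag_bd (cube_bd f) \<sigma> E F \<rho>"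
    unfolding cube_bd_def flag_bd_def sum_distrib_left by (rule sum.swap)
  finally show ?thesis .
qed

text \<open>The usual argument for a product: removing a direction of the cube changes the sign
  \<open>(-1) ^ card E\<close>, so the two mixed terms cancel.\<close>

lemma cell_bd_cell_bd:
  assumes "E \<subseteq> V" "finite F" "\<And>G H. G \<in> F \<Longrightarrow> H \<in> F \<Longrightarrow> G \<subseteq> H \<or> H \<subseteq> G"
  shows "cell_bd (cell_bd f) \<sigma> E F \<rho> = 0"
proof -
  have fin: "finite E" using assms(1) by (rule finite_sub)
  have "(-1) ^ card (E - {x}) = - ((-1) ^ card E :: int)" if "x \<in> E" for x
    unfolding card.remove[OF fin that] by simp
  then have "cube_bd (cell_bd f) \<sigma> E F \<rho> = cube_bd (cube_bd f) \<sigma> E F \<rho> - (-1) ^ card E * cube_bd (flag_bd f) \<sigma> E F \<rho>"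
    unfolding cell_bd_def[abs_def] cube_bd_def[of "\<lambda>\<sigma> E F \<rho>. cube_bd f \<sigma> E F \<rho> + _ E * flag_bd f \<sigma> E F \<rho>"]
      cube_bd_def[of "cube_bd f"] cube_bd_def[of "flag_bd f"] sum_distrib_left sum_subtractf[symmetric]
    by (intro sum.cong refl) (simp add: algebra_simps)
  moreover have "flag_bd (cell_bd f) \<sigma> E F \<rho> = flag_bd (cube_bd f) \<sigma> E F \<rho> + (-1) ^ card E * flag_bd (flag_bd f) \<sigma> E F \<rho>"
    unfolding cell_bd_def[abs_def] flag_bd_def[of "\<lambda>\<sigma> E F \<rho>. cube_bd f \<sigma> E F \<rho> + _ E * flag_bd f \<sigma> E F \<rho>"]
      flag_bd_def[of "cube_bd f"] flag_bd_def[of "flag_bd f"] sum_distrib_left sum.distrib[symmetric]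
    by (intro sum.cong refl) (simp add: algebra_simps)
  ultimately show ?thesis
    unfolding cell_bd_def[of "cell_bd f"]
    using assms by (simp add: cube_bd_cube_bd flag_bd_flag_bd cube_bd_flag_bd algebra_simps)
qed

end

section \<open>The matroid system\<close>

lemma Union_chain_in:
  assumes "finite F" "F \<noteq> {}" "\<And>G H. G \<in> F \<Longrightarrow> H \<in> F \<Longrightarrow> G \<subseteq> H \<or> H \<subseteq> G"
  shows "\<Union>F \<in> F"
  using assms
proof (induction rule: finite_ne_induct)
  case (insert G F)
  then have "\<Union>F \<in> F" by blast
  then have "G \<subseteq> \<Union>F \<or> \<Union>F \<subseteq> G" using insert.prems by blast
  then show ?case
  proof
    assume "G \<subseteq> \<Union>F"
    then have "\<Union>(insert G F) = \<Union>F" by auto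
    then show ?thesis using \<open>\<Union>F \<in> F\<close> by simp
  next
    assume "\<Union>F \<subseteq> G"
    then have "\<Union>(insert G F) = G" by auto
    then show ?thesis by simp
  qed
qed simp

locale ordered_matroid = ordered_ground V pos + matroid_ground M
  for V :: "'a set" and pos :: "'a \<Rightarrow> nat" and M :: "'a set set" +
  assumes vertex_set_M: "vertex_set M = V"
begin

abbreviation "cl \<equiv> matroid_span M"
abbreviation "rk \<equiv> rank_of M"

lemma M_subset: "M \<subseteq> Pow V"
  using vertex_set_M by (auto simp: vertex_set_def)

text \<open>
  The numerical condition bounds the dimension of the cycles that have to be filled inside the
  matroid restricted to a member \<open>G\<close> of the flag; \<open>card {H \<in> F. H \<subset> G}\<close> is the position of \<open>G\<close> in the flag.
\<close>

definition cell :: "'a set \<Rightarrow> 'a set \<Rightarrow> 'a set set \<Rightarrow> bool" where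
  "cell \<sigma> E F \<longleftrightarrow> \<sigma> \<subseteq> V \<and> E \<subseteq> V \<and> \<sigma> \<inter> E = {} \<and> F \<subseteq> Pow V
     \<and> (\<forall>G\<in>F. \<forall>H\<in>F. G \<subseteq> H \<or> H \<subseteq> G)
     \<and> (\<forall>G\<in>F. cl (G - (\<sigma> \<union> E)) = G \<and> card (E \<inter> G) + card {H \<in> F. H \<subset> G} < rk G)"

lemma cell_basics:
  assumes "cell \<sigma> E F"
  shows "\<sigma> \<subseteq> V" "E \<subseteq> V" "finite E" "finite F" "\<sigma> \<inter> E = {}"
    "\<And>G H. G \<in> F \<Longrightarrow> H \<in> F \<Longrightarrow> G \<subseteq> H \<or> H \<subseteq> G"
    "\<And>G. G \<in> F \<Longrightarrow> G \<subseteq> V"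
proof -
  show "\<sigma> \<subseteq> V" "E \<subseteq> V" "\<sigma> \<inter> E = {}"
    using assms by (auto simp: cell_def)
  then show "finite E" by (intro finite_sub)
  show "finite F" using assms finite_V by (auto simp: cell_def intro: finite_subset)
  show "\<And>G H. G \<in> F \<Longrightarrow> H \<in> F \<Longrightarrow> G \<subseteq> H \<or> H \<subseteq> G" "\<And>G. G \<in> F \<Longrightarrow> G \<subseteq> V"
    using assms by (auto simp: cell_def)
qed

lemma cell_cl:
  assumes "cell \<sigma> E F" "G \<in> F" "G - (\<sigma> \<union> E) \<subseteq> A" "A \<subseteq> G"
  shows "cl A = G"
proof -
  have G: "cl (G - (\<sigma> \<union> E)) = G" "G \<subseteq> V" using assms(1,2) by (auto simp: cell_def)
  then have "G - (\<sigma> \<union> E) \<subseteq> vertex_set M" using vertex_set_M by auto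
  then have "cl G = G" using span_span G(1) by metis
  then show ?thesis
    using span_mono[OF assms(3)] span_mono[OF assms(4)] G(1) by auto
qed

lemma cell_face:
  assumes c: "cell \<sigma> E F"
  shows "x \<in> E \<Longrightarrow> cell \<sigma> (E - {x}) F" "x \<in> E \<Longrightarrow> cell (insert x \<sigma>) (E - {x}) F"
    "G \<in> F \<Longrightarrow> cell \<sigma> E (F - {G})"
proof -
  note cb = cell_basics[OF c]
  have lt: "card (E \<inter> G) + card {H \<in> F. H \<subset> G} < rk G" if "G \<in> F" for G
    using c that by (simp add: cell_def)
  {
    assume x: "x \<in> E"
    have lt': "card ((E - {x}) \<inter> G) + card {H \<in> F. H \<subset> G} < rk G" if "G \<in> F" for G
    proof -
      have "card ((E - {x}) \<inter> G) \<le> card (E \<inter> G)" using cb(3) by (intro card_mono) auto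
      then show ?thesis using lt[OF that] by simp
    qed
    have "cl (G - (\<sigma> \<union> (E - {x}))) = G" if "G \<in> F" for G
      using that by (intro cell_cl[OF c]) auto
    then show "cell \<sigma> (E - {x}) F"
      using c lt' by (auto simp: cell_def)
    have "insert x \<sigma> \<union> (E - {x}) = \<sigma> \<union> E" using x by auto
    then have "cl (G - (insert x \<sigma> \<union> (E - {x}))) = G" if "G \<in> F" for G
      using c that by (simp add: cell_def)
    then show "cell (insert x \<sigma>) (E - {x}) F"
      using c x lt' by (auto simp: cell_def)
  }
  {
    assume "G \<in> F"
    have "card {H \<in> F - {G}. H \<subset> G'} \<le> card {H \<in> F. H \<subset> G'}" for G'
      using cb(4) by (intro card_mono) auto
    then have lt': "card (E \<inter> G') + card {H \<in> F - {G}. H \<subset> G'} < rk G'" if "G' \<in> F" for G'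
      using lt[OF that] by (rule le_less_trans[OF add_left_mono])
    have "cl (G' - (\<sigma> \<union> E)) = G'" if "G' \<in> F" for G'
      using c that by (simp add: cell_def)
    moreover have "F - {G} \<subseteq> Pow V" using c by (auto simp: cell_def)
    ultimately show "cell \<sigma> E (F - {G})"
      unfolding cell_def using cb(1,2,5,6) lt' by (intro conjI ballI) simp_all
  }
qed

text \<open>
  The chain of a cell may depend on \<open>\<sigma>\<close> only through \<open>\<sigma> \<inter> \<Union>F\<close> and must vanish unless \<open>E \<subseteq> \<Union>F\<close>,
  since only then the dimension bound applies. Without a flag it is the augmentation.
\<close>

definition flag_extension :: "('a set \<times> 'a set \<times> 'a set set \<Rightarrow> 'a set \<Rightarrow> int) \<Rightarrow> 'a system" where
  "flag_extension c \<sigma> E F \<rho> =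
     (if E \<subseteq> \<Union>F then if F = {} then if \<rho> = {} then 1 else 0 else c (\<sigma> \<inter> \<Union>F, E, F) \<rho> else 0)"

text \<open>The minus sign lets \<open>bd\<close> of \<open>b\<close> cancel \<open>cell_bd\<close>
  of \<open>b\<close> in \<open>target_cycle\<close>, where \<open>b\<close> is added to the
  boundary of cells over \<open>X\<close>.\<close>

definition supported_system :: "'a system \<Rightarrow> 'a set \<Rightarrow> 'a set \<Rightarrow> 'a set set \<Rightarrow> bool" where
  "supported_system b \<sigma> E F \<longleftrightarrow> chain_on (induced M (\<Union>F - \<sigma>)) (card E + card F) (b \<sigma> E F)
     \<and> (\<forall>\<rho>\<subseteq>V. bd (b \<sigma> E F) \<rho> = - cell_bd b \<sigma> E F \<rho>)"

text \<open>The equation is imposed only on normalised cells, with \<open>\<sigma>\<close> and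
  \<open>E\<close> inside the largest flat; all other triples carry no condition, and
  \<open>flag_extension\<close> reduces general cells to these.\<close>

definition flag_solution :: "('a set \<times> 'a set \<times> 'a set set \<Rightarrow> 'a set \<Rightarrow> int) \<Rightarrow>
    'a set \<times> 'a set \<times> 'a set set \<Rightarrow> ('a set \<Rightarrow> int) \<Rightarrow> bool" where
  "flag_solution c = (\<lambda>(\<sigma>, E, F) r. cell \<sigma> E F \<and> F \<noteq> {} \<and> \<sigma> \<subseteq> \<Union>F \<and> E \<subseteq> \<Union>F \<longrightarrow>
     chain_on (induced M (\<Union>F - \<sigma>)) (card E + card F) r
     \<and> (\<forall>\<rho>\<subseteq>V. bd r \<rho> = - cell_bd (flag_extension c) \<sigma> E F \<rho>))"

definition cell_dim :: "'a set \<times> 'a set \<times> 'a set set \<Rightarrow> nat" where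
  "cell_dim = (\<lambda>(\<sigma>, E, F). card E + card F)"

lemma cell_dim_face:
  assumes "cell \<sigma> E F"
  shows "x \<in> E \<Longrightarrow> Suc (card (E - {x}) + card F) = card E + card F"
    "G \<in> F \<Longrightarrow> Suc (card E + card (F - {G})) = card E + card F"
  using cell_basics(3,4)[OF assms] by (simp_all only: card.remove)

lemma flag_extension_project:
  assumes "E \<subseteq> \<Union>F" "\<rho> \<subseteq> V"
  shows "cell_bd (flag_extension c) (\<sigma> \<inter> \<Union>F) E F \<rho> = cell_bd (flag_extension c) \<sigma> E F \<rho>"
proof (rule cell_bd_cong)
  fix x assume "x \<in> E"
  then have "insert x (\<sigma> \<inter> \<Union>F) \<inter> \<Union>F = insert x \<sigma> \<inter> \<Union>F" using assms by auto
  then show "flag_extension c (\<sigma> \<inter> \<Union>F) (E - {x}) F \<rho> - flag_extension c (insert x (\<sigma> \<inter> \<Union>F)) (E - {x}) F \<rho>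
      = flag_extension c \<sigma> (E - {x}) F \<rho> - flag_extension c (insert x \<sigma>) (E - {x}) F \<rho>"
    by (simp add: flag_extension_def Int_assoc)
next
  fix G assume "G \<in> F"
  have "\<sigma> \<inter> \<Union>F \<inter> \<Union>(F - {G}) = \<sigma> \<inter> \<Union>(F - {G})" by auto
  then show "flag_extension c (\<sigma> \<inter> \<Union>F) E (F - {G}) \<rho> = flag_extension c \<sigma> E (F - {G}) \<rho>"
    by (simp add: flag_extension_def)
qed

text \<open>For an empty flag the opposite facets of an edge both give 1 and cancel. If some
  direction of \<open>E\<close> leaves \<open>\<Union>F\<close>, the chain is 0 and so is its
  required boundary: opposite facets in such a direction depend on the same
  \<open>\<sigma> \<inter> \<Union>F\<close>. Otherwise the normalised solution applies.\<close>

lemma flag_extension_supported: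
  assumes sol: "\<And>p. cell_dim p < n \<Longrightarrow> flag_solution c p (c p)"
    and cell: "cell \<sigma> E F" and n: "card E + card F < n"
  shows "supported_system (flag_extension c) \<sigma> E F"
proof -
  note cb = cell_basics[OF cell]
  let ?b = "flag_extension c"
  have b_empty: "?b \<sigma>' E' {} \<rho> = (if E' = {} \<and> \<rho> = {} then 1 else 0)" for \<sigma>' E' \<rho>
    by (simp add: flag_extension_def)
  consider "F = {}" | "F \<noteq> {}" "\<not> E \<subseteq> \<Union>F" | "F \<noteq> {}" "E \<subseteq> \<Union>F" by blast
  then show ?thesis
  proof cases
    case 1
    have "chain_on (induced M (\<Union>F - \<sigma>)) (card E + card F) (?b \<sigma> E F)"
      using 1 empty_indep by (auto simp: chain_on_def flag_extension_def induced_def split: if_splits)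
    moreover have "bd (?b \<sigma> E F) \<rho> = 0" for \<rho>
      using 1 by (intro bd_eq_0) (simp add: flag_extension_def)
    moreover have "cell_bd ?b \<sigma> E F \<rho> = 0" for \<rho>
      using 1 by (simp add: cell_bd_def cube_bd_def flag_bd_def b_empty)
    ultimately show ?thesis by (simp add: supported_system_def)
  next
    case 2
    have z: "?b \<sigma> E F = (\<lambda>\<rho>. 0)" using 2(2) by (simp only: flag_extension_def fun_eq_iff if_False simp_thms)
    have "cell_bd ?b \<sigma> E F \<rho> = 0" for \<rho>
    proof -
      have "?b \<sigma> (E - {x}) F \<rho> - ?b (insert x \<sigma>) (E - {x}) F \<rho> = 0" if "x \<in> E" for x
      proof (cases "E - {x} \<subseteq> \<Union>F")
        case True
        then have "insert x \<sigma> \<inter> \<Union>F = \<sigma> \<inter> \<Union>F" using 2 by auto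
        then show ?thesis by (simp add: flag_extension_def)
      qed (simp add: flag_extension_def)
      moreover have "?b \<sigma> E (F - {G}) \<rho> = 0" for G
      proof -
        have "\<not> E \<subseteq> \<Union>(F - {G})" using 2(2) by auto
        then show ?thesis by (simp only: flag_extension_def if_False)
      qed
      ultimately show ?thesis by (simp add: cell_bd_def cube_bd_def flag_bd_def)
    qed
    then show ?thesis by (simp add: supported_system_def z chain_on_def bd_eq_0)
  next
    case 3
    have "G - (\<sigma> \<inter> \<Union>F \<union> E) = G - (\<sigma> \<union> E)" if "G \<in> F" for G using that by auto
    then have "cell (\<sigma> \<inter> \<Union>F) E F" using cell by (auto simp: cell_def)
    moreover have "flag_solution c (\<sigma> \<inter> \<Union>F, E, F) (c (\<sigma> \<inter> \<Union>F, E, F))"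
      by (rule sol) (simp add: cell_dim_def n)
    ultimately have s: "chain_on (induced M (\<Union>F - \<sigma> \<inter> \<Union>F)) (card E + card F) (c (\<sigma> \<inter> \<Union>F, E, F))"
      "\<forall>\<rho>\<subseteq>V. bd (c (\<sigma> \<inter> \<Union>F, E, F)) \<rho> = - cell_bd ?b (\<sigma> \<inter> \<Union>F) E F \<rho>"
      using 3 by (simp_all add: flag_solution_def)
    have "?b \<sigma> E F = c (\<sigma> \<inter> \<Union>F, E, F)"
      using 3 by (simp only: flag_extension_def fun_eq_iff if_True if_False simp_thms)
    moreover have "\<Union>F - \<sigma> \<inter> \<Union>F = \<Union>F - \<sigma>" by auto
    ultimately show ?thesis
      using s flag_extension_project[OF 3(2)] by (simp add: supported_system_def)
  qed
qed

text \<open>The prescribed boundary is a cycle with \<open>card E + card F - 1\<close> vertices per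
  face in the matroid restricted to \<open>U - \<sigma>\<close>, where \<open>U\<close> is the
  largest flat. The position of \<open>U\<close> is \<open>card F - 1\<close>, so the cell condition
  makes this less than \<open>rk U\<close>; and \<open>U\<close> is spanned already by
  \<open>U - (\<sigma> \<union> E)\<close>. Acyclicity of matroids below the top then fills
  it.\<close>

lemma flag_solution_step:
  assumes sol: "\<And>p. cell_dim p < cell_dim (\<sigma>, E, F) \<Longrightarrow> flag_solution c p (c p)"
  shows "\<exists>r. flag_solution c (\<sigma>, E, F) r"
proof (cases "cell \<sigma> E F \<and> F \<noteq> {} \<and> \<sigma> \<subseteq> \<Union>F \<and> E \<subseteq> \<Union>F")
  case False
  then show ?thesis by (auto simp: flag_solution_def)
next
  case True
  then have cell: "cell \<sigma> E F" and F: "F \<noteq> {}" and E: "E \<subseteq> \<Union>F" by auto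
  note cb = cell_basics[OF cell]
  let ?b = "flag_extension c"
  have sup: "supported_system ?b \<sigma>' E' F'" if "cell \<sigma>' E' F'" "card E' + card F' < card E + card F" for \<sigma>' E' F'
    using that by (intro flag_extension_supported[of "cell_dim (\<sigma>, E, F)"] sol) (simp_all add: cell_dim_def)
  have supE: "supported_system ?b \<sigma> (E - {x}) F" "supported_system ?b (insert x \<sigma>) (E - {x}) F" if "x \<in> E" for x
    using cell_face(1,2)[OF cell that] cell_dim_face(1)[OF cell that] by (auto intro!: sup)
  have supF: "supported_system ?b \<sigma> E (F - {G})" if "G \<in> F" for G
    using cell_face(3)[OF cell that] cell_dim_face(2)[OF cell that] by (auto intro!: sup)
  define U where "U = \<Union>F"
  have U: "U \<in> F" unfolding U_def using cb(4) F cb(6) by (rule Union_chain_in)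
  define k where "k = card E + card F - 1"
  define R where "R \<rho> = - cell_bd ?b \<sigma> E F \<rho>" for \<rho>
  have R: "chain_on (induced M (U - \<sigma>)) k R"
  proof (rule chain_onI)
    fix \<rho> assume "R \<rho> \<noteq> 0"
    then have "cell_bd ?b \<sigma> E F \<rho> \<noteq> 0" by (simp add: R_def)
    then consider x where "x \<in> E" "?b \<sigma> (E - {x}) F \<rho> \<noteq> 0" | x where "x \<in> E" "?b (insert x \<sigma>) (E - {x}) F \<rho> \<noteq> 0"
      | G where "G \<in> F" "?b \<sigma> E (F - {G}) \<rho> \<noteq> 0"
      using cell_bd_nonzero by blast
    then show "\<rho> \<in> induced M (U - \<sigma>) \<and> card \<rho> = k"
    proof cases
      case 1
      have "k = card (E - {x}) + card F"
        using cell_dim_face(1)[OF cell 1(1)] by (simp add: k_def)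
      then have "chain_on (induced M (U - \<sigma>)) k (?b \<sigma> (E - {x}) F)"
        using supE(1)[OF 1(1)] by (simp add: supported_system_def U_def)
      from chain_onD[OF this 1(2)] show ?thesis by (auto simp: induced_def U_def)
    next
      case 2
      have "k = card (E - {x}) + card F"
        using cell_dim_face(1)[OF cell 2(1)] by (simp add: k_def)
      then have "chain_on (induced M (U - insert x \<sigma>)) k (?b (insert x \<sigma>) (E - {x}) F)"
        using supE(2)[OF 2(1)] by (simp add: supported_system_def U_def)
      from chain_onD[OF this 2(2)] show ?thesis by (auto simp: induced_def U_def)
    next
      case 3
      have "k = card E + card (F - {G})"
        using cell_dim_face(2)[OF cell 3(1)] by (simp add: k_def)
      then have "chain_on (induced M (\<Union>(F - {G}) - \<sigma>)) k (?b \<sigma> E (F - {G}))"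
        using supF[OF 3(1)] by (simp add: supported_system_def U_def)
      from chain_onD[OF this 3(2)] show ?thesis by (auto simp: induced_def U_def)
    qed
  qed
  have sub: "induced M (U - \<sigma>) \<subseteq> Pow V" using M_subset by (auto simp: induced_def)
  have cyc: "bd R \<rho> = 0" for \<rho>
  proof (cases "\<rho> \<subseteq> V")
    case True
    have "bd R \<rho> = - bd (cell_bd ?b \<sigma> E F) \<rho>" unfolding R_def[abs_def] by (rule bd_uminus)
    also have "bd (cell_bd ?b \<sigma> E F) \<rho> = cell_bd (\<lambda>\<sigma> E F. bd (?b \<sigma> E F)) \<sigma> E F \<rho>"
      by (rule bd_cell_bd)
    also have "\<dots> = cell_bd (\<lambda>\<sigma> E F \<rho>. - cell_bd ?b \<sigma> E F \<rho>) \<sigma> E F \<rho>"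
      using supE supF True by (intro cell_bd_cong) (auto simp: supported_system_def)
    also have "\<dots> = 0" unfolding cell_bd_uminus
      using cb(2,4,6) by (simp add: cell_bd_cell_bd)
    finally show ?thesis by simp
  next
    case False
    then show ?thesis by (rule bd_outside[OF R sub])
  qed
  have rkU: "k < rk U"
  proof -
    have "{H \<in> F. H \<subset> U} = F - {U}" unfolding U_def by auto
    moreover have "E \<inter> U = E" using E by (auto simp: U_def)
    ultimately have "card E + card (F - {U}) < rk U"
      using cell U unfolding cell_def by (metis (no_types, lifting))
    then show ?thesis using cell_dim_face(2)[OF cell U] by (simp add: k_def)
  qed
  have "rank_of M (U - (\<sigma> \<union> E)) = rk U"
  proof -
    have "U - (\<sigma> \<union> E) \<subseteq> vertex_set M" using cb(7)[OF U] vertex_set_M by auto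
    from rank_span[OF this] have "rk U = rank_of M (U - (\<sigma> \<union> E))"
      using cell U by (simp add: cell_def)
    then show ?thesis by (rule sym)
  qed
  then obtain I where I: "I \<in> M" "I \<subseteq> U - (\<sigma> \<union> E)" "card I = rk U"
    using indep_extend[OF empty_indep, of "U - (\<sigma> \<union> E)"] by (metis empty_subsetI)
  have "\<exists>y. chain_on (induced M (U - \<sigma>)) (Suc k) y \<and> (\<forall>\<rho>. bd y \<rho> = R \<rho>)"
  proof (rule independence_system_bounding[OF _ sub _ _ R cyc])
    show "independence_system (induced M (U - \<sigma>))"
      by (intro independence_system_induced matroid_independence_system matroid)
    show "I \<in> induced M (U - \<sigma>)" "k < card I" using I rkU by (auto simp: induced_def)
  qed
  moreover have "Suc k = card E + card F"
    using F cb(4) by (simp add: k_def) (metis card_gt_0_iff Suc_pred add_gr_0)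
  ultimately show ?thesis by (auto simp: flag_solution_def U_def R_def)
qed

text \<open>Recursive choice along \<open>cell_dim\<close>: the condition on a cell refers to
  earlier values only at its faces, which have smaller \<open>cell_dim\<close>.\<close>

lemma flag_system_exists:
  obtains b :: "'a system" where
    "\<And>\<sigma> E F. cell \<sigma> E F \<Longrightarrow> supported_system b \<sigma> E F"
    "\<And>\<sigma> E \<rho>. b \<sigma> E {} \<rho> = (if E = {} \<and> \<rho> = {} then 1 else 0)"
proof -
  have "\<exists>c. \<forall>p. flag_solution c p (c p)"
  proof (rule dependent_wf_choice[of "Wellfounded.measure cell_dim"])
    fix c c' :: "'a set \<times> 'a set \<times> 'a set set \<Rightarrow> 'a set \<Rightarrow> int" and p r
    assume eq: "\<And>q. (q, p) \<in> Wellfounded.measure cell_dim \<Longrightarrow> c q = c' q"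
    obtain \<sigma> E F where p: "p = (\<sigma>, E, F)" by (cases p)
    have "cell_bd (flag_extension c) \<sigma> E F \<rho> = cell_bd (flag_extension c') \<sigma> E F \<rho>" if cell: "cell \<sigma> E F" for \<rho>
    proof (rule cell_bd_cong)
      fix x assume x: "x \<in> E"
      have "c (\<sigma>', E - {x}, F) = c' (\<sigma>', E - {x}, F)" for \<sigma>'
        by (rule eq) (simp add: p cell_dim_def flip: cell_dim_face(1)[OF cell x] del: card_Diff_insert)
      then show "flag_extension c \<sigma> (E - {x}) F \<rho> - flag_extension c (insert x \<sigma>) (E - {x}) F \<rho>
          = flag_extension c' \<sigma> (E - {x}) F \<rho> - flag_extension c' (insert x \<sigma>) (E - {x}) F \<rho>"
        by (simp add: flag_extension_def)
    next
      fix G assume G: "G \<in> F"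
      have "c (\<sigma>', E, F - {G}) = c' (\<sigma>', E, F - {G})" for \<sigma>'
        by (rule eq) (simp add: p cell_dim_def flip: cell_dim_face(2)[OF cell G])
      then show "flag_extension c \<sigma> E (F - {G}) \<rho> = flag_extension c' \<sigma> E (F - {G}) \<rho>"
        by (simp add: flag_extension_def)
    qed
    then show "flag_solution c p r = flag_solution c' p r"
      by (auto simp: p flag_solution_def)
  next
    fix p and c :: "'a set \<times> 'a set \<times> 'a set set \<Rightarrow> 'a set \<Rightarrow> int"
    assume "\<And>q. (q, p) \<in> Wellfounded.measure cell_dim \<Longrightarrow> flag_solution c q (c q)"
    then show "\<exists>r. flag_solution c p r"
      by (cases p) (auto intro!: flag_solution_step)
  qed simp
  then obtain c where c: "\<And>p. flag_solution c p (c p)" by blast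
  show ?thesis
  proof (rule that)
    show "supported_system (flag_extension c) \<sigma> E F" if "cell \<sigma> E F" for \<sigma> E F
      using that c by (intro flag_extension_supported[of "Suc (card E + card F)"]) auto
    show "flag_extension c \<sigma> E {} \<rho> = (if E = {} \<and> \<rho> = {} then 1 else 0)" for \<sigma> E \<rho>
      by (simp add: flag_extension_def)
  qed
qed

end

section \<open>The complementary flat\<close>

context ordered_matroid
begin

definition flat_off :: "'a set \<Rightarrow> 'a set" where
  "flat_off \<tau> = cl (V - \<tau>)"

text \<open>The largest complement of a flat inside \<open>\<tau>\<close>, equivalently the union of
  the cocircuits of \<open>M\<close> contained in \<open>\<tau>\<close>.\<close>

definition core :: "'a set \<Rightarrow> 'a set" where
  "core \<tau> = V - flat_off \<tau>"

lemma flat_off_subset: "flat_off \<tau> \<subseteq> V"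
  unfolding flat_off_def using span_subset vertex_set_M by auto

lemma compl_subset_flat_off: "V - \<tau> \<subseteq> flat_off \<tau>"
  unfolding flat_off_def using vertex_set_M by (intro span_extensive) auto

lemma flat_off_antimono: "\<tau> \<subseteq> \<tau>' \<Longrightarrow> flat_off \<tau>' \<subseteq> flat_off \<tau>"
  unfolding flat_off_def by (rule span_mono) auto

lemma core_subset: "core \<tau> \<subseteq> \<tau>"
  using compl_subset_flat_off by (auto simp: core_def)

lemma core_subset_V: "core \<tau> \<subseteq> V"
  by (auto simp: core_def)

lemma core_mono: "\<tau> \<subseteq> \<tau>' \<Longrightarrow> core \<tau> \<subseteq> core \<tau>'"
  using flat_off_antimono by (auto simp: core_def)

lemma cl_flat_off: "cl (flat_off \<tau>) = flat_off \<tau>"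
  unfolding flat_off_def using vertex_set_M by (intro span_span) auto

lemma flat_off_remove:
  assumes "y \<in> flat_off \<tau>"
  shows "flat_off (\<tau> - {y}) = flat_off \<tau>"
proof
  have "V - (\<tau> - {y}) \<subseteq> flat_off \<tau>" using assms compl_subset_flat_off by auto
  then have "cl (V - (\<tau> - {y})) \<subseteq> cl (flat_off \<tau>)" by (rule span_mono)
  then show "flat_off (\<tau> - {y}) \<subseteq> flat_off \<tau>" unfolding cl_flat_off by (simp add: flat_off_def)
  show "flat_off \<tau> \<subseteq> flat_off (\<tau> - {y})" by (rule flat_off_antimono) auto
qed

text \<open>Every member of the flag lies in \<open>flat_off (\<sigma> \<union> E)\<close>; openness
  says that this flat is still free to be appended as a new largest member.\<close>

definition open_cell :: "'a set \<Rightarrow> 'a set \<Rightarrow> 'a set set \<Rightarrow> bool" where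
  "open_cell \<sigma> E F \<longleftrightarrow> cell \<sigma> E F \<and> flat_off (\<sigma> \<union> E) \<notin> F"

lemma cell_flag_subset:
  assumes "cell \<sigma> E F" "G \<in> F"
  shows "G \<subseteq> flat_off (\<sigma> \<union> E)"
proof -
  have "cl (G - (\<sigma> \<union> E)) = G" "G \<subseteq> V" using assms by (auto simp: cell_def)
  moreover have "cl (G - (\<sigma> \<union> E)) \<subseteq> cl (V - (\<sigma> \<union> E))" using \<open>G \<subseteq> V\<close> by (intro span_mono) auto
  ultimately show ?thesis by (simp add: flat_off_def)
qed

text \<open>When \<open>x\<close> leaves the cell the complementary flat can only grow. A member of
  \<open>F\<close> equal to the grown flat would still lie in the old one, hence coincide with
  it.\<close>

lemma open_cell_face:
  assumes c: "open_cell \<sigma> E F"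
  shows "x \<in> E \<Longrightarrow> open_cell \<sigma> (E - {x}) F" "x \<in> E \<Longrightarrow> open_cell (insert x \<sigma>) (E - {x}) F"
    "G \<in> F \<Longrightarrow> open_cell \<sigma> E (F - {G})"
proof -
  have cell: "cell \<sigma> E F" and F: "flat_off (\<sigma> \<union> E) \<notin> F" using c by (auto simp: open_cell_def)
  show "open_cell \<sigma> (E - {x}) F" if x: "x \<in> E"
    unfolding open_cell_def
  proof
    show "cell \<sigma> (E - {x}) F" using cell x by (rule cell_face)
    show "flat_off (\<sigma> \<union> (E - {x})) \<notin> F"
    proof
      assume "flat_off (\<sigma> \<union> (E - {x})) \<in> F"
      moreover from this have "flat_off (\<sigma> \<union> (E - {x})) \<subseteq> flat_off (\<sigma> \<union> E)" by (rule cell_flag_subset[OF cell])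
      moreover have "flat_off (\<sigma> \<union> E) \<subseteq> flat_off (\<sigma> \<union> (E - {x}))" by (rule flat_off_antimono) auto
      ultimately show False using F by (metis subset_antisym)
    qed
  qed
  show "open_cell (insert x \<sigma>) (E - {x}) F" if x: "x \<in> E"
  proof -
    have "insert x \<sigma> \<union> (E - {x}) = \<sigma> \<union> E" using x by auto
    then show ?thesis using cell_face(2)[OF cell x] F by (simp add: open_cell_def)
  qed
  show "open_cell \<sigma> E (F - {G})" if "G \<in> F"
    using cell_face(3)[OF cell that] F by (simp add: open_cell_def)
qed

text \<open>This is the numerical condition of \<open>cell\<close> for the complementary flat as a
  new largest member, at position \<open>card F\<close>. Its negation is the dimension bound under
  which the link of the core fills.\<close>

definition low :: "'a set \<Rightarrow> 'a set \<Rightarrow> 'a set set \<Rightarrow> bool" where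
  "low \<sigma> E F \<longleftrightarrow> card (E \<inter> flat_off (\<sigma> \<union> E)) + card F < rk (flat_off (\<sigma> \<union> E))"

lemma cell_append:
  assumes c: "open_cell \<sigma> E F" and "low \<sigma> E F"
  shows "cell \<sigma> E (insert (flat_off (\<sigma> \<union> E)) F)"
proof -
  define \<Phi> where "\<Phi> = flat_off (\<sigma> \<union> E)"
  have cell: "cell \<sigma> E F" and F: "\<Phi> \<notin> F" using c by (auto simp: open_cell_def \<Phi>_def)
  have sub: "G \<subset> \<Phi>" if "G \<in> F" for G
    using cell_flag_subset[OF cell that] that F by (auto simp: \<Phi>_def)
  have "\<Phi> - (\<sigma> \<union> E) = V - (\<sigma> \<union> E)"
    using compl_subset_flat_off[of "\<sigma> \<union> E"] flat_off_subset[of "\<sigma> \<union> E"] by (auto simp: \<Phi>_def)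
  then have cl\<Phi>: "cl (\<Phi> - (\<sigma> \<union> E)) = \<Phi>" by (simp add: \<Phi>_def flat_off_def)
  have "{H \<in> insert \<Phi> F. H \<subset> \<Phi>} = F" using sub by auto
  then have lt\<Phi>: "card (E \<inter> \<Phi>) + card {H \<in> insert \<Phi> F. H \<subset> \<Phi>} < rk \<Phi>"
    using assms(2) by (simp add: low_def \<Phi>_def)
  have ltG: "card (E \<inter> G) + card {H \<in> insert \<Phi> F. H \<subset> G} < rk G" if "G \<in> F" for G
  proof -
    have "{H \<in> insert \<Phi> F. H \<subset> G} = {H \<in> F. H \<subset> G}" using sub[OF that] by auto
    then show ?thesis using cell that by (simp add: cell_def)
  qed
  have clG: "cl (G - (\<sigma> \<union> E)) = G" if "G \<in> F" for G using cell that by (simp add: cell_def)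
  have chain: "G \<subseteq> H \<or> H \<subseteq> G" if "G \<in> insert \<Phi> F" "H \<in> insert \<Phi> F" for G H
    using that sub cell_basics(6)[OF cell, of G H] by blast
  have "insert \<Phi> F \<subseteq> Pow V" using cell flat_off_subset by (auto simp: cell_def \<Phi>_def)
  then have "cell \<sigma> E (insert \<Phi> F)"
    unfolding cell_def
  proof (intro conjI ballI)
    fix G assume G: "G \<in> insert \<Phi> F"
    show "cl (G - (\<sigma> \<union> E)) = G"
      using G by (rule insertE) (simp_all only: cl\<Phi> clG)
    show "card (E \<inter> G) + card {H \<in> insert \<Phi> F. H \<subset> G} < rk G"
      using G by (rule insertE) (simp_all only: lt\<Phi> ltG)
    fix H assume "H \<in> insert \<Phi> F"
    with G show "G \<subseteq> H \<or> H \<subseteq> G" by (rule chain)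
  qed (rule cell_basics(1,2,5)[OF cell] | assumption)+
  then show ?thesis by (simp add: \<Phi>_def)
qed

text \<open>Removing \<open>x\<close> outside the flat makes the complementary flat strictly larger,
  since it now contains \<open>x\<close>. The appended flat is therefore not the new complementary
  one and the cell stays open.\<close>

lemma open_cell_append:
  assumes c: "open_cell \<sigma> E F" and "low \<sigma> E F" and x: "x \<in> E" "x \<notin> flat_off (\<sigma> \<union> E)" "\<sigma> \<subseteq> V"
  shows "open_cell \<sigma> (E - {x}) (insert (flat_off (\<sigma> \<union> E)) F)"
proof -
  have "cell \<sigma> (E - {x}) (insert (flat_off (\<sigma> \<union> E)) F)"
    by (rule cell_face(1)[OF cell_append[OF assms(1,2)] x(1)])
  moreover have "flat_off (\<sigma> \<union> (E - {x})) \<notin> F"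
    using open_cell_face(1)[OF c x(1)] by (simp add: open_cell_def)
  moreover have "x \<in> flat_off (\<sigma> \<union> (E - {x}))"
  proof -
    have "x \<in> V - (\<sigma> \<union> (E - {x}))" using c x by (auto simp: open_cell_def cell_def)
    then show ?thesis by (rule subsetD[OF compl_subset_flat_off])
  qed
  then have "flat_off (\<sigma> \<union> (E - {x})) \<noteq> flat_off (\<sigma> \<union> E)" using x(2) by auto
  ultimately show ?thesis by (simp add: open_cell_def)
qed

end

section \<open>Extending the system over the complex\<close>

text \<open>\<open>flat_bounding\<close> is the negation of the key fact in terms of fillings: in
  the link of \<open>V - G\<close>, cycles with at least \<open>rk G\<close> vertices per face
  bound. The clause \<open>1 \<le> rk G\<close> gives the natural-number subtraction its proper
  meaning.\<close>

locale leray_above_matroid = ordered_matroid V pos M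
  for V :: "'a set" and pos :: "'a \<Rightarrow> nat" and M :: "'a set set" +
  fixes X :: "'a set set" and b :: "'a system"
  assumes down_closed_X: "down_closed X" and X_subset: "X \<subseteq> Pow V" and M_X: "M \<subseteq> X"
    and flat_bounding: "\<And>G. cl G = G \<Longrightarrow> G \<subseteq> V \<Longrightarrow> V - G \<in> X \<Longrightarrow>
      1 \<le> rk G \<and> bounding_from (rk G - 1) (link X (V - G))"
    and b_supported: "\<And>\<sigma> E F. cell \<sigma> E F \<Longrightarrow> supported_system b \<sigma> E F"
    and b_empty: "\<And>\<sigma> E \<rho>. b \<sigma> E {} \<rho> = (if E = {} \<and> \<rho> = {} then 1 else 0)"
begin

type_synonym 'b family = "'b set \<times> 'b set \<times> 'b set set \<Rightarrow> 'b set \<Rightarrow> int"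

abbreviation sys :: "'a family \<Rightarrow> 'a system" where
  "sys c \<sigma> E F \<equiv> c (\<sigma>, E, F)"

text \<open>
  In low dimensions the chain of a cell is read off from cells whose flag is prolonged by the
  complementary flat: there the boundary formula contains the required filling as the term that
  drops the new flat.
\<close>

definition appended :: "'a family \<Rightarrow> 'a system" where
  "appended c \<sigma> E F \<rho> = (if core (\<sigma> \<union> E) = {} then b \<sigma> E (insert (flat_off (\<sigma> \<union> E)) F) \<rho>
     else \<Sum>x\<in>core (\<sigma> \<union> E). es x E * c (\<sigma>, E - {x}, insert (flat_off (\<sigma> \<union> E)) F) \<rho>)"

text \<open>Boundaries are tested only at faces containing the core, that is, in its link. The last
  clause prescribes the chain on low cells instead of leaving a choice, since the filling of a low
  cell uses the same formula on its faces. Its sign is that of dropping the appended flat,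
  \<open>(-1) ^ card E\<close> from the cube times \<open>(-1) ^ card F\<close> from the
  flag.\<close>

definition fill_solution :: "'a family \<Rightarrow> 'a set \<times> 'a set \<times> 'a set set \<Rightarrow> ('a set \<Rightarrow> int) \<Rightarrow> bool" where
  "fill_solution c = (\<lambda>(\<sigma>, E, F) r. open_cell \<sigma> E F \<longrightarrow>
     (\<forall>\<rho>. r \<rho> \<noteq> 0 \<longrightarrow> \<rho> \<in> X \<and> \<rho> \<inter> \<sigma> = {} \<and> core (\<sigma> \<union> E) \<subseteq> \<rho> \<and> card \<rho> = Suc (card E + card F))
     \<and> (\<forall>\<rho>\<subseteq>V. core (\<sigma> \<union> E) \<subseteq> \<rho> \<longrightarrow> bd r \<rho> = cell_bd (sys c) \<sigma> E F \<rho> + b \<sigma> E F \<rho>)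
     \<and> (low \<sigma> E F \<and> \<sigma> \<inter> core (\<sigma> \<union> E) = {} \<longrightarrow>
          (\<forall>\<rho>. core (\<sigma> \<union> E) \<subseteq> \<rho> \<longrightarrow> r \<rho> = - ((-1) ^ (card E + card F) * appended c \<sigma> E F \<rho>))))"

text \<open>Prolonging the flag while deleting some \<open>x\<close> from \<open>E\<close> keeps
  \<open>card E + card F\<close> unchanged, so the size of \<open>\<sigma> \<union> E\<close> is
  compared first. The second component serves the upper facets and the shorter flags, which leave
  \<open>\<sigma> \<union> E\<close> unchanged.\<close>

definition cell_order :: "(('a set \<times> 'a set \<times> 'a set set) \<times> ('a set \<times> 'a set \<times> 'a set set)) set" where
  "cell_order = inv_image (less_than <*lex*> less_than) (\<lambda>(\<sigma>, E, F). (card (\<sigma> \<union> E), card E + card F))"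

lemma wf_cell_order: "wf cell_order"
  unfolding cell_order_def by (intro wf_inv_image wf_lex_prod wf_less_than)

lemma cell_order_face:
  assumes "cell \<sigma> E F"
  shows "x \<in> E \<Longrightarrow> ((\<sigma>, E - {x}, F'), (\<sigma>, E, F)) \<in> cell_order"
    "x \<in> E \<Longrightarrow> ((insert x \<sigma>, E - {x}, F), (\<sigma>, E, F)) \<in> cell_order"
    "G \<in> F \<Longrightarrow> ((\<sigma>, E, F - {G}), (\<sigma>, E, F)) \<in> cell_order"
proof -
  note cb = cell_basics[OF assms]
  have "finite (\<sigma> \<union> E)" using cb(1,2) by (intro finite_sub) auto
  moreover have "\<sigma> \<union> (E - {x}) \<subset> \<sigma> \<union> E" if "x \<in> E" for x using cb(5) that by auto
  ultimately have "card (\<sigma> \<union> (E - {x})) < card (\<sigma> \<union> E)" if "x \<in> E" for x using that by (intro psubset_card_mono)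
  then show "x \<in> E \<Longrightarrow> ((\<sigma>, E - {x}, F'), (\<sigma>, E, F)) \<in> cell_order"
    by (simp add: cell_order_def)
  show "((insert x \<sigma>, E - {x}, F), (\<sigma>, E, F)) \<in> cell_order" if x: "x \<in> E"
  proof -
    have "insert x \<sigma> \<union> (E - {x}) = \<sigma> \<union> E" using x by auto
    moreover have "card (E - {x}) + card F < card E + card F" using cell_dim_face(1)[OF assms x] by linarith
    ultimately show ?thesis by (simp add: cell_order_def)
  qed
  show "((\<sigma>, E, F - {G}), (\<sigma>, E, F)) \<in> cell_order" if G: "G \<in> F"
  proof -
    have "card E + card (F - {G}) < card E + card F" using cell_dim_face(2)[OF assms G] by linarith
    then show ?thesis by (simp add: cell_order_def)
  qed
qed

lemma b_nonzero:
  assumes "cell \<sigma> E F" "b \<sigma> E F \<rho> \<noteq> 0"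
  shows "\<rho> \<in> M" "\<rho> \<subseteq> \<Union>F" "\<rho> \<inter> \<sigma> = {}" "card \<rho> = card E + card F"
proof -
  have "chain_on (induced M (\<Union>F - \<sigma>)) (card E + card F) (b \<sigma> E F)"
    using b_supported[OF assms(1)] by (simp add: supported_system_def)
  from chain_onD[OF this assms(2)] show "\<rho> \<in> M" "\<rho> \<subseteq> \<Union>F" "\<rho> \<inter> \<sigma> = {}" "card \<rho> = card E + card F"
    by (auto simp: induced_def)
qed

lemma bd_b: "cell \<sigma> E F \<Longrightarrow> \<rho> \<subseteq> V \<Longrightarrow> bd (b \<sigma> E F) \<rho> = - cell_bd b \<sigma> E F \<rho>"
  using b_supported by (simp add: supported_system_def)

text \<open>Faces of \<open>b\<close> lie in \<open>\<Union>F\<close>, hence in the complementary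
  flat, which is disjoint from the core.\<close>

lemma b_eq_0_of_core:
  assumes "cell \<sigma> E F" "core (\<sigma> \<union> E) \<noteq> {}" "core (\<sigma> \<union> E) \<subseteq> \<rho>"
  shows "b \<sigma> E F \<rho> = 0"
proof (rule ccontr)
  assume nz: "b \<sigma> E F \<rho> \<noteq> 0"
  obtain x where x: "x \<in> core (\<sigma> \<union> E)" using assms(2) by blast
  then have "x \<in> \<Union>F" using assms(3) b_nonzero(2)[OF assms(1) nz] by auto
  then have "x \<in> flat_off (\<sigma> \<union> E)" using cell_flag_subset[OF assms(1)] by auto
  then show False using x by (simp add: core_def)
qed

end

section \<open>One step of the recursion, for a fixed open cell\<close>

locale fill_step = leray_above_matroid V pos M X b
  for V :: "'a set" and pos M X b +
  fixes c :: "'a family" and \<sigma> E :: "'a set" and F :: "'a set set"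
  assumes solved: "\<And>q. (q, (\<sigma>, E, F)) \<in> cell_order \<Longrightarrow> fill_solution c q (c q)"
    and open_cell: "open_cell \<sigma> E F"
begin

abbreviation "\<Phi> \<equiv> flat_off (\<sigma> \<union> E)"
abbreviation "D \<equiv> core (\<sigma> \<union> E)"

lemma cell: "cell \<sigma> E F"
  using open_cell by (simp add: open_cell_def)

lemmas basics = cell_basics[OF cell]

lemma Un_faces: "x \<in> E \<Longrightarrow> insert x \<sigma> \<union> (E - {x}) = \<sigma> \<union> E"
  by auto

lemma core_face: "core (\<sigma> \<union> (E - {x})) \<subseteq> D"
  by (rule core_mono) auto

lemma value_nonzero:
  assumes "open_cell \<sigma>' E' F'" "((\<sigma>', E', F'), (\<sigma>, E, F)) \<in> cell_order" "c (\<sigma>', E', F') \<rho> \<noteq> 0"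
  shows "\<rho> \<in> X" "\<rho> \<inter> \<sigma>' = {}" "core (\<sigma>' \<union> E') \<subseteq> \<rho>" "card \<rho> = Suc (card E' + card F')"
  using solved[OF assms(2)] assms(1,3) by (auto simp: fill_solution_def)

lemma value_bd:
  assumes "open_cell \<sigma>' E' F'" "((\<sigma>', E', F'), (\<sigma>, E, F)) \<in> cell_order" "\<rho> \<subseteq> V" "core (\<sigma>' \<union> E') \<subseteq> \<rho>"
  shows "bd (c (\<sigma>', E', F')) \<rho> = cell_bd (sys c) \<sigma>' E' F' \<rho> + b \<sigma>' E' F' \<rho>"
  using solved[OF assms(2)] assms(1,3,4) by (auto simp: fill_solution_def)

lemma value_low:
  assumes "open_cell \<sigma>' E' F'" "((\<sigma>', E', F'), (\<sigma>, E, F)) \<in> cell_order"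
    "low \<sigma>' E' F'" "\<sigma>' \<inter> core (\<sigma>' \<union> E') = {}" "core (\<sigma>' \<union> E') \<subseteq> \<rho>"
  shows "c (\<sigma>', E', F') \<rho> = - ((-1) ^ (card E' + card F') * appended c \<sigma>' E' F' \<rho>)"
  using solved[OF assms(2)] assms(1,3-5) by (auto simp: fill_solution_def)

lemmas faces = open_cell_face[OF open_cell]
lemmas orders = cell_order_face[OF cell]

lemma face_nonzero:
  shows "x \<in> E \<Longrightarrow> c (\<sigma>, E - {x}, F) \<rho> \<noteq> 0 \<Longrightarrow> \<rho> \<in> X \<and> \<rho> \<inter> \<sigma> = {} \<and> card \<rho> = card E + card F"
    "x \<in> E \<Longrightarrow> c (insert x \<sigma>, E - {x}, F) \<rho> \<noteq> 0 \<Longrightarrow> \<rho> \<in> X \<and> \<rho> \<inter> insert x \<sigma> = {} \<and> card \<rho> = card E + card F"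
    "G \<in> F \<Longrightarrow> c (\<sigma>, E, F - {G}) \<rho> \<noteq> 0 \<Longrightarrow> \<rho> \<in> X \<and> \<rho> \<inter> \<sigma> = {} \<and> card \<rho> = card E + card F"
proof -
  show "\<rho> \<in> X \<and> \<rho> \<inter> \<sigma> = {} \<and> card \<rho> = card E + card F" if "x \<in> E" "c (\<sigma>, E - {x}, F) \<rho> \<noteq> 0"
    using value_nonzero[OF faces(1)[OF that(1)] orders(1)[OF that(1)] that(2)] cell_dim_face(1)[OF cell that(1)]
    by simp
  show "\<rho> \<in> X \<and> \<rho> \<inter> insert x \<sigma> = {} \<and> card \<rho> = card E + card F" if "x \<in> E" "c (insert x \<sigma>, E - {x}, F) \<rho> \<noteq> 0"
    using value_nonzero[OF faces(2)[OF that(1)] orders(2)[OF that(1)] that(2)] cell_dim_face(1)[OF cell that(1)]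
    by simp
  show "\<rho> \<in> X \<and> \<rho> \<inter> \<sigma> = {} \<and> card \<rho> = card E + card F" if "G \<in> F" "c (\<sigma>, E, F - {G}) \<rho> \<noteq> 0"
    using value_nonzero[OF faces(3)[OF that(1)] orders(3)[OF that(1)] that(2)] cell_dim_face(2)[OF cell that(1)]
    by simp
qed

lemma target_nonzero:
  assumes "cell_bd (sys c) \<sigma> E F \<rho> + b \<sigma> E F \<rho> \<noteq> 0"
  shows "\<rho> \<in> X \<and> \<rho> \<inter> \<sigma> = {} \<and> card \<rho> = card E + card F"
proof (cases "b \<sigma> E F \<rho> = 0")
  case True
  then have "cell_bd (sys c) \<sigma> E F \<rho> \<noteq> 0" using assms by simp
  then consider x where "x \<in> E" "c (\<sigma>, E - {x}, F) \<rho> \<noteq> 0"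
    | x where "x \<in> E" "c (insert x \<sigma>, E - {x}, F) \<rho> \<noteq> 0"
    | G where "G \<in> F" "c (\<sigma>, E, F - {G}) \<rho> \<noteq> 0"
    using cell_bd_nonzero by blast
  then show ?thesis
  proof cases
    case 1
    then show ?thesis by (rule face_nonzero(1))
  next
    case 2
    from face_nonzero(2)[OF this] show ?thesis by simp
  next
    case 3
    then show ?thesis by (rule face_nonzero(3))
  qed
next
  case False
  then show ?thesis using b_nonzero[OF cell False] M_X by auto
qed

text \<open>The equations of the faces of the cell hold at \<open>\<rho>\<close> because their cores
  are contained in \<open>D\<close>. Inserting them leaves \<open>cell_bd b\<close> after the
  iterated cell boundary vanishes, and the boundary of \<open>b\<close> cancels it.\<close>

lemma target_cycle:
  assumes "\<rho> \<subseteq> V" "D \<subseteq> \<rho>"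
  shows "bd (\<lambda>\<rho>. cell_bd (sys c) \<sigma> E F \<rho> + b \<sigma> E F \<rho>) \<rho> = 0"
proof -
  have "bd (cell_bd (sys c) \<sigma> E F) \<rho> = cell_bd (\<lambda>\<sigma> E F. bd (sys c \<sigma> E F)) \<sigma> E F \<rho>"
    by (rule bd_cell_bd)
  also have "\<dots> = cell_bd (\<lambda>\<sigma> E F \<rho>. cell_bd (sys c) \<sigma> E F \<rho> + b \<sigma> E F \<rho>) \<sigma> E F \<rho>"
  proof (rule cell_bd_cong)
    fix x assume x: "x \<in> E"
    have "bd (c (\<sigma>, E - {x}, F)) \<rho> = cell_bd (sys c) \<sigma> (E - {x}) F \<rho> + b \<sigma> (E - {x}) F \<rho>"
      using core_face assms by (intro value_bd faces(1) orders(1) x) auto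
    moreover have "bd (c (insert x \<sigma>, E - {x}, F)) \<rho> = cell_bd (sys c) (insert x \<sigma>) (E - {x}) F \<rho> + b (insert x \<sigma>) (E - {x}) F \<rho>"
      using assms Un_faces[OF x] by (intro value_bd faces(2) orders(2) x) auto
    ultimately show "bd (c (\<sigma>, E - {x}, F)) \<rho> - bd (c (insert x \<sigma>, E - {x}, F)) \<rho>
      = cell_bd (sys c) \<sigma> (E - {x}) F \<rho> + b \<sigma> (E - {x}) F \<rho>
        - (cell_bd (sys c) (insert x \<sigma>) (E - {x}) F \<rho> + b (insert x \<sigma>) (E - {x}) F \<rho>)"
      by simp
  next
    fix G assume G: "G \<in> F"
    show "bd (c (\<sigma>, E, F - {G})) \<rho> = cell_bd (sys c) \<sigma> E (F - {G}) \<rho> + b \<sigma> E (F - {G}) \<rho>"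
      using assms by (intro value_bd faces(3) orders(3) G)
  qed
  also have "\<dots> = cell_bd b \<sigma> E F \<rho>"
    unfolding cell_bd_add using basics(2,4,6) by (simp add: cell_bd_cell_bd)
  finally show ?thesis using bd_b[OF cell assms(1)] by (simp add: bd_add)
qed

text \<open>A face cannot both contain \<open>D\<close> and avoid \<open>\<sigma>\<close>, so the
  target vanishes wherever it is tested.\<close>

lemma solution_blocked:
  assumes "\<sigma> \<inter> D \<noteq> {}"
  shows "fill_solution c (\<sigma>, E, F) (\<lambda>\<rho>. 0)"
proof -
  have "cell_bd (sys c) \<sigma> E F \<rho> + b \<sigma> E F \<rho> = 0" if "D \<subseteq> \<rho>" for \<rho>
    using target_nonzero[of \<rho>] that assms by auto
  then show ?thesis using assms by (simp add: fill_solution_def bd_eq_0)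
qed

text \<open>If \<open>D\<close> is not in \<open>X\<close>, no face contains it and 0 works.
  Otherwise \<open>D\<close> lies in \<open>E\<close>, and the target has
  \<open>card (E - D) + card F\<close> vertices outside \<open>D\<close>. Not being low, this is at
  least \<open>rk \<Phi>\<close>, so the link of \<open>D\<close> provides the filling.\<close>

lemma solution_high:
  assumes free: "\<sigma> \<inter> D = {}" and high: "\<not> low \<sigma> E F"
  shows "\<exists>r. fill_solution c (\<sigma>, E, F) r"
proof -
  define T where "T \<rho> = cell_bd (sys c) \<sigma> E F \<rho> + b \<sigma> E F \<rho>" for \<rho>
  show ?thesis
  proof (cases "D \<in> X")
    case False
    have "T \<rho> = 0" if "D \<subseteq> \<rho>" for \<rho>
      using target_nonzero[of \<rho>] False down_closedD[OF down_closed_X _ that] by (auto simp: T_def)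
    then have "fill_solution c (\<sigma>, E, F) (\<lambda>\<rho>. 0)"
      using high by (simp add: fill_solution_def bd_eq_0 T_def)
    then show ?thesis by blast
  next
    case True
    have DE: "D \<subseteq> E" using core_subset[of "\<sigma> \<union> E"] free by auto
    have VD: "V - \<Phi> = D" by (simp add: core_def)
    have hyp: "1 \<le> rk \<Phi>" "bounding_from (rk \<Phi> - 1) (link X D)"
      using flat_bounding[OF cl_flat_off flat_off_subset, of "\<sigma> \<union> E"] True VD by auto
    have EPhi: "E \<inter> \<Phi> = E - D" using basics(2) by (auto simp: core_def)
    define k where "k = card (E - D) + card F"
    have cardE: "card E = card D + card (E - D)"
      using DE basics(3) by (metis card_Diff_subset card_mono finite_subset le_add_diff_inverse)
    have k: "rk \<Phi> - 1 < k" using high hyp(1) by (simp add: low_def k_def EPhi)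
    define R where "R \<rho> = (if D \<subseteq> \<rho> then T \<rho> else 0)" for \<rho>
    have "\<exists>r. (\<forall>\<rho>. r \<rho> \<noteq> 0 \<longrightarrow> \<rho> \<in> X \<and> D \<subseteq> \<rho> \<and> \<rho> \<subseteq> D \<union> (V - D - \<sigma>) \<and> card \<rho> = Suc (card D + k))
      \<and> (\<forall>\<rho>\<subseteq>V. D \<subseteq> \<rho> \<longrightarrow> bd r \<rho> = R \<rho>)"
    proof (rule bounding_from_relative[OF down_closed_X X_subset core_subset_V _ hyp(2) k])
      \<comment> \<open>Filling over these vertices keeps the new chain disjoint from
        \<open>\<sigma>\<close>.\<close>
      show "V - D - \<sigma> \<subseteq> V - D" by auto
      show "\<rho> \<in> X \<and> D \<subseteq> \<rho> \<and> \<rho> \<subseteq> D \<union> (V - D - \<sigma>) \<and> card \<rho> = card D + k" if "R \<rho> \<noteq> 0" for \<rho>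
      proof -
        have \<rho>: "D \<subseteq> \<rho>" "T \<rho> \<noteq> 0" using that by (auto simp: R_def split: if_splits)
        note t = target_nonzero[of \<rho>, folded T_def, OF \<rho>(2)]
        then have "\<rho> \<subseteq> V" using X_subset by auto
        then show ?thesis using t \<rho>(1) cardE by (auto simp: k_def)
      qed
      show "bd R \<rho> = 0" if "\<rho> \<subseteq> V" "D \<subseteq> \<rho>" for \<rho>
      proof -
        have "bd R \<rho> = bd T \<rho>" using that by (intro bd_cong) (auto simp: R_def)
        then show ?thesis using target_cycle[OF that] by (simp add: T_def[abs_def])
      qed
    qed
    then obtain r where r: "\<And>\<rho>. r \<rho> \<noteq> 0 \<Longrightarrow> \<rho> \<in> X \<and> D \<subseteq> \<rho> \<and> \<rho> \<subseteq> D \<union> (V - D - \<sigma>) \<and> card \<rho> = Suc (card D + k)"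
      "\<And>\<rho>. \<rho> \<subseteq> V \<Longrightarrow> D \<subseteq> \<rho> \<Longrightarrow> bd r \<rho> = R \<rho>" by auto
    have "fill_solution c (\<sigma>, E, F) r"
      unfolding fill_solution_def prod.case
    proof (intro impI conjI allI)
      fix \<rho> assume nz: "r \<rho> \<noteq> 0"
      note rr = r(1)[OF nz]
      show "\<rho> \<in> X" "D \<subseteq> \<rho>" using rr by auto
      show "\<rho> \<inter> \<sigma> = {}" using rr free by auto
      show "card \<rho> = Suc (card E + card F)" using rr cardE by (simp add: k_def)
    next
      fix \<rho> assume "\<rho> \<subseteq> V" "D \<subseteq> \<rho>"
      then show "bd r \<rho> = cell_bd (sys c) \<sigma> E F \<rho> + b \<sigma> E F \<rho>"
        using r(2)[of \<rho>] by (simp add: R_def T_def)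
    qed (use high in simp)
    then show ?thesis by blast
  qed
qed

end

section \<open>Low cells: fillings obtained by prolonging the flag\<close>

context fill_step
begin

abbreviation "sgn_n \<equiv> (-1 :: int) ^ (card E + card F)"
abbreviation "F' \<equiv> insert \<Phi> F"

lemma Phi_notin: "\<Phi> \<notin> F"
  using open_cell by (simp add: open_cell_def)

lemma flag_psubset: "G \<in> F \<Longrightarrow> G \<subset> \<Phi>"
  using cell_flag_subset[OF cell, of G] Phi_notin by auto

text \<open>As the largest member, \<open>\<Phi>\<close> has sign \<open>(-1) ^ card F\<close> and
  does not affect the signs of the others.\<close>

lemma flag_bd_append:
  "flag_bd f \<sigma>' E' F' \<rho> = (\<Sum>G\<in>F. fs G F * f \<sigma>' E' (insert \<Phi> (F - {G})) \<rho>) + (-1) ^ card F * f \<sigma>' E' F \<rho>"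
proof -
  have "{H \<in> F. H \<subset> \<Phi>} = F" using flag_psubset by auto
  then have "fs \<Phi> F' = (-1) ^ card F"
    by (subst esign_insert_self) (simp_all add: esign_def)
  moreover have "F' - {\<Phi>} = F" using Phi_notin by auto
  moreover have "fs G F' * f \<sigma>' E' (F' - {G}) \<rho> = fs G F * f \<sigma>' E' (insert \<Phi> (F - {G})) \<rho>" if "G \<in> F" for G
  proof -
    have "F' - {G} = insert \<Phi> (F - {G})" using that Phi_notin by auto
    moreover have "fs G F' = fs G F"
      using flag_psubset[OF that] basics(4) Phi_notin by (subst esign_insert) auto
    ultimately show ?thesis by simp
  qed
  ultimately show ?thesis
    unfolding flag_bd_def using basics(4) Phi_notin by simp
qed

lemma sign_face: "x \<in> E \<Longrightarrow> (-1 :: int) ^ (card (E - {x}) + card F) = - sgn_n"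
  "G \<in> F \<Longrightarrow> (-1 :: int) ^ (card E + card (F - {G})) = - sgn_n"
  by (simp_all only: cell_dim_face[OF cell, symmetric] power_Suc)

context
  assumes low: "low \<sigma> E F" and free: "\<sigma> \<inter> D = {}"
begin

lemma D_subset_E: "D \<subseteq> E"
  using core_subset[of "\<sigma> \<union> E"] free by auto

lemma flat_off_face: "y \<in> E \<Longrightarrow> y \<in> \<Phi> \<Longrightarrow> flat_off (\<sigma> \<union> (E - {y})) = \<Phi>"
proof -
  assume "y \<in> E" "y \<in> \<Phi>"
  moreover from this have "\<sigma> \<union> (E - {y}) = \<sigma> \<union> E - {y}" using basics(5) by auto
  ultimately show ?thesis by (simp add: flat_off_remove)
qed

lemma core_face_eq: "y \<in> E \<Longrightarrow> y \<in> \<Phi> \<Longrightarrow> core (\<sigma> \<union> (E - {y})) = D"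
  by (simp add: core_def flat_off_face)

lemma card_face_le: "card ((E - {y}) \<inter> \<Phi>) \<le> card (E \<inter> \<Phi>)"
  using basics(3) by (intro card_mono) auto

lemma low_faces:
  shows "y \<in> E \<Longrightarrow> y \<in> \<Phi> \<Longrightarrow> low \<sigma> (E - {y}) F"
    "y \<in> E \<Longrightarrow> y \<in> \<Phi> \<Longrightarrow> low (insert y \<sigma>) (E - {y}) F"
    "G \<in> F \<Longrightarrow> low \<sigma> E (F - {G})"
proof -
  show "low \<sigma> (E - {y}) F" if "y \<in> E" "y \<in> \<Phi>"
    using low card_face_le[of y] flat_off_face[OF that] by (simp add: low_def)
  show "low (insert y \<sigma>) (E - {y}) F" if "y \<in> E" "y \<in> \<Phi>"
    using low card_face_le[of y] Un_faces[OF that(1)] by (simp add: low_def)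
  show "low \<sigma> E (F - {G})" if "G \<in> F"
    using low cell_dim_face(2)[OF cell that] by (simp add: low_def)
qed

text \<open>These faces are again low, with the same \<open>\<Phi>\<close> and \<open>D\<close>, so
  the prescribed formula applies to them. Having one dimension less turns its minus sign into
  plus.\<close>

lemma face_values:
  assumes "D \<subseteq> \<rho>"
  shows "y \<in> E \<Longrightarrow> y \<in> \<Phi> \<Longrightarrow> c (\<sigma>, E - {y}, F) \<rho> = sgn_n * appended c \<sigma> (E - {y}) F \<rho>"
    "y \<in> E \<Longrightarrow> y \<in> \<Phi> \<Longrightarrow> c (insert y \<sigma>, E - {y}, F) \<rho> = sgn_n * appended c (insert y \<sigma>) (E - {y}) F \<rho>"
    "G \<in> F \<Longrightarrow> c (\<sigma>, E, F - {G}) \<rho> = sgn_n * appended c \<sigma> E (F - {G}) \<rho>"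
proof -
  show "c (\<sigma>, E - {y}, F) \<rho> = sgn_n * appended c \<sigma> (E - {y}) F \<rho>" if y: "y \<in> E" "y \<in> \<Phi>"
    using value_low[OF faces(1)[OF y(1)] orders(1)[OF y(1)] low_faces(1)[OF y], of \<rho>]
      core_face_eq[OF y] free assms sign_face(1)[OF y(1)] by simp
  show "c (insert y \<sigma>, E - {y}, F) \<rho> = sgn_n * appended c (insert y \<sigma>) (E - {y}) F \<rho>" if y: "y \<in> E" "y \<in> \<Phi>"
  proof -
    have "y \<notin> D" using y(2) by (simp add: core_def)
    then show ?thesis
      using value_low[OF faces(2)[OF y(1)] orders(2)[OF y(1)] low_faces(2)[OF y], of \<rho>]
        Un_faces[OF y(1)] free assms sign_face(1)[OF y(1)] by simp
  qed
  show "c (\<sigma>, E, F - {G}) \<rho> = sgn_n * appended c \<sigma> E (F - {G}) \<rho>" if G: "G \<in> F"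
    using value_low[OF faces(3)[OF G] orders(3)[OF G] low_faces(3)[OF G], of \<rho>]
      free assms sign_face(2)[OF G] by simp
qed

text \<open>Here \<open>\<Phi> = V\<close> and the prescribed chain comes from \<open>b\<close> on
  the prolonged flag. In its boundary the term dropping \<open>\<Phi>\<close> is
  \<open>b \<sigma> E F\<close>; all other terms are the prescribed chains of the faces.\<close>

lemma solution_low_spanning:
  assumes D: "D = {}"
  shows "fill_solution c (\<sigma>, E, F) (\<lambda>\<rho>. - (sgn_n * b \<sigma> E F' \<rho>))"
proof -
  have Phi: "\<Phi> = V" using D flat_off_subset by (auto simp: core_def)
  have EPhi: "x \<in> \<Phi>" if "x \<in> E" for x using that basics(2) Phi by auto
  have cell': "cell \<sigma> E F'" by (rule cell_append[OF open_cell low])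
  have app: "appended c \<sigma> (E - {x}) F \<rho> = b \<sigma> (E - {x}) F' \<rho>"
    "appended c (insert x \<sigma>) (E - {x}) F \<rho> = b (insert x \<sigma>) (E - {x}) F' \<rho>" if "x \<in> E" for x \<rho>
    using D core_face_eq[OF that EPhi[OF that]] flat_off_face[OF that EPhi[OF that]] Un_faces[OF that]
    by (simp_all add: appended_def)
  have appF: "appended c \<sigma> E (F - {G}) \<rho> = b \<sigma> E (insert \<Phi> (F - {G})) \<rho>" for G \<rho>
    using D by (simp add: appended_def)
  show ?thesis
    unfolding fill_solution_def prod.case
  proof (intro impI conjI allI)
    fix \<rho> assume "- (sgn_n * b \<sigma> E F' \<rho>) \<noteq> 0"
    then have "b \<sigma> E F' \<rho> \<noteq> 0" by simp
    note nz = b_nonzero[OF cell' this]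
    show "\<rho> \<in> X" "\<rho> \<inter> \<sigma> = {}" "D \<subseteq> \<rho>" using nz M_X D by auto
    show "card \<rho> = Suc (card E + card F)" using nz(4) basics(4) Phi_notin by simp
  next
    fix \<rho> assume \<rho>: "\<rho> \<subseteq> V" "D \<subseteq> \<rho>"
    have "bd (\<lambda>\<rho>. - (sgn_n * b \<sigma> E F' \<rho>)) \<rho> = sgn_n * cell_bd b \<sigma> E F' \<rho>"
      using bd_b[OF cell' \<rho>(1)] by (simp add: bd_uminus bd_scale)
    also have "\<dots> = sgn_n * cube_bd b \<sigma> E F' \<rho>
        + sgn_n * (-1) ^ card E * (\<Sum>G\<in>F. fs G F * b \<sigma> E (insert \<Phi> (F - {G})) \<rho>)
        + sgn_n * sgn_n * b \<sigma> E F \<rho>"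
      by (simp add: cell_bd_def flag_bd_append algebra_simps power_add)
    also have "sgn_n * sgn_n = 1" by (simp flip: power_mult_distrib)
    also have "sgn_n * cube_bd b \<sigma> E F' \<rho> = cube_bd (sys c) \<sigma> E F \<rho>"
      unfolding cube_bd_def sum_distrib_left
    proof (rule sum.cong[OF refl])
      fix x assume x: "x \<in> E"
      show "sgn_n * (es x E * (b \<sigma> (E - {x}) F' \<rho> - b (insert x \<sigma>) (E - {x}) F' \<rho>))
        = es x E * (c (\<sigma>, E - {x}, F) \<rho> - c (insert x \<sigma>, E - {x}, F) \<rho>)"
        using face_values(1,2)[OF \<rho>(2) x EPhi[OF x]] by (simp add: app[OF x] algebra_simps)
    qed
    also have "sgn_n * (-1) ^ card E * (\<Sum>G\<in>F. fs G F * b \<sigma> E (insert \<Phi> (F - {G})) \<rho>)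
        = (-1) ^ card E * flag_bd (sys c) \<sigma> E F \<rho>"
    proof -
      have "flag_bd (sys c) \<sigma> E F \<rho> = (\<Sum>G\<in>F. sgn_n * (fs G F * b \<sigma> E (insert \<Phi> (F - {G})) \<rho>))"
        unfolding flag_bd_def using face_values(3)[OF \<rho>(2)]
        by (intro sum.cong refl) (simp add: appF algebra_simps)
      then show ?thesis by (simp add: sum_distrib_left mult.left_commute mult.assoc)
    qed
    finally show "bd (\<lambda>\<rho>. - (sgn_n * b \<sigma> E F' \<rho>)) \<rho> = cell_bd (sys c) \<sigma> E F \<rho> + b \<sigma> E F \<rho>"
      by (simp add: cell_bd_def)
  next
    fix \<rho> show "- (sgn_n * b \<sigma> E F' \<rho>) = - (sgn_n * appended c \<sigma> E F \<rho>)"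
      using D by (simp add: appended_def)
  qed
qed

text \<open>Inserting the boundary equations of the prolonged cells leaves four kinds of terms at
  faces containing \<open>D\<close>: pairs of directions in \<open>D\<close> cancel, dropping
  \<open>\<Phi>\<close> yields the lower facets in directions of \<open>D\<close>, and directions
  outside \<open>D\<close> and shorter flags reproduce the prescribed chains of the remaining
  faces.\<close>

lemma solution_low_core:
  assumes D: "D \<noteq> {}"
  shows "fill_solution c (\<sigma>, E, F) (\<lambda>\<rho>. if D \<subseteq> \<rho> then - (sgn_n * appended c \<sigma> E F \<rho>) else 0)"
    (is "fill_solution c _ ?r")
proof -
  have app: "appended c \<sigma> E F \<rho> = (\<Sum>x\<in>D. es x E * c (\<sigma>, E - {x}, F') \<rho>)" for \<rho>
    using D by (simp add: appended_def)
  have DPhi: "x \<notin> \<Phi>" if "x \<in> D" for x using that by (simp add: core_def)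
  have DE: "x \<in> E" if "x \<in> D" for x using that D_subset_E by auto
  have oc: "open_cell \<sigma> (E - {x}) F'" if "x \<in> D" for x
    using that by (intro open_cell_append open_cell low DE DPhi basics(1))
  have finD: "finite D" using core_subset_V by (rule finite_sub)
  show ?thesis
    unfolding fill_solution_def prod.case
  proof (intro impI conjI allI)
    fix \<rho> assume nz: "?r \<rho> \<noteq> 0"
    then show "D \<subseteq> \<rho>" by (auto split: if_splits)
    have "appended c \<sigma> E F \<rho> \<noteq> 0" using nz by (auto split: if_splits)
    then obtain x where x: "x \<in> D" "c (\<sigma>, E - {x}, F') \<rho> \<noteq> 0"
      unfolding app by (metis (no_types, lifting) mult_zero_right sum.neutral)
    note v = value_nonzero[OF oc[OF x(1)] orders(1)[OF DE[OF x(1)]] x(2)]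
    show "\<rho> \<in> X" "\<rho> \<inter> \<sigma> = {}" by (rule v)+
    show "card \<rho> = Suc (card E + card F)"
      using v(4) cell_dim_face(1)[OF cell DE[OF x(1)]] basics(4) Phi_notin by simp
  next
    fix \<rho> assume \<rho>: "\<rho> \<subseteq> V" "D \<subseteq> \<rho>"
    define E' where "E' = E - D"
    have E'Phi: "y \<in> \<Phi>" "y \<in> E" "y \<notin> D" if "y \<in> E'" for y
      using that basics(2) by (auto simp: E'_def core_def)
    have E_split: "(\<Sum>x\<in>E. g x) = (\<Sum>x\<in>D. g x) + (\<Sum>x\<in>E'. g x)" for g :: "'a \<Rightarrow> int"
      unfolding E'_def using D_subset_E basics(3) by (metis add.commute sum.subset_diff)
    have E_split': "(\<Sum>y\<in>E-{x}. g y) = (\<Sum>y\<in>D-{x}. g y) + (\<Sum>y\<in>E'. g y)" if "x \<in> D" for x and g :: "'a \<Rightarrow> int"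
    proof -
      have "E - {x} = (D - {x}) \<union> E'" "(D - {x}) \<inter> E' = {}" using that D_subset_E by (auto simp: E'_def)
      then show ?thesis using finD basics(3) by (simp add: sum.union_disjoint E'_def)
    qed
    have b0: "b \<sigma> E F \<rho> = 0" by (rule b_eq_0_of_core[OF cell D \<rho>(2)])
    define \<phi> where "\<phi> x y = c (\<sigma>, E - {x} - {y}, F') \<rho>" for x y
    define \<psi> where "\<psi> x y = c (insert y \<sigma>, E - {x} - {y}, F') \<rho>" for x y
    define \<gamma> where "\<gamma> x G = c (\<sigma>, E - {x}, insert \<Phi> (F - {G})) \<rho>" for x G
    define \<kappa> where "\<kappa> = (-1 :: int) ^ card E"
    \<comment> \<open>Such a chain avoids \<open>y\<close>, whereas \<open>\<rho>\<close> contains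
      \<open>D\<close> and hence \<open>y\<close>.\<close>
    have \<psi>0: "\<psi> x y = 0" if x: "x \<in> D" and y: "y \<in> D - {x}" for x y
    proof (rule ccontr)
      assume nz: "\<psi> x y \<noteq> 0"
      have yE: "y \<in> E - {x}" using y DE by auto
      have oc': "open_cell (insert y \<sigma>) (E - {x} - {y}) F'" by (rule open_cell_face(2)[OF oc[OF x] yE])
      have "((insert y \<sigma>, E - {x} - {y}, F'), (\<sigma>, E - {x}, F')) \<in> cell_order"
        using oc[OF x] yE by (intro cell_order_face(2)) (auto simp: open_cell_def)
      then have "((insert y \<sigma>, E - {x} - {y}, F'), (\<sigma>, E, F)) \<in> cell_order"
        using orders(1)[OF DE[OF x], of F'] unfolding cell_order_def by auto
      from value_nonzero(2)[OF oc' this nz[unfolded \<psi>_def]] have "y \<notin> \<rho>" by auto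
      then show False using y \<rho>(2) by auto
    qed
    have bdx: "bd (c (\<sigma>, E - {x}, F')) \<rho> = (\<Sum>y\<in>D-{x}. es y (E - {x}) * \<phi> x y)
        + (\<Sum>y\<in>E'. es y (E - {x}) * (\<phi> x y - \<psi> x y))
        - \<kappa> * (\<Sum>G\<in>F. fs G F * \<gamma> x G) - sgn_n * c (\<sigma>, E - {x}, F) \<rho>" if x: "x \<in> D" for x
    proof -
      have cell': "cell \<sigma> (E - {x}) F'" using oc[OF x] by (simp add: open_cell_def)
      have "core (\<sigma> \<union> (E - {x})) \<subseteq> \<rho>" using core_face \<rho>(2) by blast
      then have "bd (c (\<sigma>, E - {x}, F')) \<rho> = cell_bd (sys c) \<sigma> (E - {x}) F' \<rho> + b \<sigma> (E - {x}) F' \<rho>"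
        by (intro value_bd oc x orders(1) DE \<rho>(1))
      moreover have "b \<sigma> (E - {x}) F' \<rho> = 0"
      proof (rule ccontr)
        assume "b \<sigma> (E - {x}) F' \<rho> \<noteq> 0"
        then have "\<rho> \<subseteq> \<Union>F'" by (rule b_nonzero(2)[OF cell'])
        then have "x \<in> \<Union>F'" using x \<rho>(2) by auto
        then show False using flag_psubset DPhi[OF x] by auto
      qed
      moreover have "cube_bd (sys c) \<sigma> (E - {x}) F' \<rho> = (\<Sum>y\<in>D-{x}. es y (E - {x}) * \<phi> x y)
          + (\<Sum>y\<in>E'. es y (E - {x}) * (\<phi> x y - \<psi> x y))"
        unfolding cube_bd_def E_split'[OF x] \<phi>_def[symmetric] \<psi>_def[symmetric]
        using \<psi>0[OF x] by simp
      moreover have "flag_bd (sys c) \<sigma> (E - {x}) F' \<rho> = (\<Sum>G\<in>F. fs G F * \<gamma> x G) + (-1) ^ card F * c (\<sigma>, E - {x}, F) \<rho>"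
        unfolding flag_bd_append \<gamma>_def ..
      moreover have "(-1 :: int) ^ card (E - {x}) = - \<kappa>"
        unfolding \<kappa>_def card.remove[OF basics(3) DE[OF x]] by simp
      ultimately show ?thesis
        by (simp add: cell_bd_def \<kappa>_def power_add algebra_simps)
    qed
    have "bd ?r \<rho> = bd (\<lambda>\<rho>. - (sgn_n * (\<Sum>x\<in>D. es x E * c (\<sigma>, E - {x}, F') \<rho>))) \<rho>"
      using \<rho>(2) by (intro bd_cong) (auto simp: app)
    also have "\<dots> = - (sgn_n * (\<Sum>x\<in>D. es x E * bd (c (\<sigma>, E - {x}, F')) \<rho>))"
      by (simp add: bd_uminus bd_scale bd_sum)
    also have "(\<Sum>x\<in>D. es x E * bd (c (\<sigma>, E - {x}, F')) \<rho>) =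
        (\<Sum>x\<in>D. \<Sum>y\<in>D-{x}. es x E * es y (E - {x}) * \<phi> x y)
        + (\<Sum>x\<in>D. \<Sum>y\<in>E'. es x E * es y (E - {x}) * (\<phi> x y - \<psi> x y))
        - \<kappa> * (\<Sum>x\<in>D. \<Sum>G\<in>F. es x E * fs G F * \<gamma> x G)
        - sgn_n * (\<Sum>x\<in>D. es x E * c (\<sigma>, E - {x}, F) \<rho>)"
    proof -
      have "(\<Sum>x\<in>D. es x E * bd (c (\<sigma>, E - {x}, F')) \<rho>) = (\<Sum>x\<in>D. (\<Sum>y\<in>D-{x}. es x E * es y (E - {x}) * \<phi> x y)
          + (\<Sum>y\<in>E'. es x E * es y (E - {x}) * (\<phi> x y - \<psi> x y))
          - \<kappa> * (\<Sum>G\<in>F. es x E * fs G F * \<gamma> x G) - sgn_n * (es x E * c (\<sigma>, E - {x}, F) \<rho>))"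
      proof (rule sum.cong[OF refl])
        fix x assume x: "x \<in> D"
        have dist: "es x E * (A + B - \<kappa> * C - sgn_n * e) = es x E * A + es x E * B - \<kappa> * (es x E * C) - sgn_n * (es x E * e)" for A B C e :: int
          by (simp add: algebra_simps)
        show "es x E * bd (c (\<sigma>, E - {x}, F')) \<rho> = (\<Sum>y\<in>D-{x}. es x E * es y (E - {x}) * \<phi> x y)
          + (\<Sum>y\<in>E'. es x E * es y (E - {x}) * (\<phi> x y - \<psi> x y))
          - \<kappa> * (\<Sum>G\<in>F. es x E * fs G F * \<gamma> x G) - sgn_n * (es x E * c (\<sigma>, E - {x}, F) \<rho>)"
          unfolding bdx[OF x] dist by (simp only: sum_distrib_left mult.assoc)
      qed
      then show ?thesis
        by (simp only: sum.distrib sum_subtractf sum_distrib_left)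
    qed
    \<comment> \<open>Deleting two directions of \<open>D\<close> in either order gives the same
      cell with opposite signs.\<close>
    also have "(\<Sum>x\<in>D. \<Sum>y\<in>D-{x}. es x E * es y (E - {x}) * \<phi> x y) = 0"
    proof (rule sum_antisymmetric[OF finD])
      fix x y assume xy: "x \<in> D" "y \<in> D" "x \<noteq> y"
      have "\<phi> x y = \<phi> y x" unfolding \<phi>_def by (simp add: insert_commute Diff_insert2[symmetric] flip: Diff_insert)
      then show "es x E * es y (E - {x}) * \<phi> x y = - (es y E * es x (E - {y}) * \<phi> y x)"
        using es_swap[OF basics(2) DE[OF xy(1)] DE[OF xy(2)] xy(3)] by simp
    qed
    finally have lhs: "bd ?r \<rho> = - (sgn_n * (\<Sum>x\<in>D. \<Sum>y\<in>E'. es x E * es y (E - {x}) * (\<phi> x y - \<psi> x y)))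
        + sgn_n * (\<kappa> * (\<Sum>x\<in>D. \<Sum>G\<in>F. es x E * fs G F * \<gamma> x G))
        + (sgn_n * sgn_n) * (\<Sum>x\<in>D. es x E * c (\<sigma>, E - {x}, F) \<rho>)"
      by (simp add: algebra_simps)
    have sq: "sgn_n * sgn_n = 1" by (simp flip: power_mult_distrib)
    have partD: "(\<Sum>x\<in>D. es x E * (c (\<sigma>, E - {x}, F) \<rho> - c (insert x \<sigma>, E - {x}, F) \<rho>))
        = (\<Sum>x\<in>D. es x E * c (\<sigma>, E - {x}, F) \<rho>)"
    proof (rule sum.cong[OF refl])
      fix x assume x: "x \<in> D"
      have "c (insert x \<sigma>, E - {x}, F) \<rho> = 0"
        using face_nonzero(2)[OF DE[OF x], of \<rho>] x \<rho>(2) by auto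
      then show "es x E * (c (\<sigma>, E - {x}, F) \<rho> - c (insert x \<sigma>, E - {x}, F) \<rho>) = es x E * c (\<sigma>, E - {x}, F) \<rho>"
        by simp
    qed
    \<comment> \<open>For \<open>y\<close> outside \<open>D\<close>, the prescribed chains of both
      facets are sums over the same \<open>D\<close>; exchanging \<open>x\<close> and
      \<open>y\<close> supplies the minus sign.\<close>
    have partE: "(\<Sum>y\<in>E'. es y E * (c (\<sigma>, E - {y}, F) \<rho> - c (insert y \<sigma>, E - {y}, F) \<rho>))
        = - (sgn_n * (\<Sum>x\<in>D. \<Sum>y\<in>E'. es x E * es y (E - {x}) * (\<phi> x y - \<psi> x y)))"
    proof -
      have "es y E * (c (\<sigma>, E - {y}, F) \<rho> - c (insert y \<sigma>, E - {y}, F) \<rho>)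
          = (\<Sum>x\<in>D. - (sgn_n * (es x E * es y (E - {x}) * (\<phi> x y - \<psi> x y))))" if y: "y \<in> E'" for y
      proof -
        note yP = E'Phi(2,1)[OF y]
        have a1: "appended c \<sigma> (E - {y}) F \<rho> = (\<Sum>x\<in>D. es x (E - {y}) * \<phi> x y)"
          using D core_face_eq[OF yP] flat_off_face[OF yP]
          by (simp add: appended_def \<phi>_def Diff_insert2[symmetric] insert_commute flip: Diff_insert)
        have a2: "appended c (insert y \<sigma>) (E - {y}) F \<rho> = (\<Sum>x\<in>D. es x (E - {y}) * \<psi> x y)"
          using D Un_faces[OF yP(1)]
          by (simp add: appended_def \<psi>_def Diff_insert2[symmetric] insert_commute flip: Diff_insert)
        have "es y E * (c (\<sigma>, E - {y}, F) \<rho> - c (insert y \<sigma>, E - {y}, F) \<rho>)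
            = es y E * (sgn_n * (\<Sum>x\<in>D. es x (E - {y}) * (\<phi> x y - \<psi> x y)))"
          unfolding face_values(1,2)[OF \<rho>(2) yP] a1 a2
          by (simp add: sum_subtractf right_diff_distrib)
        also have "\<dots> = (\<Sum>x\<in>D. sgn_n * ((es y E * es x (E - {y})) * (\<phi> x y - \<psi> x y)))"
          by (simp only: sum_distrib_left mult.assoc mult.left_commute[of "es y E"])
        also have "\<dots> = (\<Sum>x\<in>D. - (sgn_n * (es x E * es y (E - {x}) * (\<phi> x y - \<psi> x y))))"
        proof (rule sum.cong[OF refl])
          fix x assume x: "x \<in> D"
          have "es y E * es x (E - {y}) = - (es x E * es y (E - {x}))"
            using x E'Phi(3)[OF y] by (intro es_swap basics(2) yP(1) DE) auto
          then show "sgn_n * ((es y E * es x (E - {y})) * (\<phi> x y - \<psi> x y))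
              = - (sgn_n * (es x E * es y (E - {x}) * (\<phi> x y - \<psi> x y)))" by simp
        qed
        finally show ?thesis .
      qed
      then have "(\<Sum>y\<in>E'. es y E * (c (\<sigma>, E - {y}, F) \<rho> - c (insert y \<sigma>, E - {y}, F) \<rho>))
          = (\<Sum>y\<in>E'. \<Sum>x\<in>D. - (sgn_n * (es x E * es y (E - {x}) * (\<phi> x y - \<psi> x y))))"
        by (rule sum.cong[OF refl])
      also have "\<dots> = (\<Sum>x\<in>D. \<Sum>y\<in>E'. - (sgn_n * (es x E * es y (E - {x}) * (\<phi> x y - \<psi> x y))))"
        by (rule sum.swap)
      finally show ?thesis by (simp only: sum_negf sum_distrib_left)
    qed
    have partF: "\<kappa> * flag_bd (sys c) \<sigma> E F \<rho> = sgn_n * (\<kappa> * (\<Sum>x\<in>D. \<Sum>G\<in>F. es x E * fs G F * \<gamma> x G))"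
    proof -
      have "flag_bd (sys c) \<sigma> E F \<rho> = (\<Sum>G\<in>F. \<Sum>x\<in>D. sgn_n * (es x E * fs G F * \<gamma> x G))"
        unfolding flag_bd_def
      proof (rule sum.cong[OF refl])
        fix G assume G: "G \<in> F"
        have "c (\<sigma>, E, F - {G}) \<rho> = sgn_n * (\<Sum>x\<in>D. es x E * \<gamma> x G)"
          unfolding face_values(3)[OF \<rho>(2) G] using D by (simp add: appended_def \<gamma>_def)
        then show "fs G F * c (\<sigma>, E, F - {G}) \<rho> = (\<Sum>x\<in>D. sgn_n * (es x E * fs G F * \<gamma> x G))"
          by (simp add: sum_distrib_left algebra_simps)
      qed
      also have "\<dots> = (\<Sum>x\<in>D. \<Sum>G\<in>F. sgn_n * (es x E * fs G F * \<gamma> x G))" by (rule sum.swap)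
      finally show ?thesis by (simp add: sum_distrib_left mult.left_commute)
    qed
    have "cell_bd (sys c) \<sigma> E F \<rho> = (\<Sum>x\<in>D. es x E * c (\<sigma>, E - {x}, F) \<rho>)
        + - (sgn_n * (\<Sum>x\<in>D. \<Sum>y\<in>E'. es x E * es y (E - {x}) * (\<phi> x y - \<psi> x y)))
        + sgn_n * (\<kappa> * (\<Sum>x\<in>D. \<Sum>G\<in>F. es x E * fs G F * \<gamma> x G))"
      unfolding cell_bd_def cube_bd_def E_split partD partE \<kappa>_def[symmetric] partF ..
    then show "bd ?r \<rho> = cell_bd (sys c) \<sigma> E F \<rho> + b \<sigma> E F \<rho>"
      using lhs sq b0 by simp
  next
    fix \<rho> assume "D \<subseteq> \<rho>"
    then show "?r \<rho> = - (sgn_n * appended c \<sigma> E F \<rho>)" by simp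
  qed
qed

end

lemma solution_exists: "\<exists>r. fill_solution c (\<sigma>, E, F) r"
proof (cases "\<sigma> \<inter> D = {}")
  case False
  then show ?thesis using solution_blocked by blast
next
  case free: True
  show ?thesis
  proof (cases "low \<sigma> E F")
    case False
    then show ?thesis using solution_high[OF free] by blast
  next
    case low: True
    show ?thesis
      using solution_low_spanning[OF low free] solution_low_core[OF low free] by (cases "D = {}") blast+
  qed
qed

end

section \<open>Trace contradiction and the theorem\<close>

context leray_above_matroid
begin

text \<open>The values entering \<open>appended\<close> are earlier in \<open>cell_order\<close>
  because each \<open>x\<close> in the core lies in \<open>E\<close>. This uses the guard
  \<open>\<sigma> \<inter> core (\<sigma> \<union> E) = {}\<close>: an \<open>x\<close> in
  \<open>\<sigma>\<close> would leave \<open>E\<close> and the size of the cell unchanged.\<close>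

lemma fill_solution_cong:
  assumes eq: "\<And>q. (q, p) \<in> cell_order \<Longrightarrow> c q = c' q"
  shows "fill_solution c p r = fill_solution c' p r"
proof -
  obtain \<sigma> E F where p: "p = (\<sigma>, E, F)" by (cases p)
  have *: "cell_bd (sys c) \<sigma> E F \<rho> = cell_bd (sys c') \<sigma> E F \<rho>" if "open_cell \<sigma> E F" for \<rho>
  proof (rule cell_bd_cong)
    have cell: "cell \<sigma> E F" using that by (simp add: open_cell_def)
    note ord = cell_order_face[OF cell, folded p]
    show "c (\<sigma>, E - {x}, F) \<rho> - c (insert x \<sigma>, E - {x}, F) \<rho>
        = c' (\<sigma>, E - {x}, F) \<rho> - c' (insert x \<sigma>, E - {x}, F) \<rho>" if "x \<in> E" for x
      using eq[OF ord(1)[OF that]] eq[OF ord(2)[OF that]] by simp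
    show "c (\<sigma>, E, F - {G}) \<rho> = c' (\<sigma>, E, F - {G}) \<rho>" if "G \<in> F" for G
      using eq[OF ord(3)[OF that]] by simp
  qed
  have **: "appended c \<sigma> E F \<rho> = appended c' \<sigma> E F \<rho>"
    if oc: "open_cell \<sigma> E F" and free: "\<sigma> \<inter> core (\<sigma> \<union> E) = {}" for \<rho>
  proof -
    have "c (\<sigma>, E - {x}, F') = c' (\<sigma>, E - {x}, F')" if "x \<in> core (\<sigma> \<union> E)" for x F'
    proof -
      have "x \<in> E" using that core_subset[of "\<sigma> \<union> E"] free by auto
      moreover have "cell \<sigma> E F" using oc by (simp add: open_cell_def)
      ultimately show ?thesis unfolding p by (intro eq[unfolded p] cell_order_face(1))
    qed
    then show ?thesis by (simp add: appended_def cong: sum.cong)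
  qed
  show ?thesis
    unfolding fill_solution_def p prod.case
  proof (rule imp_cong[OF refl])
    assume oc: "open_cell \<sigma> E F"
    show "((\<forall>\<rho>. r \<rho> \<noteq> 0 \<longrightarrow> \<rho> \<in> X \<and> \<rho> \<inter> \<sigma> = {} \<and> core (\<sigma> \<union> E) \<subseteq> \<rho> \<and> card \<rho> = Suc (card E + card F))
     \<and> (\<forall>\<rho>\<subseteq>V. core (\<sigma> \<union> E) \<subseteq> \<rho> \<longrightarrow> bd r \<rho> = cell_bd (sys c) \<sigma> E F \<rho> + b \<sigma> E F \<rho>)
     \<and> (low \<sigma> E F \<and> \<sigma> \<inter> core (\<sigma> \<union> E) = {} \<longrightarrow>
          (\<forall>\<rho>. core (\<sigma> \<union> E) \<subseteq> \<rho> \<longrightarrow> r \<rho> = - ((-1) ^ (card E + card F) * appended c \<sigma> E F \<rho>)))) \<longleftrightarrow>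
     ((\<forall>\<rho>. r \<rho> \<noteq> 0 \<longrightarrow> \<rho> \<in> X \<and> \<rho> \<inter> \<sigma> = {} \<and> core (\<sigma> \<union> E) \<subseteq> \<rho> \<and> card \<rho> = Suc (card E + card F))
     \<and> (\<forall>\<rho>\<subseteq>V. core (\<sigma> \<union> E) \<subseteq> \<rho> \<longrightarrow> bd r \<rho> = cell_bd (sys c') \<sigma> E F \<rho> + b \<sigma> E F \<rho>)
     \<and> (low \<sigma> E F \<and> \<sigma> \<inter> core (\<sigma> \<union> E) = {} \<longrightarrow>
          (\<forall>\<rho>. core (\<sigma> \<union> E) \<subseteq> \<rho> \<longrightarrow> r \<rho> = - ((-1) ^ (card E + card F) * appended c' \<sigma> E F \<rho>))))"
      unfolding *[OF oc] using **[OF oc]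
      by (cases "\<sigma> \<inter> core (\<sigma> \<union> E) = {}") simp_all
  qed
qed

lemma family_exists: "\<exists>c. \<forall>p. fill_solution c p (c p)"
proof (rule dependent_wf_choice[OF wf_cell_order])
  fix c c' :: "'a family" and p r
  assume "\<And>q. (q, p) \<in> cell_order \<Longrightarrow> c q = c' q"
  then show "fill_solution c p r = fill_solution c' p r" by (rule fill_solution_cong)
next
  fix p and c :: "'a family"
  assume IH: "\<And>q. (q, p) \<in> cell_order \<Longrightarrow> fill_solution c q (c q)"
  obtain \<sigma> E F where p: "p = (\<sigma>, E, F)" by (cases p)
  show "\<exists>r. fill_solution c p r"
  proof (cases "open_cell \<sigma> E F")
    case True
    interpret fill_step V pos M X b c \<sigma> E F
      by unfold_locales (use IH True p in auto)
    show ?thesis unfolding p by (rule solution_exists)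
  next
    case False
    then show ?thesis by (simp add: p fill_solution_def)
  qed
qed

lemma trace_contradiction: False
proof -
  obtain c where c: "\<And>p. fill_solution c p (c p)" using family_exists by blast
  define h where "h \<tau> = c ({}, \<tau>, {})" for \<tau>
  have oc: "open_cell {} \<tau> {}" if "\<tau> \<subseteq> V" for \<tau>
    using that by (simp add: open_cell_def cell_def)
  have oc1: "open_cell {x} (\<tau> - {x}) {}" if "\<tau> \<subseteq> V" "x \<in> \<tau>" for \<tau> x
    using open_cell_face(2)[OF oc[OF that(1)] that(2)] .
  have eq: "(\<Sum>x\<in>V-\<tau>. es x \<tau> * h \<tau> (insert x \<tau>)) = (\<Sum>x\<in>\<tau>. es x \<tau> * h (\<tau> - {x}) \<tau>) + (if \<tau> = {} then 1 else 0)"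
    if \<tau>: "\<tau> \<subseteq> V" for \<tau>
  proof -
    have "bd (h \<tau>) \<tau> = cell_bd (sys c) {} \<tau> {} \<tau> + b {} \<tau> {} \<tau>"
      using c[of "({}, \<tau>, {})"] oc[OF \<tau>] \<tau> core_subset[of \<tau>] by (simp add: fill_solution_def h_def)
    moreover have "cell_bd (sys c) {} \<tau> {} \<tau> = (\<Sum>x\<in>\<tau>. es x \<tau> * h (\<tau> - {x}) \<tau>)"
    proof -
      \<comment> \<open>Chains with base point \<open>{x}\<close> avoid \<open>x\<close>, so the
        upper facets contribute nothing at \<open>\<tau>\<close> and only the chains
        \<open>h (\<tau> - {x})\<close> remain.\<close>
      have "c ({x}, \<tau> - {x}, {}) \<tau> = 0" if x: "x \<in> \<tau>" for x
      proof (rule ccontr)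
        assume "c ({x}, \<tau> - {x}, {}) \<tau> \<noteq> 0"
        with c[of "({x}, \<tau> - {x}, {})", unfolded fill_solution_def prod.case, THEN mp, OF oc1[OF \<tau> x], THEN conjunct1, THEN spec, of \<tau>]
        have "\<tau> \<inter> {x} = {}" by simp
        then show False using x by simp
      qed
      then show ?thesis by (simp add: cell_bd_def cube_bd_def flag_bd_def h_def cong: sum.cong)
    qed
    ultimately show ?thesis by (simp add: bd_def b_empty)
  qed
  have fin: "finite \<tau>" if "\<tau> \<in> Pow V" for \<tau> using that by (simp add: finite_sub)
  have "(\<Sum>\<tau>\<in>Pow V. \<Sum>x\<in>V-\<tau>. es x \<tau> * h \<tau> (insert x \<tau>))
      = (\<Sum>(\<tau>, x)\<in>Sigma (Pow V) (\<lambda>\<tau>. V - \<tau>). es x \<tau> * h \<tau> (insert x \<tau>))"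
    using finite_V by (intro sum.Sigma) auto
  \<comment> \<open>A pair with \<open>x\<close> outside \<open>\<tau>\<close> corresponds to the
    pair with \<open>x\<close> added to \<open>\<tau>\<close>; the sign agrees because a vertex does
    not count itself. Both totals coincide, so only the 1 from the empty set is left over.\<close>
  also have "\<dots> = (\<Sum>(\<tau>, x)\<in>Sigma (Pow V) (\<lambda>\<tau>. \<tau>). es x \<tau> * h (\<tau> - {x}) \<tau>)"
    by (rule sum.reindex_bij_witness[of _ "\<lambda>(\<tau>, x). (\<tau> - {x}, x)" "\<lambda>(\<tau>, x). (insert x \<tau>, x)"])
      (auto simp: insert_absorb esign_insert_self)
  also have "\<dots> = (\<Sum>\<tau>\<in>Pow V. \<Sum>x\<in>\<tau>. es x \<tau> * h (\<tau> - {x}) \<tau>)"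
    using finite_V fin by (intro sum.Sigma[symmetric]) auto
  finally have "(\<Sum>\<tau>\<in>Pow V. \<Sum>x\<in>V-\<tau>. es x \<tau> * h \<tau> (insert x \<tau>))
      = (\<Sum>\<tau>\<in>Pow V. \<Sum>x\<in>\<tau>. es x \<tau> * h (\<tau> - {x}) \<tau>)" .
  moreover have "(\<Sum>\<tau>\<in>Pow V. \<Sum>x\<in>V-\<tau>. es x \<tau> * h \<tau> (insert x \<tau>))
      = (\<Sum>\<tau>\<in>Pow V. (\<Sum>x\<in>\<tau>. es x \<tau> * h (\<tau> - {x}) \<tau>) + (if \<tau> = {} then 1 else 0))"
    using eq by (intro sum.cong) auto
  moreover have "(\<Sum>\<tau>\<in>Pow V. if \<tau> = {} then 1 else 0 :: int) = 1"
    using finite_V by (simp add: sum.delta)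
  ultimately show False by (simp add: sum.distrib)
qed

end

lemma bounding_from_of_leray_number_link:
  assumes "ordered_ground V pos" "down_closed X" "X \<subseteq> Pow V" "A \<subseteq> B" "B \<subseteq> V" "leray_number (link X A) \<le> j"
  shows "ordered_ground.bounding_from V pos j (link X B)"
proof -
  interpret ordered_ground V pos by (rule assms(1))
  have "link X A \<subseteq> Pow V" using assms(3) link_subset by blast
  then have "bounding_from j (link X A)" using assms(6) by (rule bounding_from_leray_number)
  then show ?thesis using assms by (intro bounding_from_link[of X A B])
qed

lemma flat_with_large_links:
  fixes X M :: "'a set set"
  assumes X: "simplicial_complex X" "vertex_set X = V" and M: "matroid M" "M \<subseteq> X" "vertex_set M = V"
  obtains G where "matroid_span M G = G" "G \<subseteq> V" "V - G \<in> X"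
    "\<And>A. A \<subseteq> V - G \<Longrightarrow> rank_of M G \<le> leray_number (link X A)"
proof (rule ccontr)
  note witness = that
  assume "\<not> thesis"
  then have small: "\<exists>A\<subseteq>V - G. \<not> rank_of M G \<le> leray_number (link X A)"
    if "matroid_span M G = G" "G \<subseteq> V" "V - G \<in> X" for G
    using witness[OF that] by blast
  have dc: "down_closed X" "X \<subseteq> Pow V"
    using X by (auto simp: simplicial_complex_down_closed vertex_set_def)
  have "finite V" using X by (auto simp: simplicial_complex_def vertex_set_def)
  then obtain pos :: "'a \<Rightarrow> nat" where "inj_on pos V"
    using finite_imp_inj_to_nat_seg by blast
  then interpret ordered_matroid V pos M
    using \<open>finite V\<close> M by unfold_locales auto
  obtain b where b: "\<And>\<sigma> E F. cell \<sigma> E F \<Longrightarrow> supported_system b \<sigma> E F"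
    "\<And>\<sigma> E \<rho>. b \<sigma> E {} \<rho> = (if E = {} \<and> \<rho> = {} then 1 else 0)"
    using flag_system_exists by blast
  interpret leray_above_matroid V pos M X b
  proof
    show "1 \<le> rk G \<and> bounding_from (rk G - 1) (link X (V - G))" if G: "cl G = G" "G \<subseteq> V" "V - G \<in> X" for G
    proof -
      \<comment> \<open>The strict inequality at \<open>A\<close> forces \<open>rk G\<close> to be
        positive, and the bound passes to the larger set \<open>V - G\<close> because links do not
        raise the Leray number.\<close>
      obtain A where A: "A \<subseteq> V - G" "\<not> rk G \<le> leray_number (link X A)" using small[OF G] by blast
      then show ?thesis
        using bounding_from_of_leray_number_link[OF ordered_ground_axioms dc A(1)] by auto
    qed
  qed (use dc M b in auto)
  show False by (rule trace_contradiction)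
qed

theorem theorem2p4:
  fixes d r :: nat and X M :: "'a set set" and V :: "'a set"
  assumes "r \<ge> d + 1"
    and "simplicial_complex X" and "vertex_set X = V" and "leray d X"
    and "matroid M" and "matroid_rank M = r"
    and "M \<subseteq> X" and "vertex_set M = V"
  shows "\<exists>B\<in>bases M. (\<Sum>v\<in>B. link_leray_dim X (V - matroid_span M (B - {v}))) \<ge> 0"
proof -
  interpret matroid_ground M by unfold_locales (rule assms)
  have X: "down_closed X"
    using assms(2) by (rule simplicial_complex_down_closed)
  have ind: "induced M V = M" using assms(8) by (auto simp: induced_def vertex_set_def)
  then have rkV: "rank_of M V = r" using assms(6) by (simp add: rank_of_def)
  obtain G where G: "matroid_span M G = G" "G \<subseteq> V" "V - G \<in> X"
    and large: "\<And>A. A \<subseteq> V - G \<Longrightarrow> rank_of M G \<le> leray_number (link X A)"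
    using flat_with_large_links[OF assms(2,3,5,7,8)] by metis
  define q where "q = rank_of M G"
  \<comment> \<open>With \<open>A = {}\<close> the link is \<open>X\<close> itself, so
    \<open>q \<le> L(X) \<le> d < r\<close>.\<close>
  have "q < r"
    using large[of "{}"] assms(1,4) by (simp add: q_def leray_def link_empty)
  obtain I where I: "I \<in> M" "I \<subseteq> G" "card I = q"
    using indep_extend[OF empty_indep, of G] by (metis empty_subsetI q_def)
  have G_span: "G \<subseteq> matroid_span M I"
    using I G(2) assms(8) by (intro subset_span_basis) (auto simp: q_def)
  have "I \<subseteq> V" using I(2) G(2) by auto
  obtain B where B: "I \<subseteq> B" "card B = r" "B \<in> bases M" "B \<in> M"
    using indep_extend[OF I(1) \<open>I \<subseteq> V\<close>] rkV ind by metis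
  have finB: "finite B" using B(4) by (rule finite_indep)
  let ?\<delta> = "\<lambda>v. link_leray_dim X (V - matroid_span M (B - {v}))"
  have "int q \<le> ?\<delta> v" if "v \<in> B - I" for v
  proof -
    have "matroid_span M I \<subseteq> matroid_span M (B - {v})" using that B(1) by (intro span_mono) auto
    then have "V - matroid_span M (B - {v}) \<subseteq> V - G" using G_span by auto
    then show ?thesis
      using large down_closedD[OF X G(3)] by (simp add: link_leray_dim_def q_def)
  qed
  then have "int (card (B - I)) * int q \<le> (\<Sum>v\<in>B - I. ?\<delta> v)"
    by (intro sum_bounded_below) auto
  moreover have "int (card I) * (- 1) \<le> (\<Sum>v\<in>I. ?\<delta> v)"
    by (intro sum_bounded_below) (simp add: link_leray_dim_def)
  moreover have "(\<Sum>v\<in>B. ?\<delta> v) = (\<Sum>v\<in>B - I. ?\<delta> v) + (\<Sum>v\<in>I. ?\<delta> v)"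
    by (rule sum.subset_diff[OF B(1) finB])
  \<comment> \<open>One element outside \<open>I\<close> already contributes \<open>q\<close>, which
    balances the total of at least \<open>- q\<close> from the \<open>q\<close> elements of
    \<open>I\<close>.\<close>
  moreover have "1 \<le> card (B - I)"
    using B I finB \<open>q < r\<close> by (simp add: card_Diff_subset finite_subset)
  then have "int q \<le> int (card (B - I)) * int q" by (simp add: mult_le_cancel_right1)
  ultimately have "0 \<le> (\<Sum>v\<in>B. ?\<delta> v)" using I(3) by simp
  then show ?thesis using B(3) by blast
qed

end
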